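(* Let $X=\{X(s,t);\,(s,t)\in[0,S]\times[0,T]\}$ be a complex-valued continuous process with $X(s,0)=X(0,t)=0$ for all $s\in[0,S]$, $t\in[0,T]$, write $X=X^1+iX^2$ with $X^1,X^2$ real, and let $\{\mathcal{F}_{s,t}\}$ be the natural filtration of $X$. Then the following are equivalent: (i) $X$ is a complex Brownian sheet; (ii) $X^1$ and $X^2$ are strong martingales with respect to $\{\mathcal{F}_{s,t}\}$ and, for all $(0,0)<(s,t)\le(s',t')\le(S,T)$ and $j=1,2$, $$\mathbb{E}\big[(\Delta_{s,t}X^j(s',t'))^2\,\big|\,\mathcal{F}_{s,T}\big]=(s'-s)(t'-t),\qquad \mathbb{E}\big[\Delta_{s,t}X^1(s',t')\,\Delta_{s,t}X^2(s',t')\,\big|\,\mathcal{F}_{s,T}\big]=0.$$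
   Context: Partial order: $(s,t)<(s',t')$ means $s<s'$ and $t<t'$; $(s,t)\le(s',t')$ means $s\le s'$, $t\le t'$. Rectangular increment: $\Delta_{s,t}Y(s',t')=Y(s',t')-Y(s,t')-Y(s',t)+Y(s,t)$. The natural filtration is $\mathcal{F}_{s,t}=\sigma\{X(u,v);\,u\le s,v\le t\}$, suitably completed. An adapted real process $Y$ is a strong martingale if $\mathbb{E}|Y(s,t)|<\infty$ for all $(s,t)$, $Y(s,0)=Y(0,t)=0$, and $\mathbb{E}[\Delta_{s,t}Y(s',t')\,|\,\mathcal{F}_{S,t}\vee\mathcal{F}_{s,T}]=0$ for all $(s,t)<(s',t')$. A Brownian sheet is an adapted process $W$ with $W(s,0)=W(0,t)=0$ a.s., whose increments $\Delta_{s,t}W(s',t')$ are independent of $\mathcal{F}_{S,t}\vee\mathcal{F}_{s,T}$ and $N(0,(s'-s)(t'-t))$-distributed. A complex Brownian sheet is a complex process whose real and imaginary parts are independent Brownian sheets. *)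

theory Defs
  imports "HOL-Probability.Probability"
begin

definition rect_incr :: "(real \<Rightarrow> real \<Rightarrow> 'a \<Rightarrow> 'b::ab_group_add) \<Rightarrow> real \<Rightarrow> real \<Rightarrow> real \<Rightarrow> real \<Rightarrow> 'a \<Rightarrow> 'b" where
  "rect_incr Y s t s' t' \<omega> = Y s' t' \<omega> - Y s t' \<omega> - Y s' t \<omega> + Y s t \<omega>"

definition nat_filt :: "'a measure \<Rightarrow> (real \<Rightarrow> real \<Rightarrow> 'a \<Rightarrow> 'b::topological_space) \<Rightarrow> real \<Rightarrow> real \<Rightarrow> 'a measure" where
  "nat_filt M X s t = sigma (space M)
     ({X u v -` B \<inter> space M | u v B. 0 \<le> u \<and> u \<le> s \<and> 0 \<le> v \<and> v \<le> t \<and> B \<in> sets borel}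
      \<union> null_sets M)"

definition join_alg :: "'a measure \<Rightarrow> 'a measure \<Rightarrow> 'a measure \<Rightarrow> 'a measure" where
  "join_alg M A B = sigma (space M) (sets A \<union> sets B)"

definition strong_martingale :: "'a measure \<Rightarrow> (real \<Rightarrow> real \<Rightarrow> 'a measure) \<Rightarrow> real \<Rightarrow> real \<Rightarrow> (real \<Rightarrow> real \<Rightarrow> 'a \<Rightarrow> real) \<Rightarrow> bool" where
  "strong_martingale M F S T Y \<longleftrightarrow>
     (\<forall>s\<in>{0..S}. \<forall>t\<in>{0..T}. Y s t \<in> borel_measurable (F s t) \<and> integrable M (Y s t)) \<and>
     (\<forall>s\<in>{0..S}. \<forall>\<omega>\<in>space M. Y s 0 \<omega> = 0) \<and>
     (\<forall>t\<in>{0..T}. \<forall>\<omega>\<in>space M. Y 0 t \<omega> = 0) \<and>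
     (\<forall>s t s' t'. 0 \<le> s \<and> 0 \<le> t \<and> s < s' \<and> t < t' \<and> s' \<le> S \<and> t' \<le> T \<longrightarrow>
        (AE \<omega> in M. real_cond_exp M (join_alg M (F S t) (F s T)) (rect_incr Y s t s' t') \<omega> = 0))"

definition brownian_sheet :: "'a measure \<Rightarrow> (real \<Rightarrow> real \<Rightarrow> 'a measure) \<Rightarrow> real \<Rightarrow> real \<Rightarrow> (real \<Rightarrow> real \<Rightarrow> 'a \<Rightarrow> real) \<Rightarrow> bool" where
  "brownian_sheet M F S T W \<longleftrightarrow>
     (\<forall>s\<in>{0..S}. \<forall>t\<in>{0..T}. W s t \<in> borel_measurable (F s t)) \<and>
     (\<forall>s\<in>{0..S}. AE \<omega> in M. W s 0 \<omega> = 0) \<and>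
     (\<forall>t\<in>{0..T}. AE \<omega> in M. W 0 t \<omega> = 0) \<and>
     (\<forall>s t s' t'. 0 \<le> s \<and> 0 \<le> t \<and> s < s' \<and> t < t' \<and> s' \<le> S \<and> t' \<le> T \<longrightarrow>
        prob_space.indep_set M
          {rect_incr W s t s' t' -` B \<inter> space M | B. B \<in> sets borel}
          (sets (join_alg M (F S t) (F s T))) \<and>
        distributed M lborel (rect_incr W s t s' t')
          (normal_density 0 (sqrt ((s' - s) * (t' - t)))))"

definition proc_sigma :: "'a measure \<Rightarrow> real \<Rightarrow> real \<Rightarrow> (real \<Rightarrow> real \<Rightarrow> 'a \<Rightarrow> real) \<Rightarrow> 'a set set" where
  "proc_sigma M S T Y = sigma_sets (space M)
     {Y u v -` B \<inter> space M | u v B. 0 \<le> u \<and> u \<le> S \<and> 0 \<le> v \<and> v \<le> T \<and> B \<in> sets borel}"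

definition complex_brownian_sheet :: "'a measure \<Rightarrow> (real \<Rightarrow> real \<Rightarrow> 'a measure) \<Rightarrow> real \<Rightarrow> real \<Rightarrow> (real \<Rightarrow> real \<Rightarrow> 'a \<Rightarrow> complex) \<Rightarrow> bool" where
  "complex_brownian_sheet M F S T X \<longleftrightarrow>
     brownian_sheet M F S T (\<lambda>s t \<omega>. Re (X s t \<omega>)) \<and>
     brownian_sheet M F S T (\<lambda>s t \<omega>. Im (X s t \<omega>)) \<and>
     prob_space.indep_set M (proc_sigma M S T (\<lambda>s t \<omega>. Re (X s t \<omega>)))
                            (proc_sigma M S T (\<lambda>s t \<omega>. Im (X s t \<omega>)))"

end

theory Submission
  imports Defs
begin

text \<open>For fixed \<open>s\<close>, \<open>t\<close>, \<open>t'\<close> a real combination \<open>Z\<^sub>r\<close> of the two increments over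
  \<open>[s, r] \<times> [t, t']\<close> is a continuous martingale in \<open>r\<close> with bracket proportional to \<open>r - s\<close>, so (ii)
  implies (i) by P. Levy's characterisation. The version needed here is proved without stochastic
  integration: the characteristic function is expanded to second order along a partition of the
  \<open>r\<close>-axis, the remainder being controlled by stopping at the first large increment. This makes the
  increments Gaussian, hence gives fourth moments, and the sums of squared increments converge in
  \<open>L\<^sup>2\<close> to the bracket. The bracket is therefore the same for the filtration
  \<open>F(S,t) \<or> F(r,T)\<close>, in which the strong martingale property makes \<open>Z\<close> a martingale, and a second expansion
  shows that the increment of \<open>Z\<close> from \<open>s\<close> on is Gaussian and independent of \<open>F(S,t) \<or> F(s,T)\<close>. Multiplying over the cells of
  a fine grid factorises the joint characteristic function of the real and imaginary parts, which
  gives their independence.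

  For the converse only the conditional covariance is not immediate; it vanishes on the sets
  \<open>A \<inter> B\<close> with \<open>A\<close> and \<open>B\<close> generated by the real and the imaginary part respectively, and these sets together with the
  null sets generate \<open>F(s,T)\<close>.\<close>

section \<open>Conditioning and Fourier uniqueness\<close>

text \<open>The conditional variances in (ii) refer to \<open>F s T\<close>, whereas (i) asks for
  independence of the larger \<open>join_alg M (F S t) (F s T)\<close>, on which only the mean of an
  increment is prescribed. One expansion therefore cannot reach (i): the first is run in the small
  filtration and only for unconditional laws, the second against sets of the large one. They also
  differ in what they can afford. At first only second moments are at hand, so the remainder is
  small through path continuity alone and large increments must be cut out. Once the increments are
  Gaussian, fourth moments bound the remainder by a multiple of \<open>1 / sqrt n\<close> without
  truncation. Condition (ii) is silent on rectangles touching the axes; these are reached from the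
  interior by continuity. Independence is expressed throughout by a bounded complex weight, such as
  \<open>indicator A x - prob A\<close>, whose integral against every character vanishes. Fourier
  uniqueness replaces the characters by indicators.\<close>

context prob_space begin

lemma integrable_mult_of_squares:
  fixes f g :: "'a \<Rightarrow> real"
  assumes [measurable]: "f \<in> borel_measurable M" "g \<in> borel_measurable M"
    and "integrable M (\<lambda>x. (f x)\<^sup>2)" "integrable M (\<lambda>x. (g x)\<^sup>2)"
  shows "integrable M (\<lambda>x. f x * g x)"
proof (rule Bochner_Integration.integrable_bound[OF Bochner_Integration.integrable_add[OF assms(3,4)]])
  show "AE x in M. norm (f x * g x) \<le> norm ((f x)\<^sup>2 + (g x)\<^sup>2)"
  proof (rule AE_I2)
    fix x
    have "2 * (\<bar>f x\<bar> * \<bar>g x\<bar>) \<le> (f x)\<^sup>2 + (g x)\<^sup>2"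
      using sum_squares_bound[of "\<bar>f x\<bar>" "\<bar>g x\<bar>"] by (simp add: algebra_simps)
    moreover have "0 \<le> \<bar>f x\<bar> * \<bar>g x\<bar>" by simp
    ultimately have "\<bar>f x\<bar> * \<bar>g x\<bar> \<le> (f x)\<^sup>2 + (g x)\<^sup>2" by linarith
    then show "norm (f x * g x) \<le> norm ((f x)\<^sup>2 + (g x)\<^sup>2)" by (simp add: abs_mult)
  qed
qed simp

lemma integrable_of_square:
  fixes f :: "'a \<Rightarrow> real"
  assumes "f \<in> borel_measurable M" "integrable M (\<lambda>x. (f x)\<^sup>2)"
  shows "integrable M f"
  using integrable_mult_of_squares[of f "\<lambda>_. 1"] assms by simp

lemma integrable_square_add:
  fixes f g :: "'a \<Rightarrow> real"
  assumes [measurable]: "f \<in> borel_measurable M" "g \<in> borel_measurable M"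
    and "integrable M (\<lambda>x. (f x)\<^sup>2)" "integrable M (\<lambda>x. (g x)\<^sup>2)"
  shows "integrable M (\<lambda>x. (f x + g x)\<^sup>2)"
  using assms(3,4) integrable_mult_of_squares[OF assms]
  by (auto simp: power2_sum mult.assoc intro!: Bochner_Integration.integrable_add)

lemma sigma_finite_subalgebraI: "subalgebra M G \<Longrightarrow> sigma_finite_subalgebra M G"
  using finite_measure_subalgebra_is_sigma_finite[of M G]
  by (simp add: finite_measure_subalgebra_def finite_measure_subalgebra_axioms_def finite_measure_axioms)

text \<open>Vanishing integrals over \<open>G\<close> mean that the conditional expectation of
  \<open>f\<close> is 0, and a \<open>G\<close>-measurable factor pulls out of it. Integrability is
  asked of the product because \<open>V\<close> is unbounded in
  \<open>second_moment_step\<close>.\<close>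

lemma integral_mult_eq_zero:
  fixes f V :: "'a \<Rightarrow> real"
  assumes G: "subalgebra M G" and f: "integrable M f"
    and 0: "\<And>A. A \<in> sets G \<Longrightarrow> (\<integral>x. f x * indicator A x \<partial>M) = 0"
    and V: "V \<in> borel_measurable G" and Vf: "integrable M (\<lambda>x. V x * f x)"
  shows "(\<integral>x. V x * f x \<partial>M) = 0"
proof -
  interpret G: sigma_finite_subalgebra M G by (rule sigma_finite_subalgebraI[OF G])
  have "AE x in M. real_cond_exp M G f x = 0"
    by (rule G.real_cond_exp_charact) (use 0 f in \<open>auto simp: set_lebesgue_integral_def mult.commute\<close>)
  then have "(\<integral>x. V x * real_cond_exp M G f x \<partial>M) = (\<integral>x. 0 \<partial>M)"
    using measurable_from_subalg[OF G V] by (intro integral_cong_AE) auto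
  then show ?thesis
    using G.real_cond_exp_intg(2)[OF Vf V] f by simp
qed

lemma complex_integral_mult_eq_zero:
  fixes f :: "'a \<Rightarrow> real" and V :: "'a \<Rightarrow> complex"
  assumes G: "subalgebra M G" and f: "integrable M f"
    and 0: "\<And>A. A \<in> sets G \<Longrightarrow> (\<integral>x. f x * indicator A x \<partial>M) = 0"
    and V: "V \<in> borel_measurable G" and B: "\<And>x. norm (V x) \<le> B"
  shows "(\<integral>x. V x * of_real (f x) \<partial>M) = 0"
proof -
  have [measurable]: "V \<in> borel_measurable M" by (rule measurable_from_subalg[OF G V])
  have [measurable]: "f \<in> borel_measurable M" using f by auto
  have i: "integrable M (\<lambda>x. V x * of_real (f x))"
  proof (rule Bochner_Integration.integrable_bound)
    show "integrable M (\<lambda>x. B * f x)" using f by simp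
    show "AE x in M. norm (V x * of_real (f x)) \<le> norm (B * f x)"
      using order_trans[OF norm_ge_zero B] order_trans[OF B abs_ge_self]
      by (intro AE_I2) (auto simp: norm_mult abs_mult intro!: mult_right_mono B)
  qed simp
  have "(\<integral>x. Re (V x) * f x \<partial>M) = 0" "(\<integral>x. Im (V x) * f x \<partial>M) = 0"
    using integrable_Re[OF i] integrable_Im[OF i] V
    by (auto intro!: integral_mult_eq_zero[OF G f 0])
  then show ?thesis
    using integral_Re[OF i] integral_Im[OF i] by (intro complex_eqI) simp_all
qed

text \<open>Tilting the measure by the nonnegative density \<open>(C + w) / C\<close> reduces the claim to the uniqueness
  theorem for characteristic functions of probability measures.\<close>

lemma real_weight_eq_zero_of_char:
  fixes Y w :: "'a \<Rightarrow> real"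
  assumes [measurable]: "Y \<in> borel_measurable M" "w \<in> borel_measurable M"
    and C: "\<And>x. \<bar>w x\<bar> \<le> C"
    and 0: "\<And>\<theta>. (\<integral>x. iexp (\<theta> * Y x) * of_real (w x) \<partial>M) = 0"
    and [measurable]: "B \<in> sets borel"
  shows "(\<integral>x. indicator B (Y x) * w x \<partial>M) = 0"
proof -
  \<comment> \<open>\<open>C\<close> may be 0, so the division is by \<open>C + 1\<close>. The
    tilting density \<open>g\<close> then lies between 0 and 2, and its mean is 1 because the
    hypothesis at \<theta> = 0 makes the mean of \<open>w\<close> vanish.\<close>
  define D where "D = C + 1"
  have D: "D > 0" "\<bar>w x\<bar> \<le> D" for x using C[of x] unfolding D_def by linarith+
  define g where "g = (\<lambda>x. 1 + w x / D)"
  have [measurable]: "g \<in> borel_measurable M" unfolding g_def by simp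
  have "\<bar>w x / D\<bar> \<le> 1" for x using D by simp
  then have g: "0 \<le> g x" "\<bar>g x\<bar> \<le> 2" for x
    unfolding g_def using abs_le_iff[of "w x / D" 1] by (smt (verit))+
  have wi: "integrable M w" by (rule integrable_const_bound[where B=C]) (use C in auto)
  have gi: "integrable M g" unfolding g_def using wi by simp
  have w0: "(\<integral>x. w x \<partial>M) = 0"
    using 0[of 0] integral_complex_of_real[of M w] by simp
  have g1: "(\<integral>x. g x \<partial>M) = 1" unfolding g_def using wi w0 by (simp add: prob_space)
  define N where "N = density M (\<lambda>x. ennreal (g x))"
  have "emeasure N (space N) = 1"
    using g gi g1 unfolding N_def by (simp add: emeasure_density nn_integral_eq_integral cong: nn_integral_cong)
  then interpret N: prob_space N by (rule prob_spaceI)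
  have [measurable]: "Y \<in> borel_measurable N" unfolding N_def by simp
  have ii: "integrable M (\<lambda>x. iexp (\<theta> * Y x) * complex_of_real (w x))" for \<theta>
    by (rule integrable_const_bound[where B=C]) (use C in \<open>auto simp: norm_mult\<close>)
  have i0: "integrable M (\<lambda>x. iexp (\<theta> * Y x))" for \<theta>
    by (rule integrable_const_bound[where B=1]) auto
  have "char (distr N borel Y) \<theta> = char (distr M borel Y) \<theta>" for \<theta>
  proof -
    have "char (distr N borel Y) \<theta> = (\<integral>x. iexp (\<theta> * Y x) \<partial>N)"
      unfolding char_def by (subst integral_distr) auto
    also have "\<dots> = (\<integral>x. g x *\<^sub>R iexp (\<theta> * Y x) \<partial>M)"
      unfolding N_def by (subst integral_density) (use g in auto)
    also have "\<dots> = (\<integral>x. iexp (\<theta> * Y x) + (1 / D) *\<^sub>R (iexp (\<theta> * Y x) * of_real (w x)) \<partial>M)"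
      unfolding g_def by (intro Bochner_Integration.integral_cong) (auto simp: scaleR_conv_of_real algebra_simps)
    also have "\<dots> = (\<integral>x. iexp (\<theta> * Y x) \<partial>M)"
      by (subst Bochner_Integration.integral_add[OF i0]) (use ii 0 in auto)
    also have "\<dots> = char (distr M borel Y) \<theta>"
      unfolding char_def by (subst integral_distr) auto
    finally show ?thesis .
  qed
  then have "distr N borel Y = distr M borel Y"
    by (intro Levy_uniqueness ext) auto
  then have "(\<integral>y. indicator B y \<partial>distr N borel Y) = (\<integral>y. indicator B y \<partial>distr M borel Y :: real)"
    by simp
  then have "(\<integral>x. indicator B (Y x) \<partial>N) = (\<integral>x. indicator B (Y x) \<partial>M :: real)"
    by (subst (asm) (1 2) integral_distr) auto
  moreover have iB: "integrable M (\<lambda>x. indicator B (Y x) :: real)"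
    by (rule integrable_const_bound[where B=1]) (auto simp: indicator_def)
  moreover have iBw: "integrable M (\<lambda>x. indicator B (Y x) * w x)"
    by (rule integrable_const_bound[where B=D])
      (use D order.strict_implies_order[OF D(1)] in \<open>auto simp: abs_mult indicator_def\<close>)
  moreover have "(\<integral>x. indicator B (Y x) \<partial>N) = (\<integral>x. g x *\<^sub>R (indicator B (Y x) :: real) \<partial>M)"
    unfolding N_def by (subst integral_density) (use g in auto)
  moreover have "\<dots> = (\<integral>x. indicator B (Y x) + (1 / D) * (indicator B (Y x) * w x) \<partial>M)"
    unfolding g_def by (intro Bochner_Integration.integral_cong) (auto simp: algebra_simps)
  moreover have "\<dots> = (\<integral>x. indicator B (Y x) \<partial>M) + (1 / D) * (\<integral>x. indicator B (Y x) * w x \<partial>M)"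
    using iB iBw by simp
  ultimately show ?thesis using D(1) by simp
qed

text \<open>Conjugating the hypothesis at \<open>-\<theta>\<close> shows that \<open>cnj W\<close>
  satisfies it too. Hence so do the real and imaginary parts of \<open>W\<close>, and the real case
  applies to each.\<close>

lemma weight_eq_zero_of_char:
  fixes Y :: "'a \<Rightarrow> real" and W :: "'a \<Rightarrow> complex"
  assumes [measurable]: "Y \<in> borel_measurable M" "W \<in> borel_measurable M"
    and C: "\<And>x. norm (W x) \<le> C"
    and 0: "\<And>\<theta>. (\<integral>x. iexp (\<theta> * Y x) * W x \<partial>M) = 0"
    and [measurable]: "B \<in> sets borel"
  shows "(\<integral>x. indicator B (Y x) * W x \<partial>M) = 0"
proof -
  have i: "integrable M (\<lambda>x. iexp (\<theta> * Y x) * W x)" for \<theta>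
    by (rule integrable_const_bound[where B=C]) (use C in \<open>auto simp: norm_mult\<close>)
  have [measurable]: "(\<lambda>x. cnj (W x)) \<in> borel_measurable M"
    using measurable_compose[OF assms(2) borel_measurable_continuous_onI[of cnj]] by (auto intro: continuous_intros)
  have i': "integrable M (\<lambda>x. iexp (\<theta> * Y x) * cnj (W x))" for \<theta>
    by (rule integrable_const_bound[where B=C]) (use C in \<open>auto simp: norm_mult\<close>)
  have conj0: "(\<integral>x. iexp (\<theta> * Y x) * cnj (W x) \<partial>M) = 0" for \<theta>
  proof -
    have "(\<integral>x. iexp (\<theta> * Y x) * cnj (W x) \<partial>M) = (\<integral>x. cnj (iexp ((- \<theta>) * Y x) * W x) \<partial>M)"
      by (intro Bochner_Integration.integral_cong) (auto simp: exp_cnj)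
    also have "\<dots> = cnj (\<integral>x. iexp ((- \<theta>) * Y x) * W x \<partial>M)" by (rule Bochner_Integration.integral_cnj)
    finally show ?thesis using 0[of "-\<theta>"] by simp
  qed
  have re: "(\<integral>x. indicator B (Y x) * Re (W x) \<partial>M) = 0"
  proof (rule real_weight_eq_zero_of_char)
    show "\<bar>Re (W x)\<bar> \<le> C" for x using abs_Re_le_cmod[of "W x"] C[of x] by linarith
    fix \<theta>
    have "(\<integral>x. iexp (\<theta> * Y x) * of_real (Re (W x)) \<partial>M)
        = (\<integral>x. (iexp (\<theta> * Y x) * W x + iexp (\<theta> * Y x) * cnj (W x)) / 2 \<partial>M)"
      by (intro Bochner_Integration.integral_cong) (auto simp flip: distrib_left simp: complex_add_cnj)
    also have "\<dots> = 0" using i i' 0 conj0 by simp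
    finally show "(\<integral>x. iexp (\<theta> * Y x) * of_real (Re (W x)) \<partial>M) = 0" .
  qed auto
  have im: "(\<integral>x. indicator B (Y x) * Im (W x) \<partial>M) = 0"
  proof (rule real_weight_eq_zero_of_char)
    show "\<bar>Im (W x)\<bar> \<le> C" for x using abs_Im_le_cmod[of "W x"] C[of x] by linarith
    fix \<theta>
    have Im_W: "of_real (Im (W x)) = (W x - cnj (W x)) / (2 * \<i>)" for x
      by (rule complex_eqI) (simp_all add: complex_diff_cnj)
    have "(\<integral>x. iexp (\<theta> * Y x) * of_real (Im (W x)) \<partial>M)
        = (\<integral>x. (iexp (\<theta> * Y x) * W x - iexp (\<theta> * Y x) * cnj (W x)) / (2 * \<i>) \<partial>M)"
      by (intro Bochner_Integration.integral_cong) (auto simp: Im_W field_simps)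
    also have "\<dots> = 0" using i i' 0 conj0 by simp
    finally show "(\<integral>x. iexp (\<theta> * Y x) * of_real (Im (W x)) \<partial>M) = 0" .
  qed auto
  have iB: "integrable M (\<lambda>x. indicator B (Y x) * W x)"
    by (rule integrable_const_bound[where B=C])
      (use C order_trans[OF norm_ge_zero C] in \<open>auto simp: norm_mult indicator_def\<close>)
  have "Re (indicator B (Y x) * W x) = indicator B (Y x) * Re (W x)"
    "Im (indicator B (Y x) * W x) = indicator B (Y x) * Im (W x)" for x
    by (auto simp: indicator_def)
  then show ?thesis
    using integral_Re[OF iB] integral_Im[OF iB] re im by (intro complex_eqI) simp_all
qed

end

section \<open>Second-order expansion of characteristic functions\<close>

text \<open>The two branches have different tasks: the square stays integrable when only second
  moments are known, the cube is of smaller order for small increments. Both are Taylor remainder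
  bounds, the cubic one with its factor 1/6 dropped.\<close>

lemma norm_iexp_minus_taylor2: "norm (iexp x - (1 + \<i> * of_real x - of_real (x\<^sup>2 / 2))) \<le> min (x\<^sup>2) (\<bar>x\<bar> ^ 3)"
proof -
  have *: "(\<Sum>k\<le>2. (\<i> * of_real x) ^ k / fact k) = 1 + \<i> * of_real x - of_real (x\<^sup>2 / 2)"
    by (simp add: numeral_2_eq_2 power2_eq_square) (metis i_squared mult.assoc mult.left_commute mult_minus1)
  have "norm (iexp x - (1 + \<i> * of_real x - of_real (x\<^sup>2 / 2))) \<le> \<bar>x\<bar> ^ 3 / 6"
    using iexp_approx1[of x 2] unfolding * by (simp add: fact_numeral)
  moreover have "\<bar>x\<bar> ^ 3 / 6 \<le> \<bar>x\<bar> ^ 3" by simp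
  moreover have "norm (iexp x - (1 + \<i> * of_real x - of_real (x\<^sup>2 / 2))) \<le> x\<^sup>2"
    using iexp_approx2[of x 2] unfolding * by (simp add: fact_numeral)
  ultimately show ?thesis by linarith
qed

lemma norm_integral_le:
  fixes f :: "'a \<Rightarrow> 'b::{banach, second_countable_topology}"
  assumes "integrable M g" "\<And>x. x \<in> space M \<Longrightarrow> norm (f x) \<le> g x"
  shows "norm (\<integral>x. f x \<partial>M) \<le> (\<integral>x. g x \<partial>M)"
proof -
  have "norm (\<integral>x. f x \<partial>M) \<le> (\<integral>x. norm (f x) \<partial>M)" by (rule integral_norm_bound)
  also have "\<dots> \<le> (\<integral>x. g x \<partial>M)"
    using assms by (intro integral_mono') (auto intro: order_trans[OF norm_ge_zero])
  finally show ?thesis .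
qed

context prob_space begin

text \<open>\<open>V\<close> stands for the past and \<open>D\<close> for the next increment. Given
  \<open>G\<close>, the linear Taylor term averages to 0 and the quadratic one to
  \<open>h / 2\<close>, so the step multiplies the mean of \<open>V\<close> by
  \<open>1 - h / 2\<close> up to the Taylor remainder.\<close>

lemma char_one_step:
  fixes D :: "'a \<Rightarrow> real" and V :: "'a \<Rightarrow> complex"
  assumes G: "subalgebra M G" and D[measurable]: "D \<in> borel_measurable M"
    and D2: "integrable M (\<lambda>x. (D x)\<^sup>2)"
    and m: "\<And>A. A \<in> sets G \<Longrightarrow> (\<integral>x. D x * indicator A x \<partial>M) = 0"
    and v: "\<And>A. A \<in> sets G \<Longrightarrow> (\<integral>x. (D x)\<^sup>2 * indicator A x \<partial>M) = h * prob A"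
    and V: "V \<in> borel_measurable G" and B: "\<And>x. norm (V x) \<le> 1"
  shows "norm ((\<integral>x. V x * iexp (D x) \<partial>M) - complex_of_real (1 - h / 2) * (\<integral>x. V x \<partial>M))
    \<le> (\<integral>x. norm (V x) * min ((D x)\<^sup>2) (\<bar>D x\<bar> ^ 3) \<partial>M)"
proof -
  have [measurable]: "V \<in> borel_measurable M" by (rule measurable_from_subalg[OF G V])
  have D1: "integrable M D" by (rule integrable_of_square[OF D D2])
  have iV: "integrable M V" by (rule integrable_const_bound[where B=1]) (use B in auto)
  have iVf: "integrable M (\<lambda>x. V x * of_real (f x))" if f: "integrable M f" for f :: "'a \<Rightarrow> real"
  proof (rule Bochner_Integration.integrable_bound[OF f])
    show "AE x in M. norm (V x * of_real (f x)) \<le> norm (f x)"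
      using mult_right_mono[OF B] by (intro AE_I2) (simp add: norm_mult)
    show "(\<lambda>x. V x * of_real (f x)) \<in> borel_measurable M" using f by simp
  qed
  have iD: "integrable M (\<lambda>x. V x * of_real (D x))" by (rule iVf[OF D1])
  have iD2: "integrable M (\<lambda>x. V x * of_real ((D x)\<^sup>2))" by (rule iVf[OF D2])
  have 1: "(\<integral>x. V x * of_real (D x) \<partial>M) = 0"
    by (rule complex_integral_mult_eq_zero[OF G D1 m V B])
  have "(\<integral>x. V x * of_real ((D x)\<^sup>2 - h) \<partial>M) = 0"
  proof (rule complex_integral_mult_eq_zero[OF G _ _ V B])
    fix A assume A: "A \<in> sets G"
    then have [measurable]: "A \<in> sets M" using G by (auto simp: subalgebra_def)
    have "(\<integral>x. ((D x)\<^sup>2 - h) * indicator A x \<partial>M) = (\<integral>x. (D x)\<^sup>2 * indicator A x - h * indicator A x \<partial>M)"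
      by (simp add: algebra_simps)
    also have "\<dots> = 0"
      using v[OF A] integrable_real_mult_indicator[OF _ D2, of A]
      by (subst Bochner_Integration.integral_diff) (auto simp: less_top[symmetric])
    finally show "(\<integral>x. ((D x)\<^sup>2 - h) * indicator A x \<partial>M) = 0" .
  qed (use D2 in auto)
  then have 2: "(\<integral>x. V x * of_real ((D x)\<^sup>2) \<partial>M) = h * (\<integral>x. V x \<partial>M)"
    using iD2 iV by (simp add: right_diff_distrib mult.commute)
  have i0: "integrable M (\<lambda>x. V x * iexp (D x))"
    by (rule integrable_const_bound[where B=1]) (use B in \<open>auto simp: norm_mult\<close>)
  define R where "R = (\<lambda>x. V x * iexp (D x) - (V x + \<i> * (V x * of_real (D x)) - V x * of_real ((D x)\<^sup>2) / 2))"
  have "(\<integral>x. R x \<partial>M) = (\<integral>x. V x * iexp (D x) \<partial>M) - complex_of_real (1 - h / 2) * (\<integral>x. V x \<partial>M)"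
    unfolding R_def using i0 iD iD2 iV 1 2 by (simp add: algebra_simps)
  moreover have "norm (\<integral>x. R x \<partial>M) \<le> (\<integral>x. norm (V x) * min ((D x)\<^sup>2) (\<bar>D x\<bar> ^ 3) \<partial>M)"
  proof (rule norm_integral_le)
    show "integrable M (\<lambda>x. norm (V x) * min ((D x)\<^sup>2) (\<bar>D x\<bar> ^ 3))"
    proof (rule Bochner_Integration.integrable_bound[OF D2])
      show "AE x in M. norm (norm (V x) * min ((D x)\<^sup>2) (\<bar>D x\<bar> ^ 3)) \<le> norm ((D x)\<^sup>2)"
        using B by (intro AE_I2) (auto simp: abs_mult intro!: mult_left_le_one_le order_trans[OF mult_left_le_one_le])
    qed simp
    fix x
    have "R x = V x * (iexp (D x) - (1 + \<i> * of_real (D x) - of_real ((D x)\<^sup>2 / 2)))"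
      unfolding R_def by (simp add: algebra_simps)
    then show "norm (R x) \<le> norm (V x) * min ((D x)\<^sup>2) (\<bar>D x\<bar> ^ 3)"
      using norm_iexp_minus_taylor2[of "D x"] by (simp only: norm_mult) (rule mult_left_mono, auto)
  qed
  ultimately show ?thesis by simp
qed

text \<open>Iterates \<open>char_one_step\<close>. Each step has three errors: shrinking
  \<open>H k\<close> to \<open>H (Suc k)\<close> costs the difference of the probabilities, a new
  Taylor remainder appears, and the inherited error is not amplified because
  \<open>h \<le> 4\<close> keeps \<open>1 - h / 2\<close> within modulus 1. The events
  \<open>H\<close> are truncation events in the first application and a fixed conditioning set in
  the second.\<close>

lemma char_telescope:
  fixes Z :: "nat \<Rightarrow> 'a \<Rightarrow> real" and H :: "nat \<Rightarrow> 'a set"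
  assumes G: "\<And>k. k \<le> n \<Longrightarrow> subalgebra M (G k)"
    and Z: "\<And>k. k \<le> n \<Longrightarrow> (\<lambda>x. Z k x - Z 0 x) \<in> borel_measurable (G k)"
    and H: "\<And>k. k \<le> n \<Longrightarrow> H k \<in> sets (G k)"
    and dec: "\<And>k. k < n \<Longrightarrow> H (Suc k) \<subseteq> H k"
    and D2: "\<And>k. k < n \<Longrightarrow> integrable M (\<lambda>x. (Z (Suc k) x - Z k x)\<^sup>2)"
    and m: "\<And>k A. k < n \<Longrightarrow> A \<in> sets (G k) \<Longrightarrow> (\<integral>x. (Z (Suc k) x - Z k x) * indicator A x \<partial>M) = 0"
    and v: "\<And>k A. k < n \<Longrightarrow> A \<in> sets (G k) \<Longrightarrow> (\<integral>x. (Z (Suc k) x - Z k x)\<^sup>2 * indicator A x \<partial>M) = h * prob A"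
    and h: "0 \<le> h" "h \<le> 4"
  shows "norm ((\<integral>x. indicator (H n) x * iexp (Z n x - Z 0 x) \<partial>M) - complex_of_real ((1 - h / 2) ^ n * prob (H 0)))
    \<le> (prob (H 0) - prob (H n)) +
      (\<Sum>k<n. \<integral>x. indicator (H k) x * min ((Z (Suc k) x - Z k x)\<^sup>2) (\<bar>Z (Suc k) x - Z k x\<bar> ^ 3) \<partial>M)"
proof -
  define E where "E k = (\<integral>x. indicator (H k) x * iexp (Z k x - Z 0 x) \<partial>M)" for k
  define R where "R k = (\<integral>x. indicator (H k) x * min ((Z (Suc k) x - Z k x)\<^sup>2) (\<bar>Z (Suc k) x - Z k x\<bar> ^ 3) \<partial>M)" for k
  have HM: "H k \<in> sets M" if "k \<le> n" for k
    using H[OF that] G[OF that] by (auto simp: subalgebra_def)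
  have ZM: "(\<lambda>x. Z k x - Z 0 x) \<in> borel_measurable M" if "k \<le> n" for k
    by (rule measurable_from_subalg[OF G Z]) (use that in auto)
  have q: "\<bar>1 - h / 2\<bar> \<le> 1" using h by auto
  have "j \<le> n \<Longrightarrow> norm (E j - complex_of_real ((1 - h / 2) ^ j * prob (H 0))) \<le> (prob (H 0) - prob (H j)) + (\<Sum>k<j. R k)" for j
  proof (induction j)
    case 0
    have "E 0 = (\<integral>x. complex_of_real (indicator (H 0) x) \<partial>M)"
      unfolding E_def by (intro Bochner_Integration.integral_cong) (auto simp: indicator_def)
    also have "\<dots> = prob (H 0)"
      using HM[of 0] by simp
    finally show ?case by simp
  next
    case (Suc j)
    then have j: "j \<le> n" "Suc j \<le> n" "j < n" by auto
    note [measurable] = HM[OF j(1)] HM[OF j(2)] ZM[OF j(1)] ZM[OF j(2)]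
    define D where "D = (\<lambda>x. Z (Suc j) x - Z j x)"
    define V where "V = (\<lambda>x. indicator (H j) x * iexp (Z j x - Z 0 x))"
    have DM [measurable]: "D \<in> borel_measurable M"
      unfolding D_def using borel_measurable_diff[OF ZM[OF j(2)] ZM[OF j(1)]] by (simp add: algebra_simps)
    have VG: "V \<in> borel_measurable (G j)"
      unfolding V_def using Z[OF j(1)] H[OF j(1)] by measurable
    have Vn: "norm (V x) = indicator (H j) x" for x unfolding V_def by (auto simp: norm_mult indicator_def)
    have EV: "E j = (\<integral>x. V x \<partial>M)" unfolding E_def V_def ..
    have s: "norm ((\<integral>x. V x * iexp (D x) \<partial>M) - complex_of_real (1 - h / 2) * E j) \<le> R j"
      using char_one_step[OF G[OF j(1)] DM, of h V] D2[OF j(3)] m[OF j(3)] v[OF j(3)] VG Vn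
      unfolding EV R_def by (simp add: D_def)
    have VD: "V x * iexp (D x) = indicator (H j) x * iexp (Z (Suc j) x - Z 0 x)" for x
      unfolding V_def D_def by (auto simp: exp_add[symmetric] algebra_simps indicator_def)
    have i: "integrable M (\<lambda>x. indicator (H k) x * iexp (Z (Suc j) x - Z 0 x))" if "k \<le> n" for k
    proof (rule integrable_const_bound[where B=1])
      note [measurable] = HM[OF that]
      show "(\<lambda>x. indicator (H k) x * iexp (Z (Suc j) x - Z 0 x)) \<in> borel_measurable M" by measurable
    qed (auto simp: norm_mult indicator_def)
    have "E (Suc j) - (\<integral>x. V x * iexp (D x) \<partial>M)
        = (\<integral>x. (indicator (H (Suc j)) x - indicator (H j) x) * iexp (Z (Suc j) x - Z 0 x) \<partial>M)"
      unfolding E_def VD using i[OF j(1)] i[OF j(2)] by (simp add: left_diff_distrib)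
    also have "norm \<dots> \<le> (\<integral>x. indicator (H j) x - indicator (H (Suc j)) x \<partial>M)"
    proof (rule norm_integral_le)
      show "integrable M (\<lambda>x. indicator (H j) x - indicator (H (Suc j)) x :: real)"
        by (auto simp: less_top[symmetric])
      show "norm ((indicator (H (Suc j)) x - indicator (H j) x) * iexp (Z (Suc j) x - Z 0 x))
        \<le> indicator (H j) x - indicator (H (Suc j)) x" for x
        using dec[OF j(3)] by (auto simp: norm_mult indicator_def)
    qed
    also have "\<dots> = prob (H j) - prob (H (Suc j))"
      by (simp add: less_top[symmetric])
    finally have t: "norm (E (Suc j) - (\<integral>x. V x * iexp (D x) \<partial>M)) \<le> prob (H j) - prob (H (Suc j))" .
    have "norm (complex_of_real (1 - h / 2) * (E j - complex_of_real ((1 - h / 2) ^ j * prob (H 0)))) \<le> 1 * norm (E j - complex_of_real ((1 - h / 2) ^ j * prob (H 0)))"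
      unfolding norm_mult norm_of_real using q by (intro mult_right_mono) auto
    with Suc.IH[OF j(1)] have u: "norm (complex_of_real (1 - h / 2) * (E j - complex_of_real ((1 - h / 2) ^ j * prob (H 0))))
        \<le> (prob (H 0) - prob (H j)) + (\<Sum>k<j. R k)" by simp
    have "E (Suc j) - complex_of_real ((1 - h / 2) ^ Suc j * prob (H 0))
        = (E (Suc j) - (\<integral>x. V x * iexp (D x) \<partial>M)) + ((\<integral>x. V x * iexp (D x) \<partial>M) - complex_of_real (1 - h / 2) * E j)
          + complex_of_real (1 - h / 2) * (E j - complex_of_real ((1 - h / 2) ^ j * prob (H 0)))"
      by (simp add: algebra_simps)
    then have "norm (E (Suc j) - complex_of_real ((1 - h / 2) ^ Suc j * prob (H 0)))
        \<le> norm (E (Suc j) - (\<integral>x. V x * iexp (D x) \<partial>M)) + norm ((\<integral>x. V x * iexp (D x) \<partial>M) - complex_of_real (1 - h / 2) * E j)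
          + norm (complex_of_real (1 - h / 2) * (E j - complex_of_real ((1 - h / 2) ^ j * prob (H 0))))"
      by (smt (verit) norm_triangle_ineq)
    then show ?case using s t u by simp
  qed
  from this[of n] show ?thesis unfolding E_def R_def by simp
qed

end

section \<open>Truncated expansion under second moments\<close>

context prob_space begin

text \<open>Pythagoras localised to an event of \<open>G\<close>: the cross term vanishes because
  \<open>Y x * indicator B x\<close> is \<open>G\<close>-measurable and \<open>D\<close> has
  conditional mean 0. It supplies the submartingale inequality, the additivity of squared increments
  and the orthogonality of their compensated squares.\<close>

lemma second_moment_step:
  fixes Y D :: "'a \<Rightarrow> real"
  assumes G: "subalgebra M G" and Y: "Y \<in> borel_measurable G" and D: "D \<in> borel_measurable M"
    and Y2: "integrable M (\<lambda>x. (Y x)\<^sup>2)" and D2: "integrable M (\<lambda>x. (D x)\<^sup>2)"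
    and m: "\<And>A. A \<in> sets G \<Longrightarrow> (\<integral>x. D x * indicator A x \<partial>M) = 0"
    and B: "B \<in> sets G"
  shows "(\<integral>x. (Y x + D x)\<^sup>2 * indicator B x \<partial>M)
    = (\<integral>x. (Y x)\<^sup>2 * indicator B x \<partial>M) + (\<integral>x. (D x)\<^sup>2 * indicator B x \<partial>M)"
proof -
  note [measurable] = measurable_from_subalg[OF G Y] D
  have BM [measurable]: "B \<in> sets M" using G B by (auto simp: subalgebra_def)
  have ind: "integrable M (\<lambda>x. f x * indicator B x)" if "integrable M f" for f :: "'a \<Rightarrow> real"
    using integrable_mult_indicator[OF BM that] by (simp add: mult.commute)
  have YD: "integrable M (\<lambda>x. Y x * D x)"
    by (rule integrable_mult_of_squares) (use Y2 D2 in auto)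
  have iYB: "integrable M (\<lambda>x. Y x * indicator B x * D x)"
    using ind[OF YD] by (simp add: ac_simps)
  have "(\<integral>x. (Y x * indicator B x) * D x \<partial>M) = 0"
    by (rule integral_mult_eq_zero[OF G integrable_of_square[OF D D2] m _ iYB]) (use Y B in auto)
  moreover have "(\<integral>x. (Y x + D x)\<^sup>2 * indicator B x \<partial>M)
    = (\<integral>x. (Y x)\<^sup>2 * indicator B x + (D x)\<^sup>2 * indicator B x + 2 * (Y x * indicator B x * D x) \<partial>M)"
    by (intro Bochner_Integration.integral_cong) (auto simp: power2_sum algebra_simps)
  ultimately show ?thesis
    using ind[OF Y2] ind[OF D2] iYB by simp
qed

text \<open>The path is frozen on the events \<open>H k\<close> where it has stayed below \<open>K\<close> and has had no increment
  above \<open>\<epsilon>\<close>. The first large increment leaves a level of modulus at most \<open>K\<close>, so the submartingale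
  property of \<open>Z\<^sup>2\<close> bounds its second moment in terms of the final value alone.\<close>

lemma char_telescope_truncated:
  fixes Z :: "nat \<Rightarrow> 'a \<Rightarrow> real"
  assumes G: "\<And>k. k \<le> n \<Longrightarrow> subalgebra M (G k)"
    and G_mono: "\<And>j k. j \<le> k \<Longrightarrow> k \<le> n \<Longrightarrow> sets (G j) \<subseteq> sets (G k)"
    and Z: "\<And>k. k \<le> n \<Longrightarrow> Z k \<in> borel_measurable (G k)"
    and Z0: "\<And>x. Z 0 x = 0"
    and D2: "\<And>k. k < n \<Longrightarrow> integrable M (\<lambda>x. (Z (Suc k) x - Z k x)\<^sup>2)"
    and m: "\<And>k A. k < n \<Longrightarrow> A \<in> sets (G k) \<Longrightarrow> (\<integral>x. (Z (Suc k) x - Z k x) * indicator A x \<partial>M) = 0"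
    and v: "\<And>k A. k < n \<Longrightarrow> A \<in> sets (G k) \<Longrightarrow> (\<integral>x. (Z (Suc k) x - Z k x)\<^sup>2 * indicator A x \<partial>M) = h * prob A"
    and h: "0 \<le> h" "h \<le> 4" and \<epsilon>: "0 \<le> \<epsilon>"
  defines "W \<equiv> {x\<in>space M. \<exists>j<n. \<epsilon> < \<bar>Z (Suc j) x - Z j x\<bar>}"
  assumes L: "L \<in> sets M" "\<And>x j. x \<in> space M \<Longrightarrow> j \<le> n \<Longrightarrow> K < \<bar>Z j x\<bar> \<Longrightarrow> x \<in> L"
  shows "integrable M (\<lambda>x. (Z n x)\<^sup>2)"
    and "norm ((\<integral>x. iexp (Z n x) \<partial>M) - complex_of_real ((1 - h / 2) ^ n))
    \<le> 2 * prob W + 2 * prob L + \<epsilon> * (n * h) + 2 * (\<integral>x. ((Z n x)\<^sup>2 + K\<^sup>2) * indicator W x \<partial>M)"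
proof -
  have ZG: "Z j \<in> borel_measurable (G k)" if "j \<le> k" "k \<le> n" for j k
  proof (rule measurable_from_subalg[OF _ Z])
    show "subalgebra (G k) (G j)"
      using G[of j] G[of k] G_mono[OF that] that by (auto simp: subalgebra_def)
  qed (use that in auto)
  have ZM [measurable (raw)]: "Z j \<in> borel_measurable M" if "j \<le> n" for j
    by (rule measurable_from_subalg[OF G Z]) (use that in auto)
  have sG: "space (G k) = space M" if "k \<le> n" for k
    using G[OF that] by (simp add: subalgebra_def)
  have GM: "A \<in> sets M" if "A \<in> sets (G k)" "k \<le> n" for A k
    using that G by (auto simp: subalgebra_def)
  have Z2: "k \<le> n \<Longrightarrow> integrable M (\<lambda>x. (Z k x)\<^sup>2)" for k
  proof (induction k)
    case (Suc k)
    then have "integrable M (\<lambda>x. (Z k x + (Z (Suc k) x - Z k x))\<^sup>2)"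
      by (intro integrable_square_add D2 borel_measurable_diff ZM) auto
    then show ?case by simp
  qed (simp add: Z0)
  then show "integrable M (\<lambda>x. (Z n x)\<^sup>2)" by simp
  have ind: "integrable M (\<lambda>x. f x * indicator B x)" if "integrable M f" "B \<in> sets M" for f :: "'a \<Rightarrow> real" and B
    using integrable_mult_indicator[OF that(2,1)] by (simp add: mult.commute)
  have sub: "(\<integral>x. (Z k x)\<^sup>2 * indicator B x \<partial>M) \<le> (\<integral>x. (Z j x)\<^sup>2 * indicator B x \<partial>M)"
    if "B \<in> sets (G k)" "k \<le> j" "j \<le> n" for B k j
    using that(2,3)
  proof (induction j rule: dec_induct)
    case (step j)
    have "(\<integral>x. (Z j x + (Z (Suc j) x - Z j x))\<^sup>2 * indicator B x \<partial>M)
      = (\<integral>x. (Z j x)\<^sup>2 * indicator B x \<partial>M) + (\<integral>x. (Z (Suc j) x - Z j x)\<^sup>2 * indicator B x \<partial>M)"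
      using step that G_mono[of k j]
      by (intro second_moment_step[of "G j"] G Z Z2 D2 m borel_measurable_diff ZM) auto
    moreover have "0 \<le> (\<integral>x. (Z (Suc j) x - Z j x)\<^sup>2 * indicator B x \<partial>M)" by simp
    ultimately have "(\<integral>x. (Z j x)\<^sup>2 * indicator B x \<partial>M) \<le> (\<integral>x. (Z j x + (Z (Suc j) x - Z j x))\<^sup>2 * indicator B x \<partial>M)"
      by linarith
    then show ?case using step by simp
  qed simp

  define D where "D k x = Z (Suc k) x - Z k x" for k x
  have DM [measurable (raw)]: "D k \<in> borel_measurable M" if "k < n" for k
    unfolding D_def using that by (intro borel_measurable_diff ZM) auto
  define H where "H k = {x\<in>space M. (\<forall>j\<le>k. \<bar>Z j x\<bar> \<le> K) \<and> (\<forall>j<k. \<bar>D j x\<bar> \<le> \<epsilon>)}" for k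
  \<comment> \<open>Unlike \<open>H\<close>, these events ignore the level bound. The differences
    \<open>S k - S (Suc k)\<close> therefore partition \<open>W\<close> according to the first large
    increment, and the integrals \<open>T k\<close> below add up to a single integral over
    \<open>W\<close>.\<close>
  define S where "S k = {x\<in>space M. \<forall>j<k. \<bar>D j x\<bar> \<le> \<epsilon>}" for k
  have HG: "H k \<in> sets (G k)" if "k \<le> n" for k
  proof -
    have [measurable]: "Z j \<in> borel_measurable (G k)" if "j \<le> k" for j
      using ZG[OF that \<open>k \<le> n\<close>] .
    have [measurable]: "D j \<in> borel_measurable (G k)" if "j < k" for j
      unfolding D_def using that by (intro borel_measurable_diff) auto
    have "H k = {x\<in>space (G k). (\<forall>j\<in>{..k}. \<bar>Z j x\<bar> \<le> K) \<and> (\<forall>j\<in>{..<k}. \<bar>D j x\<bar> \<le> \<epsilon>)}"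
      unfolding H_def sG[OF that] by auto
    also have "\<dots> \<in> sets (G k)"
      by measurable
    finally show ?thesis .
  qed
  have SM: "S k \<in> sets M" if "k \<le> n" for k
  proof -
    have [measurable]: "D j \<in> borel_measurable M" if "j < k" for j
      using DM[of j] that \<open>k \<le> n\<close> by simp
    have "S k = {x\<in>space M. \<forall>j\<in>{..<k}. \<bar>D j x\<bar> \<le> \<epsilon>}" unfolding S_def by auto
    also have "\<dots> \<in> sets M" by measurable
    finally show ?thesis .
  qed
  have WS: "W = space M - S n" unfolding W_def S_def D_def by (auto simp: not_le)
  have WM: "W \<in> sets M" unfolding WS using SM[of n] by auto
  have "1 - prob (H n) = prob (space M - H n)"
    by (rule prob_compl[symmetric]) (use HG GM in blast)
  also have "\<dots> \<le> prob (W \<union> L)"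
  proof (rule finite_measure_mono)
    show "space M - H n \<subseteq> W \<union> L"
      using L(2) unfolding W_def H_def D_def by (force simp: not_le)
  qed (use WM L in auto)
  also have "\<dots> \<le> prob W + prob L"
    using WM L(1) by (rule measure_Un_le)
  finally have PH: "1 - prob (H n) \<le> prob W + prob L" .

  define \<rho> where "\<rho> k = (\<integral>x. indicator (H k) x * min ((D k x)\<^sup>2) (\<bar>D k x\<bar> ^ 3) \<partial>M)" for k
  define T where "T k = (\<integral>x. ((Z n x)\<^sup>2 + K\<^sup>2) * (indicator (S k) x - indicator (S (Suc k)) x) \<partial>M)" for k
  have ZK: "integrable M (\<lambda>x. (Z n x)\<^sup>2 + K\<^sup>2)" using Z2 by simp
  have rho: "\<rho> k \<le> \<epsilon> * h + 2 * T k" if k: "k < n" for k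
  proof -
    \<comment> \<open>The first increment above \<epsilon> occurs at step \<open>k\<close>, with
      levels within \<open>K\<close> up to then. This event is known at time \<open>Suc k\<close>,
      so \<open>sub\<close> can move the second moment over it from \<open>Suc k\<close> to the
      final index \<open>n\<close>.\<close>
    define B where "B = {x\<in>space M. x \<in> H k \<and> \<epsilon> < \<bar>D k x\<bar>}"
    have DG: "D k \<in> borel_measurable (G (Suc k))"
      unfolding D_def using k by (intro borel_measurable_diff ZG) auto
    have "H k \<in> sets (G (Suc k))" using HG[of k] G_mono[of k "Suc k"] k by auto
    then have "{x\<in>space (G (Suc k)). x \<in> H k \<and> \<epsilon> < \<bar>D k x\<bar>} \<in> sets (G (Suc k))"
      using DG by measurable
    then have BG: "B \<in> sets (G (Suc k))"
      unfolding B_def using sG[of "Suc k"] k by simp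
    have BM: "B \<in> sets M" by (rule GM[OF BG]) (use k in auto)
    have D2k: "integrable M (\<lambda>x. (D k x)\<^sup>2)" unfolding D_def by (rule D2[OF k])
    have Zk: "integrable M (\<lambda>x. (Z (Suc k) x)\<^sup>2 + K\<^sup>2)" using Z2[of "Suc k"] k by simp
    have BS: "indicator B x \<le> (indicator (S k) x - indicator (S (Suc k)) x :: real)" for x
      unfolding B_def S_def H_def by (auto simp: indicator_def less_Suc_eq)
    have "\<rho> k \<le> (\<integral>x. \<epsilon> * (D k x)\<^sup>2 + 2 * (((Z (Suc k) x)\<^sup>2 + K\<^sup>2) * indicator B x) \<partial>M)"
      unfolding \<rho>_def
    proof (rule integral_mono')
      show "integrable M (\<lambda>x. \<epsilon> * (D k x)\<^sup>2 + 2 * (((Z (Suc k) x)\<^sup>2 + K\<^sup>2) * indicator B x))"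
        using ind[OF Zk BM] D2k by (intro Bochner_Integration.integrable_add integrable_mult_right) 
      fix x assume x: "x \<in> space M"
      show "0 \<le> \<epsilon> * (D k x)\<^sup>2 + 2 * (((Z (Suc k) x)\<^sup>2 + K\<^sup>2) * indicator B x)"
        using \<epsilon> by (auto simp: indicator_def)
      \<comment> \<open>Off \<open>H k\<close> the left side is 0. An increment within \<epsilon>
        uses the cubic branch, at most \<open>\<epsilon> * (D k x)\<^sup>2\<close>. On
        \<open>B\<close> the quadratic branch is used with
        \<open>(u - v)\<^sup>2 \<le> 2 * u\<^sup>2 + 2 * v\<^sup>2\<close>, the old level being at
        most \<open>K\<close>.\<close>
      consider "x \<notin> H k" | "x \<in> H k" "\<bar>D k x\<bar> \<le> \<epsilon>" | "x \<in> B" using x unfolding B_def by force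
      then show "indicator (H k) x * min ((D k x)\<^sup>2) (\<bar>D k x\<bar> ^ 3)
          \<le> \<epsilon> * (D k x)\<^sup>2 + 2 * (((Z (Suc k) x)\<^sup>2 + K\<^sup>2) * indicator B x)"
      proof cases
        case 1 then show ?thesis using \<epsilon> by (auto simp: indicator_def)
      next
        case 2
        have "\<bar>D k x\<bar> ^ 3 \<le> \<epsilon> * (D k x)\<^sup>2"
          using mult_right_mono[OF 2(2), of "(D k x)\<^sup>2"] by (simp add: power3_eq_cube power2_eq_square mult.assoc)
        then show ?thesis using 2 by (auto simp: indicator_def min_def intro: add_increasing2)
      next
        case 3
        then have "\<bar>Z k x\<bar> \<le> K" unfolding B_def H_def by auto
        then have "(Z k x)\<^sup>2 \<le> K\<^sup>2" by (metis abs_ge_zero power2_abs power_mono)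
        moreover have "(D k x)\<^sup>2 \<le> 2 * (Z (Suc k) x)\<^sup>2 + 2 * (Z k x)\<^sup>2"
          using sum_squares_bound[of "Z (Suc k) x" "- Z k x"] unfolding D_def by (simp add: power2_diff)
        ultimately have "(D k x)\<^sup>2 \<le> 2 * ((Z (Suc k) x)\<^sup>2 + K\<^sup>2)" by simp
        moreover have "0 \<le> \<epsilon> * (D k x)\<^sup>2" using \<epsilon> by simp
        moreover have "x \<in> H k" using 3 unfolding B_def by auto
        ultimately show ?thesis using 3 by (auto simp: min_def)
      qed
    qed
    also have "\<dots> = \<epsilon> * (\<integral>x. (D k x)\<^sup>2 \<partial>M) + 2 * (\<integral>x. ((Z (Suc k) x)\<^sup>2 + K\<^sup>2) * indicator B x \<partial>M)"
      using ind[OF Zk BM] D2k by (subst Bochner_Integration.integral_add) auto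
    also have "(\<integral>x. (D k x)\<^sup>2 \<partial>M) = (\<integral>x. (D k x)\<^sup>2 * indicator (space M) x \<partial>M)"
      by (intro Bochner_Integration.integral_cong) auto
    also have "\<dots> = h"
      using v[OF k, of "space M"] k sets.top[of "G k"] sG[of k] unfolding D_def by (simp add: prob_space)
    also have "(\<integral>x. ((Z (Suc k) x)\<^sup>2 + K\<^sup>2) * indicator B x \<partial>M)
        = (\<integral>x. (Z (Suc k) x)\<^sup>2 * indicator B x \<partial>M) + (\<integral>x. K\<^sup>2 * indicator B x \<partial>M)"
      using ind[OF Z2[of "Suc k"] BM] BM k by (simp add: distrib_right less_top[symmetric])
    also have "\<dots> \<le> (\<integral>x. (Z n x)\<^sup>2 * indicator B x \<partial>M) + (\<integral>x. K\<^sup>2 * indicator B x \<partial>M)"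
      using sub[OF BG] k by simp
    also have "\<dots> = (\<integral>x. ((Z n x)\<^sup>2 + K\<^sup>2) * indicator B x \<partial>M)"
      using ind[OF Z2[of n] BM] BM k by (simp add: distrib_right less_top[symmetric])
    also have "\<dots> \<le> T k"
      unfolding T_def
    proof (rule integral_mono)
      show "integrable M (\<lambda>x. ((Z n x)\<^sup>2 + K\<^sup>2) * (indicator (S k) x - indicator (S (Suc k)) x))"
        using ind[OF ZK SM[of k]] ind[OF ZK SM[of "Suc k"]] k by (simp add: right_diff_distrib)
    qed (use ind[OF ZK BM] BS in \<open>auto intro!: mult_left_mono\<close>)
    finally show ?thesis by simp
  qed
  have "(\<Sum>k<n. T k) = (\<integral>x. (\<Sum>k<n. ((Z n x)\<^sup>2 + K\<^sup>2) * (indicator (S k) x - indicator (S (Suc k)) x)) \<partial>M)"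
    unfolding T_def
    by (rule Bochner_Integration.integral_sum[symmetric])
      (use ind[OF ZK SM] in \<open>simp add: right_diff_distrib\<close>)
  also have "\<dots> = (\<integral>x. ((Z n x)\<^sup>2 + K\<^sup>2) * (indicator (S 0) x - indicator (S n) x) \<partial>M)"
    by (simp only: sum_distrib_left[symmetric] sum_lessThan_telescope'[of "\<lambda>k. indicator (S k) _"])
  also have "\<dots> = (\<integral>x. ((Z n x)\<^sup>2 + K\<^sup>2) * indicator W x \<partial>M)"
    by (intro Bochner_Integration.integral_cong) (auto simp: WS S_def indicator_def)
  finally have sumT: "(\<Sum>k<n. T k) = (\<integral>x. ((Z n x)\<^sup>2 + K\<^sup>2) * indicator W x \<partial>M)" .
  have HM: "H k \<in> sets M" if "k \<le> n" for k using GM[OF HG] that by blast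
  have tele: "norm ((\<integral>x. indicator (H n) x * iexp (Z n x - Z 0 x) \<partial>M) - complex_of_real ((1 - h / 2) ^ n * prob (H 0)))
    \<le> (prob (H 0) - prob (H n)) + (\<Sum>k<n. \<rho> k)"
    unfolding \<rho>_def D_def
  proof (rule char_telescope[of n G])
    show "H (Suc k) \<subseteq> H k" for k unfolding H_def by auto
  qed (use G HG D2 m v h Z Z0 in auto)
  show "norm ((\<integral>x. iexp (Z n x) \<partial>M) - complex_of_real ((1 - h / 2) ^ n))
    \<le> 2 * prob W + 2 * prob L + \<epsilon> * (n * h) + 2 * (\<integral>x. ((Z n x)\<^sup>2 + K\<^sup>2) * indicator W x \<partial>M)"
    (is "?l \<le> ?r")
  proof -
    have q: "\<bar>1 - h / 2\<bar> \<le> 1" using h by auto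
    have i: "integrable M (\<lambda>x. indicator B x * iexp (Z n x))" if "B \<in> sets M" for B
      using that by (intro integrable_const_bound[where B=1]) (auto simp: norm_mult indicator_def)
    \<comment> \<open>Leaving \<open>H\<close> is paid for twice: once for inserting
      \<open>indicator (H n)\<close> here, once as \<open>prob (H 0) - prob (H n)\<close> in
      \<open>tele\<close> together with \<open>1 - prob (H 0)\<close> below. Hence the factor 2 at
      \<open>prob W\<close> and \<open>prob L\<close>.\<close>
    have "norm ((\<integral>x. iexp (Z n x) \<partial>M) - (\<integral>x. indicator (H n) x * iexp (Z n x) \<partial>M))
        = norm (\<integral>x. iexp (Z n x) - indicator (H n) x * iexp (Z n x) \<partial>M)"
      using i[of "H n"] HM[of n] by (subst Bochner_Integration.integral_diff)
        (auto intro!: integrable_const_bound[where B=1])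
    also have "\<dots> \<le> (\<integral>x. 1 - indicator (H n) x \<partial>M)"
    proof (rule norm_integral_le)
      show "integrable M (\<lambda>x. 1 - indicator (H n) x :: real)"
        using HM[of n] by (auto simp: less_top[symmetric])
    qed (auto simp: indicator_def)
    also have "\<dots> = 1 - prob (H n)" using HM[of n] by (simp add: prob_space less_top[symmetric])
    finally have 1: "norm ((\<integral>x. iexp (Z n x) \<partial>M) - (\<integral>x. indicator (H n) x * iexp (Z n x) \<partial>M)) \<le> 1 - prob (H n)" .
    have 2: "norm (complex_of_real ((1 - h / 2) ^ n * prob (H 0)) - complex_of_real ((1 - h / 2) ^ n)) \<le> 1 - prob (H 0)"
    proof -
      have "norm (complex_of_real ((1 - h / 2) ^ n * prob (H 0)) - complex_of_real ((1 - h / 2) ^ n))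
          = norm (complex_of_real ((1 - h / 2) ^ n * (prob (H 0) - 1)))"
        by (simp add: algebra_simps)
      also have "\<dots> = \<bar>1 - h / 2\<bar> ^ n * (1 - prob (H 0))"
        unfolding norm_of_real abs_mult power_abs by simp
      also have "\<dots> \<le> 1 * (1 - prob (H 0))"
        using q by (intro mult_right_mono power_le_one) auto
      finally show ?thesis by simp
    qed
    have "(\<Sum>k<n. \<rho> k) \<le> (\<Sum>k<n. \<epsilon> * h + 2 * T k)" by (rule sum_mono) (use rho in auto)
    also have "\<dots> = \<epsilon> * (n * h) + 2 * (\<integral>x. ((Z n x)\<^sup>2 + K\<^sup>2) * indicator W x \<partial>M)"
      by (simp add: sum.distrib sum_distrib_left[symmetric] sumT)
    finally have 3: "(\<Sum>k<n. \<rho> k) \<le> \<dots>" .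
    have "?l \<le> norm ((\<integral>x. iexp (Z n x) \<partial>M) - (\<integral>x. indicator (H n) x * iexp (Z n x) \<partial>M))
       + norm ((\<integral>x. indicator (H n) x * iexp (Z n x) \<partial>M) - complex_of_real ((1 - h / 2) ^ n * prob (H 0)))
       + norm (complex_of_real ((1 - h / 2) ^ n * prob (H 0)) - complex_of_real ((1 - h / 2) ^ n))"
      by (smt (verit) norm_diff_triangle_ineq norm_triangle_ineq diff_add_cancel add_diff_eq)
    then show ?thesis using 1 2 3 tele PH Z0 by simp
  qed
qed

end

section \<open>Continuous martingales with deterministic bracket\<close>

text \<open>Conditional means and variances are encoded as integrals over the sets of
  \<open>F r\<close>, so that passing to a larger filtration only enlarges the family of test sets.
  The bracket on the interval from \<open>a\<close> to \<open>r\<close> is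
  \<open>\<sigma> * (r - a)\<close>.\<close>

locale const_bracket_martingale = prob_space +
  fixes F :: "real \<Rightarrow> 'a measure" and Z :: "real \<Rightarrow> 'a \<Rightarrow> real" and a b \<sigma> :: real
  assumes ab: "a \<le> b" and \<sigma>: "0 \<le> \<sigma>"
    and F: "\<And>r. a \<le> r \<Longrightarrow> r \<le> b \<Longrightarrow> subalgebra M (F r)"
    and F_mono: "\<And>r r'. a \<le> r \<Longrightarrow> r \<le> r' \<Longrightarrow> r' \<le> b \<Longrightarrow> sets (F r) \<subseteq> sets (F r')"
    and adapted: "\<And>r. a \<le> r \<Longrightarrow> r \<le> b \<Longrightarrow> Z r \<in> borel_measurable (F r)"
    and cont: "\<And>x. x \<in> space M \<Longrightarrow> continuous_on {a..b} (\<lambda>r. Z r x)"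
    and incr_L2: "\<And>r r'. a \<le> r \<Longrightarrow> r \<le> r' \<Longrightarrow> r' \<le> b \<Longrightarrow> integrable M (\<lambda>x. (Z r' x - Z r x)\<^sup>2)"
    and incr_mean: "\<And>r r' A. a \<le> r \<Longrightarrow> r \<le> r' \<Longrightarrow> r' \<le> b \<Longrightarrow> A \<in> sets (F r) \<Longrightarrow>
      (\<integral>x. (Z r' x - Z r x) * indicator A x \<partial>M) = 0"
    and incr_var: "\<And>r r' A. a \<le> r \<Longrightarrow> r \<le> r' \<Longrightarrow> r' \<le> b \<Longrightarrow> A \<in> sets (F r) \<Longrightarrow>
      (\<integral>x. (Z r' x - Z r x)\<^sup>2 * indicator A x \<partial>M) = \<sigma> * (r' - r) * prob A"
begin

definition node :: "nat \<Rightarrow> nat \<Rightarrow> real" where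
  "node n k = a + (b - a) * (k / n)"

lemma node_0 [simp]: "node n 0 = a"
  by (simp add: node_def)

lemma node_n [simp]: "0 < n \<Longrightarrow> node n n = b"
  by (simp add: node_def)

lemma node_mono: "j \<le> k \<Longrightarrow> node n j \<le> node n k"
  using ab by (auto simp: node_def intro!: mult_left_mono divide_right_mono)

lemma node_bounds: "k \<le> n \<Longrightarrow> 0 < n \<Longrightarrow> a \<le> node n k \<and> node n k \<le> b"
  using node_mono[of 0 k n] node_mono[of k n n] by auto

lemma node_Suc: "node n (Suc k) - node n k = (b - a) / n"
  by (cases "n = 0") (simp_all add: node_def field_simps)

lemma adapted': "a \<le> r \<Longrightarrow> r \<le> r' \<Longrightarrow> r' \<le> b \<Longrightarrow> Z r \<in> borel_measurable (F r')"
  using F[of r] F[of r'] F_mono[of r r'] adapted[of r]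
  by (auto intro!: measurable_from_subalg[of "F r'" "F r"] simp: subalgebra_def)

lemma Z_measurable: "a \<le> r \<Longrightarrow> r \<le> b \<Longrightarrow> Z r \<in> borel_measurable M"
  by (rule measurable_from_subalg[OF F adapted])

text \<open>Three limits in a fixed order. For fixed \<epsilon> and \<open>K\<close> the mesh tends
  to 0: uniform continuity puts each path outside \<open>W \<epsilon> n\<close> eventually, and
  dominated convergence removes both terms with \<open>W\<close>. Then \<epsilon> tends to 0, and
  last \<open>K\<close> tends to infinity, where boundedness of the paths empties
  \<open>L K\<close>.\<close>

lemma char_incr_a_b: "(\<integral>x. iexp (Z b x - Z a x) \<partial>M) = exp (- (\<sigma> * (b - a) / 2))"
proof (cases "a = b")
  case True
  then show ?thesis by (simp add: prob_space)
next
  case False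
  define Y where "Y r x = Z r x - Z a x" for r x
  define c where "c = \<sigma> * (b - a)"
  \<comment> \<open>All grids are collected at once: the event does not depend on the mesh, so it
    survives the limit in \<open>n\<close>, and it is measurable as a countable union over
    nodes.\<close>
  define L where "L K = {x\<in>space M. \<exists>n>0. \<exists>j\<le>n. real K < \<bar>Y (node n j) x\<bar>}" for K
  define W where "W \<epsilon> n = {x\<in>space M. \<exists>j<n. \<epsilon> < \<bar>Y (node n (Suc j)) x - Y (node n j) x\<bar>}" for \<epsilon> n
  have c0: "0 \<le> c" unfolding c_def using ab \<sigma> by simp
  have YM: "Y r \<in> borel_measurable M" if "a \<le> r" "r \<le> b" for r
    unfolding Y_def using that ab by (intro borel_measurable_diff Z_measurable) auto
  have Yn: "Y (node n j) \<in> borel_measurable M" if "j \<le> n" "0 < n" for n j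
    using node_bounds[of j n] that by (intro YM) auto
  have Ycont: "continuous_on {a..b} (\<lambda>r. Y r x)" if "x \<in> space M" for x
    unfolding Y_def by (intro continuous_intros cont that)
  have WM: "W \<epsilon> n \<in> sets M" for \<epsilon> n
  proof -
    have "W \<epsilon> n = (\<Union>j<n. {x\<in>space M. \<epsilon> < \<bar>Y (node n (Suc j)) x - Y (node n j) x\<bar>})"
      unfolding W_def by auto
    also have "\<dots> \<in> sets M"
    proof (intro sets.finite_UN)
      fix j assume "j \<in> {..<n}"
      then have [measurable]: "Y (node n (Suc j)) \<in> borel_measurable M" "Y (node n j) \<in> borel_measurable M"
        by (auto intro!: Yn)
      show "{x\<in>space M. \<epsilon> < \<bar>Y (node n (Suc j)) x - Y (node n j) x\<bar>} \<in> sets M" by measurable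
    qed simp
    finally show ?thesis .
  qed
  have LM: "L K \<in> sets M" for K
  proof -
    have "L K = (\<Union>n\<in>{0<..}. \<Union>j\<le>n. {x\<in>space M. real K < \<bar>Y (node n j) x\<bar>})"
      unfolding L_def by auto
    also have "\<dots> \<in> sets M"
    proof (intro sets.countable_UN'' sets.finite_UN)
      fix n j :: nat assume "n \<in> {0<..}" "j \<in> {..n}"
      then have [measurable]: "Y (node n j) \<in> borel_measurable M" by (auto intro!: Yn)
      show "{x\<in>space M. real K < \<bar>Y (node n j) x\<bar>} \<in> sets M" by measurable
    qed auto
    finally show ?thesis .
  qed
  define \<phi> where "\<phi> = (\<integral>x. iexp (Y b x) \<partial>M)"
  have bound: "norm (\<phi> - complex_of_real ((1 - (c / n) / 2) ^ n))
      \<le> 2 * prob (W \<epsilon> n) + 2 * prob (L K) + \<epsilon> * c + 2 * (\<integral>x. ((Y b x)\<^sup>2 + (real K)\<^sup>2) * indicator (W \<epsilon> n) x \<partial>M)"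
    and Yb2: "integrable M (\<lambda>x. (Y b x)\<^sup>2)"
    if n: "0 < n" "c / n \<le> 4" and \<epsilon>: "0 \<le> \<epsilon>" for n :: nat and \<epsilon> K
  proof -
    have nb: "a \<le> node n k" "node n k \<le> b" if "k \<le> n" for k using node_bounds[of k n] n that by auto
    have var: "\<sigma> * (node n (Suc k) - node n k) = c / n" for k unfolding node_Suc c_def by simp
    have D: "Y (node n (Suc k)) x - Y (node n k) x = Z (node n (Suc k)) x - Z (node n k) x" for k x
      unfolding Y_def by simp
    note * = char_telescope_truncated[of n "\<lambda>k. F (node n k)" "\<lambda>k. Y (node n k)" "c / n" \<epsilon> "L K" "real K",
        folded W_def]
    have A: "subalgebra M (F (node n k))" if "k \<le> n" for k using nb[OF that] F by auto
    have B: "sets (F (node n j)) \<subseteq> sets (F (node n k))" if "j \<le> k" "k \<le> n" for j k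
      using that nb by (intro F_mono node_mono) auto
    have C: "Y (node n k) \<in> borel_measurable (F (node n k))" if "k \<le> n" for k
      unfolding Y_def using that nb ab by (intro borel_measurable_diff adapted') auto
    have E: "integrable M (\<lambda>x. (Y (node n (Suc k)) x - Y (node n k) x)\<^sup>2)" if "k < n" for k
      unfolding D using that nb[of k] nb[of "Suc k"] by (intro incr_L2 node_mono) auto
    have m: "(\<integral>x. (Y (node n (Suc k)) x - Y (node n k) x) * indicator A x \<partial>M) = 0"
      if "k < n" "A \<in> sets (F (node n k))" for k A
      unfolding D using that nb[of k] nb[of "Suc k"] by (intro incr_mean node_mono) auto
    have v: "(\<integral>x. (Y (node n (Suc k)) x - Y (node n k) x)\<^sup>2 * indicator A x \<partial>M) = c / n * prob A"
      if "k < n" "A \<in> sets (F (node n k))" for k A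
      unfolding D var[symmetric, of k] using that nb[of k] nb[of "Suc k"] by (intro incr_var node_mono) auto
    have lK: "x \<in> L K" if "x \<in> space M" "j \<le> n" "real K < \<bar>Y (node n j) x\<bar>" for x j
      unfolding L_def using that n by auto
    have Y0: "Y (node n 0) x = 0" for x by (simp add: Y_def)
    have h0: "0 \<le> c / n" using c0 by simp
    have nc: "real n * (c / n) = c" using n by simp
    show "integrable M (\<lambda>x. (Y b x)\<^sup>2)"
    proof -
      have "integrable M (\<lambda>x. (Y (node n n) x)\<^sup>2)"
        by (rule *(1)) (fact A B C Y0 E m v h0 n \<epsilon> LM lK)+
      then show ?thesis using n(1) by simp
    qed
    show "norm (\<phi> - complex_of_real ((1 - (c / n) / 2) ^ n))
      \<le> 2 * prob (W \<epsilon> n) + 2 * prob (L K) + \<epsilon> * c + 2 * (\<integral>x. ((Y b x)\<^sup>2 + (real K)\<^sup>2) * indicator (W \<epsilon> n) x \<partial>M)"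
    proof -
      have "norm ((\<integral>x. iexp (Y (node n n) x) \<partial>M) - complex_of_real ((1 - (c / n) / 2) ^ n))
        \<le> 2 * prob (W \<epsilon> n) + 2 * prob (L K) + \<epsilon> * (n * (c / n))
          + 2 * (\<integral>x. ((Y (node n n) x)\<^sup>2 + (real K)\<^sup>2) * indicator (W \<epsilon> n) x \<partial>M)"
        by (rule *(2)) (fact A B C Y0 E m v h0 n \<epsilon> LM lK)+
      then show ?thesis unfolding \<phi>_def nc node_n[OF n(1)] .
    qed
  qed
  \<comment> \<open>From \<open>N\<close> on the mesh index is positive and the variance
    \<open>c / n\<close> of one step is at most 4, as the expansion demands.\<close>
  obtain N :: nat where N: "max 1 (c / 4) \<le> N" using real_arch_simple by blast
  have ev: "0 < n" "c / n \<le> 4" if "N \<le> n" for n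
  proof -
    have "max 1 (c / 4) \<le> real n" using N that by (meson of_nat_mono order_trans)
    then show "0 < n" "c / n \<le> 4" by (auto simp: field_simps)
  qed
  have Yb2': "integrable M (\<lambda>x. (Y b x)\<^sup>2)" using Yb2[OF ev[OF order_refl], of 0] by simp
  have W0: "\<forall>\<^sub>F n in sequentially. x \<notin> W \<epsilon> n" if x: "x \<in> space M" and \<epsilon>: "0 < \<epsilon>" for x \<epsilon>
  proof -
    have "uniformly_continuous_on {a..b} (\<lambda>r. Y r x)"
      by (rule compact_uniformly_continuous[OF Ycont[OF x]]) simp
    then obtain d where d: "0 < d" "\<And>r r'. r \<in> {a..b} \<Longrightarrow> r' \<in> {a..b} \<Longrightarrow> dist r' r < d \<Longrightarrow> dist (Y r' x) (Y r x) < \<epsilon>"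
      using \<epsilon> unfolding uniformly_continuous_on_def by metis
    obtain m :: nat where m: "(b - a) / d < m" using reals_Archimedean2 by blast
    show ?thesis
    proof (rule eventually_sequentiallyI[of "Suc m"])
      fix n assume n: "Suc m \<le> n"
      then have "(b - a) / d < n" using m by (smt (verit) of_nat_Suc of_nat_mono)
      then have s: "(b - a) / n < d" using d n by (auto simp: field_simps)
      show "x \<notin> W \<epsilon> n"
      proof
        assume "x \<in> W \<epsilon> n"
        then obtain j where j: "j < n" "\<epsilon> < \<bar>Y (node n (Suc j)) x - Y (node n j) x\<bar>" unfolding W_def by auto
        have "dist (Y (node n (Suc j)) x) (Y (node n j) x) < \<epsilon>"
          using node_bounds[of j n] node_bounds[of "Suc j" n] j(1) s node_Suc[of n j] ab
          by (intro d) (auto simp: dist_real_def)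
        then show False using j by (simp add: dist_real_def)
      qed
    qed
  qed
  have dom: "(\<lambda>n. \<integral>x. f x * indicator (W \<epsilon> n) x \<partial>M) \<longlonglongrightarrow> 0"
    if f: "integrable M f" and \<epsilon>: "0 < \<epsilon>" for f :: "'a \<Rightarrow> real" and \<epsilon>
  proof -
    have "(\<lambda>n. \<integral>x. f x * indicator (W \<epsilon> n) x \<partial>M) \<longlonglongrightarrow> (\<integral>x. 0 \<partial>M)"
    proof (rule integral_dominated_convergence[where w="\<lambda>x. norm (f x)"])
      show "AE x in M. (\<lambda>n. f x * indicator (W \<epsilon> n) x) \<longlonglongrightarrow> 0"
      proof (rule AE_I2)
        fix x assume "x \<in> space M"
        from W0[OF this \<epsilon>] have "\<forall>\<^sub>F n in sequentially. f x * indicator (W \<epsilon> n) x = 0"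
          by eventually_elim auto
        then show "(\<lambda>n. f x * indicator (W \<epsilon> n) x) \<longlonglongrightarrow> 0" by (rule tendsto_eventually)
      qed
    qed (use f WM in \<open>auto simp: indicator_def\<close>)
    then show ?thesis by simp
  qed
  have step: "norm (\<phi> - of_real (exp (- (c / 2)))) \<le> 2 * prob (L K) + \<epsilon> * c" if \<epsilon>: "0 < \<epsilon>" for \<epsilon> K
  proof (rule LIMSEQ_le)
    have "(\<lambda>n. (1 + (- (c / 2)) / real n) ^ n) \<longlonglongrightarrow> exp (- (c / 2))"
      by (rule tendsto_exp_limit_sequentially)
    then have "(\<lambda>n. (1 - (c / n) / 2) ^ n) \<longlonglongrightarrow> exp (- (c / 2))" by (simp add: mult.commute)
    then show "(\<lambda>n. norm (\<phi> - complex_of_real ((1 - (c / n) / 2) ^ n))) \<longlonglongrightarrow> norm (\<phi> - of_real (exp (- (c / 2))))"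
      by (intro tendsto_intros tendsto_of_real)
    have "(\<lambda>n. prob (W \<epsilon> n)) \<longlonglongrightarrow> 0" using dom[of "\<lambda>_. 1" \<epsilon>] \<epsilon> WM by simp
    moreover have "(\<lambda>n. \<integral>x. ((Y b x)\<^sup>2 + (real K)\<^sup>2) * indicator (W \<epsilon> n) x \<partial>M) \<longlonglongrightarrow> 0"
      using dom[of "\<lambda>x. (Y b x)\<^sup>2 + (real K)\<^sup>2" \<epsilon>] \<epsilon> Yb2' by simp
    ultimately have "(\<lambda>n. 2 * prob (W \<epsilon> n) + 2 * prob (L K) + \<epsilon> * c + 2 * (\<integral>x. ((Y b x)\<^sup>2 + (real K)\<^sup>2) * indicator (W \<epsilon> n) x \<partial>M))
      \<longlonglongrightarrow> 2 * 0 + 2 * prob (L K) + \<epsilon> * c + 2 * 0" by (intro tendsto_intros)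
    then show "(\<lambda>n. 2 * prob (W \<epsilon> n) + 2 * prob (L K) + \<epsilon> * c + 2 * (\<integral>x. ((Y b x)\<^sup>2 + (real K)\<^sup>2) * indicator (W \<epsilon> n) x \<partial>M))
      \<longlonglongrightarrow> 2 * prob (L K) + \<epsilon> * c" by simp
    show "\<exists>N. \<forall>n\<ge>N. norm (\<phi> - complex_of_real ((1 - (c / n) / 2) ^ n))
      \<le> 2 * prob (W \<epsilon> n) + 2 * prob (L K) + \<epsilon> * c + 2 * (\<integral>x. ((Y b x)\<^sup>2 + (real K)\<^sup>2) * indicator (W \<epsilon> n) x \<partial>M)"
      using bound ev \<epsilon> by (intro exI[of _ N]) auto
  qed
  have step2: "norm (\<phi> - of_real (exp (- (c / 2)))) \<le> 2 * prob (L K)" for K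
  proof (rule LIMSEQ_le_const)
    have "(\<lambda>n. 2 * prob (L K) + (1 / real (Suc n)) * c) \<longlonglongrightarrow> 2 * prob (L K) + 0 * c"
      by (intro tendsto_intros LIMSEQ_Suc[OF lim_1_over_n])
    then show "(\<lambda>n. 2 * prob (L K) + (1 / real (Suc n)) * c) \<longlonglongrightarrow> 2 * prob (L K)" by simp
    show "\<exists>N. \<forall>n\<ge>N. norm (\<phi> - of_real (exp (- (c / 2)))) \<le> 2 * prob (L K) + (1 / real (Suc n)) * c"
      by (intro exI allI impI step) simp
  qed
  have "(\<lambda>K. prob (L K)) \<longlonglongrightarrow> prob (\<Inter>K. L K)"
  proof (rule finite_Lim_measure_decseq)
    show "decseq L" unfolding L_def by (auto simp: decseq_def) (meson le_less_trans of_nat_mono)+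
  qed (use LM in auto)
  moreover have "(\<Inter>K. L K) = {}"
  proof (rule equals0I)
    fix x assume x: "x \<in> (\<Inter>K. L K)"
    then have xM: "x \<in> space M" unfolding L_def by auto
    have "compact ((\<lambda>r. Y r x) ` {a..b})" by (rule compact_continuous_image[OF Ycont[OF xM]]) simp
    then obtain B where B: "\<And>r. r \<in> {a..b} \<Longrightarrow> \<bar>Y r x\<bar> \<le> B"
      by (fastforce dest!: compact_imp_bounded simp: bounded_iff)
    obtain K :: nat where K: "B \<le> K" using real_arch_simple by blast
    from x obtain n j where "0 < n" "j \<le> n" "real K < \<bar>Y (node n j) x\<bar>" unfolding L_def by blast
    then show False using B[of "node n j"] node_bounds[of j n] K by auto
  qed
  ultimately have "(\<lambda>K. 2 * prob (L K)) \<longlonglongrightarrow> 2 * 0" by (intro tendsto_intros) simp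
  then have "norm (\<phi> - of_real (exp (- (c / 2)))) \<le> 2 * 0"
    by (rule LIMSEQ_le_const) (intro exI allI impI step2)
  then show ?thesis unfolding \<phi>_def c_def Y_def by simp
qed

text \<open>Scaling by \<open>u\<close> multiplies the bracket by the square of \<open>u\<close>.
  The single value computed in \<open>char_incr_a_b\<close> thus yields the whole characteristic
  function, on every subinterval.\<close>

lemma restrict_scale:
  assumes "a \<le> r" "r \<le> r'" "r' \<le> b"
  shows "const_bracket_martingale M F (\<lambda>s x. u * Z s x) r r' (u\<^sup>2 * \<sigma>)"
proof (unfold_locales)
  show "0 \<le> u\<^sup>2 * \<sigma>" using \<sigma> by simp
  fix s s' assume s: "r \<le> s" "s \<le> s'" "s' \<le> r'"
  have D: "u * Z s' x - u * Z s x = u * (Z s' x - Z s x)" for x by (simp add: algebra_simps)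
  show "integrable M (\<lambda>x. (u * Z s' x - u * Z s x)\<^sup>2)"
    unfolding D power_mult_distrib using s assms by (intro integrable_mult_right incr_L2) auto
  fix A assume A: "A \<in> sets (F s)"
  show "(\<integral>x. (u * Z s' x - u * Z s x) * indicator A x \<partial>M) = 0"
    unfolding D mult.assoc using s assms incr_mean[OF _ s(2) _ A] by simp
  show "(\<integral>x. (u * Z s' x - u * Z s x)\<^sup>2 * indicator A x \<partial>M) = u\<^sup>2 * \<sigma> * (s' - s) * prob A"
    unfolding D power_mult_distrib mult.assoc using s assms incr_var[OF _ s(2) _ A]
    by (simp add: mult.assoc)
next
  fix x assume "x \<in> space M"
  then show "continuous_on {r..r'} (\<lambda>s. u * Z s x)"
    using assms by (intro continuous_on_mult_left continuous_on_subset[OF cont]) auto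
qed (use assms F F_mono adapted in auto)

lemma char_incr:
  assumes "a \<le> r" "r \<le> r'" "r' \<le> b"
  shows "(\<integral>x. iexp (u * (Z r' x - Z r x)) \<partial>M) = exp (- (u\<^sup>2 * (\<sigma> * (r' - r)) / 2))"
  using const_bracket_martingale.char_incr_a_b[OF restrict_scale[OF assms, of u]]
  by (simp add: algebra_simps)

end

text \<open>The characteristic function identifies the law of \<open>Y\<close> with that of
  \<open>sqrt c\<close> times a standard normal variable, whose density is known as that of an
  affine image. Positivity of \<open>c\<close> ensures that there is a density.\<close>

lemma (in prob_space) distributed_normalI:
  assumes [measurable]: "Y \<in> borel_measurable M" and c: "0 < c"
    and ch: "\<And>u. (\<integral>x. iexp (u * Y x) \<partial>M) = exp (- (u\<^sup>2 * c / 2))"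
  shows "distributed M lborel Y (normal_density 0 (sqrt c))"
proof -
  interpret N: prob_space std_normal_distribution by (rule prob_space_normal_density) simp
  have [measurable_cong]: "sets std_normal_distribution = sets borel" by simp
  have "distributed std_normal_distribution lborel (\<lambda>x. x) std_normal_density"
    unfolding distributed_def by (auto simp: distr_id2)
  from N.normal_density_affine[OF this _ _, of "sqrt c" 0] c
  have d: "distributed std_normal_distribution lborel (\<lambda>x. sqrt c * x) (normal_density 0 (sqrt c))" by simp
  have "distr M borel Y = distr std_normal_distribution borel (\<lambda>x. sqrt c * x)"
  proof (intro Levy_uniqueness ext)
    show "real_distribution (distr M borel Y)" by simp
    show "real_distribution (distr std_normal_distribution borel (\<lambda>x. sqrt c * x))"
      by (intro N.real_distribution_distr) simp
    fix u
    have "char (distr std_normal_distribution borel (\<lambda>x. sqrt c * x)) u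
        = (\<integral>x. iexp (u * (sqrt c * x)) \<partial>std_normal_distribution)"
      unfolding char_def by (subst integral_distr) auto
    also have "\<dots> = char std_normal_distribution (u * sqrt c)"
      unfolding char_def by (simp add: mult.assoc)
    also have "\<dots> = exp (- (u\<^sup>2 * c / 2))"
      unfolding char_std_normal_distribution using c by (simp add: power_mult_distrib)
    also have "\<dots> = char (distr M borel Y) u"
      unfolding ch[symmetric] char_def by (subst integral_distr) auto
    finally show "char (distr M borel Y) u = char (distr std_normal_distribution borel (\<lambda>x. sqrt c * x)) u" ..
  qed
  moreover have "distr M lborel Y = distr M borel Y" by (rule distr_cong) auto
  moreover have "distr std_normal_distribution lborel (\<lambda>x. sqrt c * x)
      = distr std_normal_distribution borel (\<lambda>x. sqrt c * x)" by (rule distr_cong) auto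
  ultimately show ?thesis using d unfolding distributed_def by simp
qed

lemma (in prob_space) normal_fourth_moment:
  assumes d: "distributed M lborel Y (normal_density 0 (sqrt c))" and c: "0 < c"
  shows "integrable M (\<lambda>x. Y x ^ 4)" "(\<integral>x. Y x ^ 4 \<partial>M) = 3 * c\<^sup>2"
proof -
  have "integrable lborel (\<lambda>x. normal_density 0 (sqrt c) x * x ^ 4)"
    using integrable_normal_moment[of "sqrt c" 0 4] c by simp
  then show "integrable M (\<lambda>x. Y x ^ 4)"
    by (subst distributed_integrable[OF d, symmetric]) auto
  have "(\<integral>x. Y x ^ 4 \<partial>M) = (\<integral>x. normal_density 0 (sqrt c) x * x ^ 4 \<partial>lborel)"
    by (rule distributed_integral[OF d, symmetric]) auto
  also have "\<dots> = 3 * c\<^sup>2"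
    using integral_normal_moment_even[of "sqrt c" 0 2] c by (simp add: fact_numeral field_simps power2_eq_square)
  finally show "(\<integral>x. Y x ^ 4 \<partial>M) = 3 * c\<^sup>2" .
qed

text \<open>The bracket is postulated for the filtration \<open>F\<close> only. As it is the limit of the sums of squared
  increments, a pathwise quantity, it is also the bracket for every larger filtration \<open>G\<close> in which the
  process remains a martingale.\<close>

locale const_bracket_martingale_ext = const_bracket_martingale +
  fixes G :: "real \<Rightarrow> 'a measure"
  assumes \<sigma>_pos: "0 < \<sigma>"
    and G: "\<And>r. a \<le> r \<Longrightarrow> r \<le> b \<Longrightarrow> subalgebra M (G r)"
    and G_mono: "\<And>r r'. a \<le> r \<Longrightarrow> r \<le> r' \<Longrightarrow> r' \<le> b \<Longrightarrow> sets (G r) \<subseteq> sets (G r')"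
    and F_sub_G: "\<And>r. a \<le> r \<Longrightarrow> r \<le> b \<Longrightarrow> sets (F r) \<subseteq> sets (G r)"
    and incr_mean_G: "\<And>r r' A. a \<le> r \<Longrightarrow> r \<le> r' \<Longrightarrow> r' \<le> b \<Longrightarrow> A \<in> sets (G r) \<Longrightarrow>
      (\<integral>x. (Z r' x - Z r x) * indicator A x \<partial>M) = 0"
begin

lemma adapted_G: "a \<le> r \<Longrightarrow> r \<le> r' \<Longrightarrow> r' \<le> b \<Longrightarrow> Z r \<in> borel_measurable (G r')"
  using F[of r'] G[of r'] F_sub_G[of r'] adapted'[of r r']
  by (auto intro!: measurable_from_subalg[of "G r'" "F r'"] simp: subalgebra_def)

text \<open>The hypotheses contain second moments only. The fourth moment is what the first
  expansion buys, through the Gaussian law of the increment.\<close>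

lemma fourth_moment:
  assumes "a \<le> r" "r < r'" "r' \<le> b"
  shows "integrable M (\<lambda>x. (Z r' x - Z r x) ^ 4)"
    and "(\<integral>x. (Z r' x - Z r x) ^ 4 \<partial>M) = 3 * (\<sigma> * (r' - r))\<^sup>2"
proof -
  have "distributed M lborel (\<lambda>x. Z r' x - Z r x) (normal_density 0 (sqrt (\<sigma> * (r' - r))))"
    using assms \<sigma>_pos char_incr[of r r']
    by (intro distributed_normalI borel_measurable_diff Z_measurable) auto
  from normal_fourth_moment[OF this] show "integrable M (\<lambda>x. (Z r' x - Z r x) ^ 4)"
    and "(\<integral>x. (Z r' x - Z r x) ^ 4 \<partial>M) = 3 * (\<sigma> * (r' - r))\<^sup>2"
    using assms \<sigma>_pos by auto
qed

lemma incr_second_moment: "a \<le> r \<Longrightarrow> r \<le> r' \<Longrightarrow> r' \<le> b \<Longrightarrow> (\<integral>x. (Z r' x - Z r x)\<^sup>2 \<partial>M) = \<sigma> * (r' - r)"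
proof -
  assume r: "a \<le> r" "r \<le> r'" "r' \<le> b"
  have "space M \<in> sets (F r)" using F[of r] sets.top[of "F r"] r by (simp add: subalgebra_def)
  from incr_var[OF r this] show ?thesis
    by (subst (asm) Bochner_Integration.integral_cong[of M M _ "\<lambda>x. (Z r' x - Z r x)\<^sup>2"]) (auto simp: prob_space)
qed

section \<open>Quadratic variation and the change of filtration\<close>

context
  assumes ab_less: "a < b"
begin

lemma node_le_b: "k \<le> n \<Longrightarrow> 0 < n \<Longrightarrow> node n k \<le> b" and node_ge_a: "k \<le> n \<Longrightarrow> 0 < n \<Longrightarrow> a \<le> node n k"
  using node_bounds by auto

lemma node_less: "0 < n \<Longrightarrow> node n k < node n (Suc k)"
  using node_Suc[of n k] divide_pos_pos[of "b - a" "real n"] ab_less by linarith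

text \<open>The compensated quadratic variation along the grid: a discrete martingale for
  \<open>F\<close>, yet computed from the path without reference to a filtration.\<close>

definition defect :: "nat \<Rightarrow> nat \<Rightarrow> 'a \<Rightarrow> real" where
  "defect n k x = (\<Sum>j<k. (Z (node n (Suc j)) x - Z (node n j) x)\<^sup>2 - \<sigma> * (b - a) / n)"

lemma defect_measurable: "k \<le> n \<Longrightarrow> 0 < n \<Longrightarrow> defect n k \<in> borel_measurable (F (node n k))"
  unfolding defect_def
  by (intro borel_measurable_sum borel_measurable_diff borel_measurable_power borel_measurable_const adapted' node_mono)
    (auto intro: node_le_b node_ge_a)

text \<open>With \<open>h\<close> the variance of the Gaussian increment, the second moment of its
  compensated square is
  \<open>3 * h\<^sup>2 - 2 * h\<^sup>2 + h\<^sup>2 = 2 * h\<^sup>2\<close>.\<close>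

lemma incr_sq_defect:
  assumes "k < n"
  defines "d \<equiv> \<lambda>x. (Z (node n (Suc k)) x - Z (node n k) x)\<^sup>2 - \<sigma> * (b - a) / n"
  shows "d \<in> borel_measurable M" "integrable M (\<lambda>x. (d x)\<^sup>2)" "(\<integral>x. (d x)\<^sup>2 \<partial>M) = 2 * (\<sigma> * (b - a) / n)\<^sup>2"
    "A \<in> sets (F (node n k)) \<Longrightarrow> (\<integral>x. d x * indicator A x \<partial>M) = 0"
proof -
  define D where "D x = Z (node n (Suc k)) x - Z (node n k) x" for x
  define h where "h = \<sigma> * (b - a) / n"
  have n: "0 < n" "k \<le> n" "Suc k \<le> n" using assms by auto
  note nn = node_ge_a[OF n(2,1)] node_less[OF n(1), of k] node_le_b[OF n(3,1)] order.strict_implies_order[OF node_less[OF n(1), of k]]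
  have hn: "\<sigma> * (node n (Suc k) - node n k) = h" unfolding node_Suc h_def by simp
  have d: "d = (\<lambda>x. (D x)\<^sup>2 - h)" unfolding d_def D_def h_def by simp
  have DM: "D \<in> borel_measurable M" unfolding D_def using nn by (intro borel_measurable_diff Z_measurable) auto
  then show "d \<in> borel_measurable M" unfolding d by simp
  have i4: "integrable M (\<lambda>x. D x ^ 4)" "(\<integral>x. D x ^ 4 \<partial>M) = 3 * h\<^sup>2"
    using fourth_moment[OF nn(1-3)] unfolding D_def hn by auto
  have i2: "integrable M (\<lambda>x. (D x)\<^sup>2)" "(\<integral>x. (D x)\<^sup>2 \<partial>M) = h"
    using incr_L2[OF nn(1,4,3)] incr_second_moment[OF nn(1,4,3)] unfolding D_def hn by auto
  have sq: "(d x)\<^sup>2 = D x ^ 4 - 2 * h * (D x)\<^sup>2 + h\<^sup>2" for x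
    unfolding d by (simp add: power2_eq_square power4_eq_xxxx algebra_simps)
  show "integrable M (\<lambda>x. (d x)\<^sup>2)" unfolding sq using i4 i2 by simp
  show "(\<integral>x. (d x)\<^sup>2 \<partial>M) = 2 * (\<sigma> * (b - a) / n)\<^sup>2" unfolding sq h_def[symmetric] using i4 i2
    by (simp add: prob_space power2_eq_square)
  assume A: "A \<in> sets (F (node n k))"
  then have AM: "A \<in> sets M" using F[of "node n k"] nn by (auto simp: subalgebra_def)
  have "(\<integral>x. d x * indicator A x \<partial>M) = (\<integral>x. (D x)\<^sup>2 * indicator A x - h * indicator A x \<partial>M)"
    unfolding d by (simp add: algebra_simps)
  also have "\<dots> = h * prob A - h * prob A"
    using integrable_mult_indicator[OF AM i2(1)] AM incr_var[OF nn(1,4,3) A] unfolding D_def hn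
    by (subst Bochner_Integration.integral_diff) (auto simp: mult.commute less_top[symmetric])
  finally show "(\<integral>x. d x * indicator A x \<partial>M) = 0" by simp
qed

text \<open>The compensated squares are orthogonal martingale differences, so their second moments
  add. At \<open>k = n\<close> the total is of order \<open>1 / n\<close>.\<close>

lemma defect_L2:
  assumes n: "0 < n"
  shows "k \<le> n \<Longrightarrow> integrable M (\<lambda>x. (defect n k x)\<^sup>2) \<and> (\<integral>x. (defect n k x)\<^sup>2 \<partial>M) = k * (2 * (\<sigma> * (b - a) / n)\<^sup>2)"
proof (induction k)
  case 0
  show ?case by (simp add: defect_def)
next
  case (Suc k)
  then have k: "k < n" "k \<le> n" "Suc k \<le> n" by auto
  define d where "d x = (Z (node n (Suc k)) x - Z (node n k) x)\<^sup>2 - \<sigma> * (b - a) / n" for x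
  note d = incr_sq_defect[OF k(1), folded d_def]
  have sub: "subalgebra M (F (node n k))" by (intro F node_ge_a node_le_b k n)
  have S: "defect n (Suc k) x = defect n k x + d x" for x unfolding defect_def d_def by simp
  have dk: "defect n k \<in> borel_measurable M" by (rule measurable_from_subalg[OF sub defect_measurable[OF k(2) n]])
  have I: "integrable M (\<lambda>x. (defect n (Suc k) x)\<^sup>2)"
    unfolding S using Suc.IH[OF k(2)] d by (intro integrable_square_add dk) auto
  have top: "space M \<in> sets (F (node n k))" using sub sets.top[of "F (node n k)"] by (simp add: subalgebra_def)
  have full: "(\<integral>x. f x * indicator (space M) x \<partial>M) = (\<integral>x. f x \<partial>M)" for f :: "'a \<Rightarrow> real"
    by (intro Bochner_Integration.integral_cong) auto
  have "(\<integral>x. (defect n (Suc k) x)\<^sup>2 \<partial>M) = (\<integral>x. (defect n k x)\<^sup>2 \<partial>M) + (\<integral>x. (d x)\<^sup>2 \<partial>M)"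
    unfolding S using second_moment_step[OF sub defect_measurable[OF k(2) n] d(1) _ d(2) d(4) top] Suc.IH[OF k(2)]
    unfolding full by blast
  also have "\<dots> = Suc k * (2 * (\<sigma> * (b - a) / n)\<^sup>2)"
    using d(3) Suc.IH[OF k(2)] by (simp add: algebra_simps)
  finally show ?case using I by blast
qed

text \<open>Orthogonality of the increments in the larger filtration: a set of \<open>G a\<close>
  belongs to every later \<open>G\<close>, so the cross terms vanish over it by the mean-zero
  property.\<close>

lemma incr_sq_G_sum:
  assumes n: "0 < n" and A: "A \<in> sets (G a)"
  shows "k \<le> n \<Longrightarrow> (\<integral>x. (Z (node n k) x - Z a x)\<^sup>2 * indicator A x \<partial>M)
    = (\<Sum>j<k. \<integral>x. (Z (node n (Suc j)) x - Z (node n j) x)\<^sup>2 * indicator A x \<partial>M)"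
proof (induction k)
  case (Suc k)
  then have k: "k < n" "k \<le> n" "Suc k \<le> n" by auto
  note nn = node_ge_a[OF k(2) n] order.strict_implies_order[OF node_less[OF n(1), of k]] node_le_b[OF k(3) n]
  have A': "A \<in> sets (G (node n k))" using G_mono[of a "node n k"] A nn by auto
  have "(\<integral>x. ((Z (node n k) x - Z a x) + (Z (node n (Suc k)) x - Z (node n k) x))\<^sup>2 * indicator A x \<partial>M)
    = (\<integral>x. (Z (node n k) x - Z a x)\<^sup>2 * indicator A x \<partial>M)
      + (\<integral>x. (Z (node n (Suc k)) x - Z (node n k) x)\<^sup>2 * indicator A x \<partial>M)"
    by (rule second_moment_step[of "G (node n k)"])
      (use nn ab A' in \<open>auto intro!: G incr_L2 incr_mean_G borel_measurable_diff adapted_G Z_measurable\<close>)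
  then show ?case using Suc by simp
qed simp

text \<open>For every \<open>n\<close> the two sides differ by the integral of
  \<open>defect n n\<close> over \<open>A\<close>: the square is split over the grid by
  orthogonality in \<open>G\<close>, while the size of the defect was computed in \<open>F\<close>.
  Its second moment \<open>2 * c\<^sup>2 / n\<close>, with \<open>c = \<sigma> * (b - a)\<close>,
  tends to 0.\<close>

lemma incr_var_G_a_b:
  assumes A: "A \<in> sets (G a)"
  shows "(\<integral>x. (Z b x - Z a x)\<^sup>2 * indicator A x \<partial>M) = \<sigma> * (b - a) * prob A"
proof -
  define c where "c = \<sigma> * (b - a)"
  have AM: "A \<in> sets M" using G[of a] A ab by (auto simp: subalgebra_def)
  define e where "e = \<bar>(\<integral>x. (Z b x - Z a x)\<^sup>2 * indicator A x \<partial>M) - c * prob A\<bar>"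
  have bd: "e \<le> 2 * c\<^sup>2 / \<eta> / real n + \<eta>" if n: "0 < n" and \<eta>: "0 < \<eta>" for n :: nat and \<eta>
  proof -
    have D: "integrable M (\<lambda>x. (Z (node n (Suc j)) x - Z (node n j) x)\<^sup>2 * indicator A x)" if "j < n" for j
    proof -
      have "integrable M (\<lambda>x. (Z (node n (Suc j)) x - Z (node n j) x)\<^sup>2)"
        using that n by (intro incr_L2 node_ge_a node_le_b node_mono) auto
      from integrable_mult_indicator[OF AM this] show ?thesis by (simp add: mult.commute)
    qed
    have cn: "defect n n x = (\<Sum>j<n. (Z (node n (Suc j)) x - Z (node n j) x)\<^sup>2) - c" for x
      using n by (simp add: defect_def sum_subtractf c_def)
    have "(\<integral>x. (Z b x - Z a x)\<^sup>2 * indicator A x \<partial>M) - c * prob A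
      = (\<Sum>j<n. \<integral>x. (Z (node n (Suc j)) x - Z (node n j) x)\<^sup>2 * indicator A x \<partial>M) - (\<integral>x. c * indicator A x \<partial>M)"
      using incr_sq_G_sum[OF n A, of n] n AM by simp
    also have "\<dots> = (\<integral>x. (\<Sum>j<n. (Z (node n (Suc j)) x - Z (node n j) x)\<^sup>2 * indicator A x) - c * indicator A x \<partial>M)"
    proof -
      have "(\<Sum>j<n. \<integral>x. (Z (node n (Suc j)) x - Z (node n j) x)\<^sup>2 * indicator A x \<partial>M)
        = (\<integral>x. (\<Sum>j<n. (Z (node n (Suc j)) x - Z (node n j) x)\<^sup>2 * indicator A x) \<partial>M)"
        by (rule Bochner_Integration.integral_sum[symmetric]) (use D in simp)
      moreover have "integrable M (\<lambda>x. \<Sum>j<n. (Z (node n (Suc j)) x - Z (node n j) x)\<^sup>2 * indicator A x)"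
        by (rule Bochner_Integration.integrable_sum) (use D in simp)
      moreover have "integrable M (\<lambda>x. c * indicator A x)" using AM by (simp add: less_top[symmetric])
      ultimately show ?thesis by (simp only: Bochner_Integration.integral_diff)
    qed
    also have "\<dots> = (\<integral>x. defect n n x * indicator A x \<partial>M)"
      by (simp only: cn sum_distrib_right left_diff_distrib)
    finally have "e = norm (\<integral>x. defect n n x * indicator A x \<partial>M)" unfolding e_def by simp
    also have "\<dots> \<le> (\<integral>x. (defect n n x)\<^sup>2 / \<eta> + \<eta> \<partial>M)"
    proof (rule norm_integral_le)
      show "integrable M (\<lambda>x. (defect n n x)\<^sup>2 / \<eta> + \<eta>)" using defect_L2[OF n, of n] by simp
      fix x
      \<comment> \<open>Expanding gives
        \<open>\<bar>y\<bar> \<le> y\<^sup>2 / \<eta> + \<eta>\<close>, a substitute for the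
        Cauchy-Schwarz inequality: first \<open>n\<close> tends to infinity, then \<eta> to
        0.\<close>
      have "0 \<le> (\<bar>defect n n x\<bar> - \<eta>)\<^sup>2 + \<bar>defect n n x\<bar> * \<eta>" using \<eta> by simp
      moreover have "(\<bar>defect n n x\<bar> - \<eta>)\<^sup>2 = (defect n n x)\<^sup>2 - 2 * (\<bar>defect n n x\<bar> * \<eta>) + \<eta>\<^sup>2"
        by (simp add: power2_diff)
      ultimately have "\<bar>defect n n x\<bar> * \<eta> \<le> (defect n n x)\<^sup>2 + \<eta>\<^sup>2" by linarith
      then have "\<bar>defect n n x\<bar> \<le> (defect n n x)\<^sup>2 / \<eta> + \<eta>"
        using \<eta> by (simp add: field_simps power2_eq_square)
      moreover have "norm (defect n n x * indicator A x) \<le> \<bar>defect n n x\<bar>" by (simp add: indicator_def)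
      ultimately show "norm (defect n n x * indicator A x) \<le> (defect n n x)\<^sup>2 / \<eta> + \<eta>" by linarith
    qed
    also have "\<dots> = 2 * c\<^sup>2 / \<eta> / real n + \<eta>"
      using defect_L2[OF n, of n] n unfolding c_def[symmetric]
      by (simp add: prob_space power2_eq_square)
    finally show ?thesis .
  qed
  have "e \<le> \<eta>" if \<eta>: "0 < \<eta>" for \<eta>
  proof (rule LIMSEQ_le_const)
    have "(\<lambda>n. 2 * c\<^sup>2 / \<eta> * (1 / real n) + \<eta>) \<longlonglongrightarrow> 2 * c\<^sup>2 / \<eta> * 0 + \<eta>"
      by (intro tendsto_intros lim_1_over_n)
    then show "(\<lambda>n. 2 * c\<^sup>2 / \<eta> / real n + \<eta>) \<longlonglongrightarrow> \<eta>" by simp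
    show "\<exists>N. \<forall>n\<ge>N. e \<le> 2 * c\<^sup>2 / \<eta> / real n + \<eta>"
      by (intro exI[of _ 1] allI impI bd \<eta>) auto
  qed
  then have "e \<le> 0" using field_le_epsilon[of e 0] by auto
  then show ?thesis unfolding e_def c_def by simp
qed

end

lemma restrict_ext:
  assumes "a \<le> r" "r \<le> r'" "r' \<le> b"
  shows "const_bracket_martingale_ext M F Z r r' \<sigma> G"
proof -
  interpret R: const_bracket_martingale M F Z r r' \<sigma>
    using restrict_scale[OF assms, of 1] by simp
  show ?thesis
    by unfold_locales (use assms \<sigma>_pos G G_mono F_sub_G incr_mean_G in auto)
qed

lemma incr_var_G:
  assumes "a \<le> r" "r \<le> r'" "r' \<le> b" "A \<in> sets (G r)"
  shows "(\<integral>x. (Z r' x - Z r x)\<^sup>2 * indicator A x \<partial>M) = \<sigma> * (r' - r) * prob A"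
proof (cases "r = r'")
  case False
  then show ?thesis
    using const_bracket_martingale_ext.incr_var_G_a_b[OF restrict_ext[OF assms(1-3)] _ assms(4)] assms by simp
qed simp

text \<open>The freezing events of \<open>char_telescope\<close> are constantly \<open>A\<close>, so
  no probability is lost. Fourth moments bound each remainder by \<open>4 * h * sqrt h\<close> with
  \<open>h = c / n\<close>, and the \<open>n\<close> remainders add up to
  \<open>4 * c * sqrt (c / n)\<close>, which tends to 0. Carrying \<open>A\<close> along is what
  gives independence of \<open>G a\<close>.\<close>

lemma char_incr_G:
  assumes A: "A \<in> sets (G a)"
  shows "(\<integral>x. indicator A x * iexp (Z b x - Z a x) \<partial>M) = exp (- (\<sigma> * (b - a) / 2)) * prob A"
proof (cases "a = b")
  case True
  have "A \<in> sets M" using G[of a] A ab by (auto simp: subalgebra_def)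
  then have "(\<integral>x. complex_of_real (indicator A x) \<partial>M) = prob A" by simp
  moreover have "(\<integral>x. indicator A x * iexp (Z b x - Z a x) \<partial>M) = (\<integral>x. complex_of_real (indicator A x) \<partial>M)"
    using True by (intro Bochner_Integration.integral_cong) (auto simp: indicator_def)
  ultimately show ?thesis using True by simp
next
  case False
  then have less: "a < b" using ab by simp
  define c where "c = \<sigma> * (b - a)"
  have c: "0 < c" unfolding c_def using less \<sigma>_pos by simp
  have AM: "A \<in> sets M" using G[of a] A ab by (auto simp: subalgebra_def)
  define E where "E = (\<integral>x. indicator A x * iexp (Z b x - Z a x) \<partial>M)"
  obtain N :: nat where N: "max 1 (c / 4) \<le> N" using real_arch_simple by blast
  have bd: "norm (E - complex_of_real ((1 - (c / n) / 2) ^ n * prob A)) \<le> 4 * c * sqrt (c / n)" if "N \<le> n" for n :: nat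
  proof -
    have "max 1 (c / 4) \<le> real n" using N that by (meson of_nat_mono order_trans)
    then have n: "0 < n" "c / n \<le> 4" by (auto simp: field_simps)
    define h where "h = c / n"
    have h: "0 < h" "h \<le> 4" "n * h = c" unfolding h_def using c n by auto
    have nn: "a \<le> node n k" "node n k \<le> b" if "k \<le> n" for k
      using that n by (auto intro: node_ge_a[OF less] node_le_b[OF less])
    have hn: "\<sigma> * (node n (Suc k) - node n k) = h" for k unfolding node_Suc h_def c_def by simp
    have nm: "node n k < node n (Suc k)" "node n k \<le> node n (Suc k)" for k
      using node_less[OF less n(1), of k] by auto
    define R where "R k = (\<integral>x. indicator A x * min ((Z (node n (Suc k)) x - Z (node n k) x)\<^sup>2)
        (\<bar>Z (node n (Suc k)) x - Z (node n k) x\<bar> ^ 3) \<partial>M)" for k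
    have R: "R k \<le> 4 * h * sqrt h" if k: "k < n" for k
    proof -
      define D where "D x = Z (node n (Suc k)) x - Z (node n k) x" for x
      have i4: "integrable M (\<lambda>x. D x ^ 4)" "(\<integral>x. D x ^ 4 \<partial>M) = 3 * h\<^sup>2"
        using fourth_moment[of "node n k" "node n (Suc k)"] k nn nm unfolding D_def hn by auto
      have i2: "integrable M (\<lambda>x. (D x)\<^sup>2)" "(\<integral>x. (D x)\<^sup>2 \<partial>M) = h"
        using incr_L2[of "node n k" "node n (Suc k)"] incr_second_moment[of "node n k" "node n (Suc k)"] k nn nm
        unfolding D_def hn by auto
      \<comment> \<open>The cube is split at the standard deviation:
        \<open>\<bar>D x\<bar> \<le> sqrt h + (D x)\<^sup>2 / sqrt h\<close>. With the moments
        \<open>h\<close> and \<open>3 * h\<^sup>2\<close> the two terms contribute 1 and 3 times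
        \<open>h * sqrt h\<close>, whence the constant 4.\<close>
      have "R k \<le> (\<integral>x. sqrt h * (D x)\<^sup>2 + D x ^ 4 / sqrt h \<partial>M)"
        unfolding R_def D_def[symmetric]
      proof (rule integral_mono')
        show "integrable M (\<lambda>x. sqrt h * (D x)\<^sup>2 + D x ^ 4 / sqrt h)" using i4 i2 by simp
        fix x
        show "0 \<le> sqrt h * (D x)\<^sup>2 + D x ^ 4 / sqrt h" using h by simp
        have "\<bar>D x\<bar> * sqrt h \<le> h + (D x)\<^sup>2"
        proof -
          have "0 \<le> (\<bar>D x\<bar> - sqrt h)\<^sup>2 + \<bar>D x\<bar> * sqrt h" using h by simp
          moreover have "(\<bar>D x\<bar> - sqrt h)\<^sup>2 = (D x)\<^sup>2 - 2 * (\<bar>D x\<bar> * sqrt h) + h"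
            using h by (simp add: power2_diff)
          ultimately show ?thesis by linarith
        qed
        then have le: "\<bar>D x\<bar> \<le> sqrt h + (D x)\<^sup>2 / sqrt h"
          using h by (simp add: field_simps)
        have D3: "\<bar>D x\<bar> ^ 3 = (D x)\<^sup>2 * \<bar>D x\<bar>"
          unfolding power2_abs[symmetric, of "D x"] by (simp only: power3_eq_cube power2_eq_square)
        have D4: "D x ^ 4 = (D x)\<^sup>2 * (D x)\<^sup>2" by (simp add: power4_eq_xxxx power2_eq_square)
        have "\<bar>D x\<bar> ^ 3 \<le> (D x)\<^sup>2 * (sqrt h + (D x)\<^sup>2 / sqrt h)"
          unfolding D3 by (rule mult_left_mono[OF le]) simp
        also have "\<dots> = sqrt h * (D x)\<^sup>2 + D x ^ 4 / sqrt h"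
          unfolding D4 by (simp only: distrib_left times_divide_eq_right mult.commute)
        finally have "\<bar>D x\<bar> ^ 3 \<le> sqrt h * (D x)\<^sup>2 + D x ^ 4 / sqrt h" .
        moreover have "0 \<le> sqrt h * (D x)\<^sup>2 + D x ^ 4 / sqrt h" using h by simp
        ultimately show "indicator A x * min ((D x)\<^sup>2) (\<bar>D x\<bar> ^ 3) \<le> sqrt h * (D x)\<^sup>2 + D x ^ 4 / sqrt h"
          by (auto simp: indicator_def)
      qed
      also have "\<dots> = sqrt h * h + 3 * h\<^sup>2 / sqrt h" using i4 i2 by simp
      also have "h\<^sup>2 / sqrt h = h * sqrt h"
        using h by (simp add: power2_eq_square real_div_sqrt flip: times_divide_eq_right)
      then have "sqrt h * h + 3 * h\<^sup>2 / sqrt h = 4 * h * sqrt h" by simp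
      finally show ?thesis .
    qed
    have "norm ((\<integral>x. indicator A x * iexp (Z (node n n) x - Z (node n 0) x) \<partial>M) - complex_of_real ((1 - h / 2) ^ n * prob A))
      \<le> (prob A - prob A) + (\<Sum>k<n. R k)"
      unfolding R_def
    proof (rule char_telescope[of n "\<lambda>k. G (node n k)" "\<lambda>k. Z (node n k)" "\<lambda>_. A" h])
      fix k assume k: "k \<le> n"
      show "subalgebra M (G (node n k))" using nn[OF k] by (rule G)
      show "(\<lambda>x. Z (node n k) x - Z (node n 0) x) \<in> borel_measurable (G (node n k))"
        using nn[OF k] ab by (auto intro!: borel_measurable_diff adapted_G)
      show "A \<in> sets (G (node n k))" using G_mono[of a "node n k"] A nn[OF k] by auto
    next
      fix k assume k: "k < n"
      note kk = nn(1)[of k] nm(2)[of k] nn(2)[of "Suc k"]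
      show "integrable M (\<lambda>x. (Z (node n (Suc k)) x - Z (node n k) x)\<^sup>2)" using kk k by (intro incr_L2) auto
      fix B assume B: "B \<in> sets (G (node n k))"
      show "(\<integral>x. (Z (node n (Suc k)) x - Z (node n k) x) * indicator B x \<partial>M) = 0"
        using kk k B by (intro incr_mean_G) auto
      show "(\<integral>x. (Z (node n (Suc k)) x - Z (node n k) x)\<^sup>2 * indicator B x \<partial>M) = h * prob B"
        using kk k B by (subst incr_var_G) (auto simp: hn)
    qed (use h in auto)
    also have "\<dots> \<le> (\<Sum>k<n. 4 * h * sqrt h)" using sum_mono[of "{..<n}" R "\<lambda>_. 4 * h * sqrt h"] R by simp
    also have "\<dots> = 4 * c * sqrt h" by (simp add: h(3)[symmetric])
    finally show ?thesis unfolding E_def h_def node_n[OF n(1)] node_0 .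
  qed
  have "norm (E - complex_of_real (exp (- (c / 2)) * prob A)) \<le> 4 * c * sqrt 0"
  proof (rule LIMSEQ_le)
    have "(\<lambda>n. (1 + (- (c / 2)) / real n) ^ n) \<longlonglongrightarrow> exp (- (c / 2))"
      by (rule tendsto_exp_limit_sequentially)
    then have "(\<lambda>n. (1 - (c / n) / 2) ^ n) \<longlonglongrightarrow> exp (- (c / 2))" by (simp add: mult.commute)
    then show "(\<lambda>n. norm (E - complex_of_real ((1 - (c / n) / 2) ^ n * prob A)))
      \<longlonglongrightarrow> norm (E - complex_of_real (exp (- (c / 2)) * prob A))"
      by (intro tendsto_intros tendsto_of_real)
    show "(\<lambda>n. 4 * c * sqrt (c / real n)) \<longlonglongrightarrow> 4 * c * sqrt 0"
      by (intro tendsto_intros lim_const_over_n)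
    show "\<exists>N. \<forall>n\<ge>N. norm (E - complex_of_real ((1 - (c / n) / 2) ^ n * prob A)) \<le> 4 * c * sqrt (c / n)"
      using bd by blast
  qed
  then show ?thesis unfolding E_def c_def by simp
qed

end

section \<open>The planar filtration\<close>

context prob_space begin

text \<open>Square integrability of the increments is not part of (ii) and has to be recovered. For
  a nonnegative function \<open>real_cond_exp\<close> is \<open>enn2real\<close> of the extended
  conditional expectation, and \<open>enn2real\<close> sends infinity to 0. A value
  \<open>c > 0\<close> therefore excludes infinity, and integrating gives the finite mean
  \<open>c\<close>.\<close>

lemma cond_exp_const_integrable:
  fixes f :: "'a \<Rightarrow> real"
  assumes G: "subalgebra M G" and [measurable]: "f \<in> borel_measurable M" and f: "\<And>x. 0 \<le> f x" and c: "0 < c"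
    and ce: "AE x in M. real_cond_exp M G f x = c"
  shows "integrable M f"
proof -
  interpret G: sigma_finite_subalgebra M G by (rule sigma_finite_subalgebraI[OF G])
  have z: "AE x in M. (0::ennreal) = nn_cond_exp M G (\<lambda>_. 0) x"
    by (rule G.nn_cond_exp_F_meas) simp
  have neg: "(\<lambda>x. ennreal (- f x)) = (\<lambda>_. 0)" using f by (auto simp: ennreal_neg)
  from z ce have "AE x in M. nn_cond_exp M G (\<lambda>x. ennreal (f x)) x = ennreal c"
  proof eventually_elim
    case (elim x)
    then have "enn2real (nn_cond_exp M G (\<lambda>x. ennreal (f x)) x) = c"
      by (simp add: real_cond_exp_def neg)
    then show ?case using c by (cases "nn_cond_exp M G (\<lambda>x. ennreal (f x)) x") auto
  qed
  then have "(\<integral>\<^sup>+x. 1 * nn_cond_exp M G (\<lambda>x. ennreal (f x)) x \<partial>M) = (\<integral>\<^sup>+x. ennreal c \<partial>M)"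
    by (intro nn_integral_cong_AE) auto
  then have "(\<integral>\<^sup>+x. ennreal (f x) \<partial>M) = ennreal c"
    using G.nn_cond_exp_intg[of "\<lambda>_. 1" "\<lambda>x. ennreal (f x)"] by (simp add: emeasure_space_1)
  then show ?thesis
    using f by (intro integrableI_nn_integral_finite[where x=c]) (use c in auto)
qed

lemma cond_exp_const_set_integral:
  fixes f :: "'a \<Rightarrow> real"
  assumes G: "subalgebra M G" and f: "integrable M f"
    and ce: "AE x in M. real_cond_exp M G f x = c" and A: "A \<in> sets G"
  shows "(\<integral>x. f x * indicator A x \<partial>M) = c * prob A"
proof -
  interpret G: sigma_finite_subalgebra M G by (rule sigma_finite_subalgebraI[OF G])
  have AM [measurable]: "A \<in> sets M" using G A by (auto simp: subalgebra_def)
  have "(\<integral>x. f x * indicator A x \<partial>M) = (\<integral>x. indicator A x * real_cond_exp M G f x \<partial>M)"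
    using G.real_cond_exp_intA[OF f A] by (simp add: set_lebesgue_integral_def mult.commute)
  also have "\<dots> = (\<integral>x. indicator A x * c \<partial>M)"
    using ce f by (intro integral_cong_AE) auto
  finally show ?thesis using AM by simp
qed

end

lemma rect_incr_diff: "rect_incr Y s t r' t' x - rect_incr Y s t r t' x = rect_incr Y r t r' t' x"
  by (simp add: rect_incr_def)

lemma rect_incr_degenerate: "rect_incr Y s t s t' x = (0::real)" "rect_incr Y s t s' t x = (0::real)"
  by (simp_all add: rect_incr_def)

locale planar_process = prob_space +
  fixes X :: "real \<Rightarrow> real \<Rightarrow> 'a \<Rightarrow> complex" and S T :: real
  assumes X_measurable: "\<And>s t. 0 \<le> s \<Longrightarrow> s \<le> S \<Longrightarrow> 0 \<le> t \<Longrightarrow> t \<le> T \<Longrightarrow> X s t \<in> borel_measurable M"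
    and X_cont: "\<And>x. x \<in> space M \<Longrightarrow> continuous_on ({0..S} \<times> {0..T}) (\<lambda>(s, t). X s t x)"
    and X_s0: "\<And>s x. 0 \<le> s \<Longrightarrow> s \<le> S \<Longrightarrow> x \<in> space M \<Longrightarrow> X s 0 x = 0"
    and X_0t: "\<And>t x. 0 \<le> t \<Longrightarrow> t \<le> T \<Longrightarrow> x \<in> space M \<Longrightarrow> X 0 t x = 0"
begin

abbreviation F where "F \<equiv> nat_filt M X"
abbreviation J where "J s t \<equiv> join_alg M (F S t) (F s T)"
abbreviation XR where "XR \<equiv> \<lambda>s t \<omega>. Re (X s t \<omega>)"
abbreviation XI where "XI \<equiv> \<lambda>s t \<omega>. Im (X s t \<omega>)"

lemma nat_filt_generators:
  "{X u v -` B \<inter> space M |u v B. 0 \<le> u \<and> u \<le> s \<and> 0 \<le> v \<and> v \<le> t \<and> B \<in> sets borel} \<union> null_sets M \<subseteq> Pow (space M)"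
  using sets.sets_into_space by blast

lemma space_F [simp]: "space (F s t) = space M"
  unfolding nat_filt_def using nat_filt_generators by (rule space_measure_of)

lemma sets_F: "sets (F s t) = sigma_sets (space M)
  ({X u v -` B \<inter> space M |u v B. 0 \<le> u \<and> u \<le> s \<and> 0 \<le> v \<and> v \<le> t \<and> B \<in> sets borel} \<union> null_sets M)"
  unfolding nat_filt_def using nat_filt_generators by (rule sets_measure_of)

lemma subalgebra_F: "s \<le> S \<Longrightarrow> t \<le> T \<Longrightarrow> subalgebra M (F s t)"
  unfolding subalgebra_def sets_F
  using X_measurable by (auto intro!: sets.sigma_sets_subset measurable_sets)

lemma F_mono: "s \<le> s' \<Longrightarrow> t \<le> t' \<Longrightarrow> sets (F s t) \<subseteq> sets (F s' t')"
  unfolding sets_F by (rule sigma_sets_mono', rule Un_mono) (blast intro: order_trans, simp)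

lemma X_measurable_F: "0 \<le> u \<Longrightarrow> u \<le> s \<Longrightarrow> 0 \<le> v \<Longrightarrow> v \<le> t \<Longrightarrow> X u v \<in> borel_measurable (F s t)"
  by (rule measurableI) (auto simp: sets_F intro!: sigma_sets.Basic)

lemma J_generators: "s \<le> S \<Longrightarrow> t \<le> T \<Longrightarrow> sets (F S t) \<union> sets (F s T) \<subseteq> Pow (space M)"
  using sets.sets_into_space[of _ "F S t"] sets.sets_into_space[of _ "F s T"] by auto

lemma sets_J: "s \<le> S \<Longrightarrow> t \<le> T \<Longrightarrow> sets (J s t) = sigma_sets (space M) (sets (F S t) \<union> sets (F s T))"
  unfolding join_alg_def using J_generators by (rule sets_measure_of)

lemma space_J [simp]: "space (J s t) = space M"
  by (simp add: join_alg_def space_measure_of_conv)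

lemma subalgebra_J: "s \<le> S \<Longrightarrow> t \<le> T \<Longrightarrow> subalgebra M (J s t)"
  using subalgebra_F[of S t] subalgebra_F[of s T]
  by (auto simp: subalgebra_def sets_J intro!: sets.sigma_sets_subset)

lemma F_subset_J: "s \<le> S \<Longrightarrow> t \<le> T \<Longrightarrow> sets (F s T) \<subseteq> sets (J s t)" "s \<le> S \<Longrightarrow> t \<le> T \<Longrightarrow> sets (F S t) \<subseteq> sets (J s t)"
  by (auto simp: sets_J)

lemma J_mono: "s \<le> s' \<Longrightarrow> t \<le> t' \<Longrightarrow> s' \<le> S \<Longrightarrow> t' \<le> T \<Longrightarrow> sets (J s t) \<subseteq> sets (J s' t')"
  using F_mono[of S S t t'] F_mono[of s s' T T]
  by (auto simp: sets_J intro!: sigma_sets_mono')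

lemma XR_XI_measurable:
  "0 \<le> u \<Longrightarrow> u \<le> s \<Longrightarrow> 0 \<le> v \<Longrightarrow> v \<le> t \<Longrightarrow> XR u v \<in> borel_measurable (F s t)"
  "0 \<le> u \<Longrightarrow> u \<le> s \<Longrightarrow> 0 \<le> v \<Longrightarrow> v \<le> t \<Longrightarrow> XI u v \<in> borel_measurable (F s t)"
  using X_measurable_F[of u s v t] by measurable

lemma rect_incr_measurable_F:
  assumes "0 \<le> s" "s \<le> s'" "0 \<le> t" "t \<le> t'"
  shows "rect_incr XR s t s' t' \<in> borel_measurable (F s' t')" "rect_incr XI s t s' t' \<in> borel_measurable (F s' t')"
  unfolding rect_incr_def[abs_def] using assms
  by (auto intro!: borel_measurable_diff borel_measurable_add XR_XI_measurable)

lemma rect_incr_measurable: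
  assumes "0 \<le> s" "s \<le> s'" "0 \<le> t" "t \<le> t'" "s' \<le> S" "t' \<le> T"
  shows "rect_incr XR s t s' t' \<in> borel_measurable M" "rect_incr XI s t s' t' \<in> borel_measurable M"
  using assms by (auto intro!: measurable_from_subalg[OF subalgebra_F rect_incr_measurable_F(1)]
    measurable_from_subalg[OF subalgebra_F rect_incr_measurable_F(2)])

lemma X_tendsto:
  assumes "x \<in> space M" "f \<longlonglongrightarrow> s" "g \<longlonglongrightarrow> t" "s \<in> {0..S}" "t \<in> {0..T}"
    and "\<And>n. f n \<in> {0..S}" "\<And>n. g n \<in> {0..T}"
  shows "(\<lambda>n. X (f n) (g n) x) \<longlonglongrightarrow> X s t x"
proof -
  have "((\<lambda>n. (\<lambda>(s, t). X s t x) (f n, g n)) \<longlonglongrightarrow> (\<lambda>(s, t). X s t x) (s, t))"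
    by (rule continuous_on_tendsto_compose[OF X_cont]) (use assms in \<open>auto intro!: tendsto_Pair\<close>)
  then show ?thesis by simp
qed

lemma X_cont_fst:
  assumes "x \<in> space M" "0 \<le> t" "t \<le> T"
  shows "continuous_on {0..S} (\<lambda>r. X r t x)"
proof -
  have "continuous_on {0..S} ((\<lambda>(s, t). X s t x) \<circ> (\<lambda>r. (r, t)))"
    using assms by (intro continuous_on_compose continuous_on_subset[OF X_cont] continuous_intros) auto
  then show ?thesis by (simp add: o_def)
qed

end

section \<open>Condition (ii): the law of the increment over one rectangle\<close>

locale planar_levy = planar_process +
  assumes sm_R: "strong_martingale M F S T XR" and sm_I: "strong_martingale M F S T XI"
    and ce_R: "\<And>s t s' t'. 0 < s \<Longrightarrow> 0 < t \<Longrightarrow> s \<le> s' \<Longrightarrow> t \<le> t' \<Longrightarrow> s' \<le> S \<Longrightarrow> t' \<le> T \<Longrightarrow>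
      AE \<omega> in M. real_cond_exp M (F s T) (\<lambda>\<omega>. (rect_incr XR s t s' t' \<omega>)\<^sup>2) \<omega> = (s' - s) * (t' - t)"
    and ce_I: "\<And>s t s' t'. 0 < s \<Longrightarrow> 0 < t \<Longrightarrow> s \<le> s' \<Longrightarrow> t \<le> t' \<Longrightarrow> s' \<le> S \<Longrightarrow> t' \<le> T \<Longrightarrow>
      AE \<omega> in M. real_cond_exp M (F s T) (\<lambda>\<omega>. (rect_incr XI s t s' t' \<omega>)\<^sup>2) \<omega> = (s' - s) * (t' - t)"
    and ce_RI: "\<And>s t s' t'. 0 < s \<Longrightarrow> 0 < t \<Longrightarrow> s \<le> s' \<Longrightarrow> t \<le> t' \<Longrightarrow> s' \<le> S \<Longrightarrow> t' \<le> T \<Longrightarrow>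
      AE \<omega> in M. real_cond_exp M (F s T) (\<lambda>\<omega>. rect_incr XR s t s' t' \<omega> * rect_incr XI s t s' t' \<omega>) \<omega> = 0"
begin

text \<open>All real combinations together determine the joint law of the two increments. The
  vanishing conditional covariance makes \<open>\<alpha>\<^sup>2 + \<beta>\<^sup>2\<close> the
  variance factor.\<close>

definition comb :: "real \<Rightarrow> real \<Rightarrow> real \<Rightarrow> real \<Rightarrow> real \<Rightarrow> real \<Rightarrow> 'a \<Rightarrow> real" where
  "comb \<alpha> \<beta> s t s' t' x = \<alpha> * rect_incr XR s t s' t' x + \<beta> * rect_incr XI s t s' t' x"

lemma comb_diff: "comb \<alpha> \<beta> s t r' t' x - comb \<alpha> \<beta> s t r t' x = comb \<alpha> \<beta> r t r' t' x"
  unfolding comb_def rect_incr_diff[symmetric, of XR r t r' t' x s] rect_incr_diff[symmetric, of XI r t r' t' x s]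
  by (simp add: algebra_simps)

lemma comb_measurable_F:
  assumes "0 \<le> s" "s \<le> s'" "0 \<le> t" "t \<le> t'"
  shows "comb \<alpha> \<beta> s t s' t' \<in> borel_measurable (F s' t')"
  unfolding comb_def[abs_def] using rect_incr_measurable_F[OF assms] by measurable

lemma comb_measurable:
  assumes "0 \<le> s" "s \<le> s'" "0 \<le> t" "t \<le> t'" "s' \<le> S" "t' \<le> T"
  shows "comb \<alpha> \<beta> s t s' t' \<in> borel_measurable M"
  unfolding comb_def[abs_def] using rect_incr_measurable[OF assms] by measurable

lemma rect_incr_integrable:
  assumes "0 \<le> s" "s \<le> s'" "0 \<le> t" "t \<le> t'" "s' \<le> S" "t' \<le> T"
  shows "integrable M (rect_incr XR s t s' t')" "integrable M (rect_incr XI s t s' t')"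
  unfolding rect_incr_def[abs_def] using assms sm_R sm_I unfolding strong_martingale_def
  by (auto intro!: Bochner_Integration.integrable_diff Bochner_Integration.integrable_add)

lemma rect_incr_mean:
  assumes "0 \<le> s" "s \<le> s'" "0 \<le> t" "t \<le> t'" "s' \<le> S" "t' \<le> T" and A: "A \<in> sets (J s t)"
  shows "(\<integral>x. rect_incr XR s t s' t' x * indicator A x \<partial>M) = 0" "(\<integral>x. rect_incr XI s t s' t' x * indicator A x \<partial>M) = 0"
proof -
  have J: "subalgebra M (J s t)" using assms by (intro subalgebra_J) auto
  show "(\<integral>x. rect_incr XR s t s' t' x * indicator A x \<partial>M) = 0"
  proof (cases "s < s' \<and> t < t'")
    case True
    then have "AE \<omega> in M. real_cond_exp M (J s t) (rect_incr XR s t s' t') \<omega> = 0"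
      using sm_R assms unfolding strong_martingale_def by blast
    from cond_exp_const_set_integral[OF J rect_incr_integrable(1)[OF assms(1-6)] this A] show ?thesis by simp
  qed (use assms in \<open>auto simp: rect_incr_degenerate\<close>)
  show "(\<integral>x. rect_incr XI s t s' t' x * indicator A x \<partial>M) = 0"
  proof (cases "s < s' \<and> t < t'")
    case True
    then have "AE \<omega> in M. real_cond_exp M (J s t) (rect_incr XI s t s' t') \<omega> = 0"
      using sm_I assms unfolding strong_martingale_def by blast
    from cond_exp_const_set_integral[OF J rect_incr_integrable(2)[OF assms(1-6)] this A] show ?thesis by simp
  qed (use assms in \<open>auto simp: rect_incr_degenerate\<close>)
qed

lemma rect_incr_L2:
  assumes "0 < s" "s \<le> s'" "0 < t" "t \<le> t'" "s' \<le> S" "t' \<le> T"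
  shows "integrable M (\<lambda>x. (rect_incr XR s t s' t' x)\<^sup>2)" "integrable M (\<lambda>x. (rect_incr XI s t s' t' x)\<^sup>2)"
proof -
  have F: "subalgebra M (F s T)" using assms by (intro subalgebra_F) auto
  have [measurable]: "rect_incr XR s t s' t' \<in> borel_measurable M" "rect_incr XI s t s' t' \<in> borel_measurable M"
    using assms by (auto intro!: rect_incr_measurable)
  have "integrable M (\<lambda>x. (rect_incr XR s t s' t' x)\<^sup>2) \<and> integrable M (\<lambda>x. (rect_incr XI s t s' t' x)\<^sup>2)"
  \<comment> \<open>On a degenerate rectangle the conditional variance is 0 and says nothing about
    integrability, but there the increment itself is 0.\<close>
  proof (cases "s < s' \<and> t < t'")
    case True
    then have "0 < (s' - s) * (t' - t)" by simp
    with F show ?thesis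
      using ce_R[of s t s' t'] ce_I[of s t s' t'] assms by (auto intro!: cond_exp_const_integrable)
  qed (use assms in \<open>auto simp: rect_incr_degenerate\<close>)
  then show "integrable M (\<lambda>x. (rect_incr XR s t s' t' x)\<^sup>2)" "integrable M (\<lambda>x. (rect_incr XI s t s' t' x)\<^sup>2)"
    by auto
qed

lemma comb_L2_var:
  assumes st: "0 < s" "s \<le> s'" "0 < t" "t \<le> t'" "s' \<le> S" "t' \<le> T"
  shows "integrable M (\<lambda>x. (comb \<alpha> \<beta> s t s' t' x)\<^sup>2)"
    and "A \<in> sets (F s T) \<Longrightarrow> (\<integral>x. (comb \<alpha> \<beta> s t s' t' x)\<^sup>2 * indicator A x \<partial>M) = (\<alpha>\<^sup>2 + \<beta>\<^sup>2) * ((s' - s) * (t' - t)) * prob A"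
proof -
  define f where "f = rect_incr XR s t s' t'"
  define g where "g = rect_incr XI s t s' t'"
  have F: "subalgebra M (F s T)" using assms by (intro subalgebra_F) auto
  have m: "f \<in> borel_measurable M" "g \<in> borel_measurable M"
    unfolding f_def g_def using assms by (auto intro!: rect_incr_measurable)
  note L2 = rect_incr_L2[OF st, folded f_def g_def]
  note fg = integrable_mult_of_squares[OF m L2]
  have sq: "(comb \<alpha> \<beta> s t s' t' x)\<^sup>2 = \<alpha>\<^sup>2 * (f x)\<^sup>2 + \<beta>\<^sup>2 * (g x)\<^sup>2 + 2 * \<alpha> * \<beta> * (f x * g x)" for x
    unfolding comb_def f_def g_def by (simp add: power2_eq_square algebra_simps)
  show "integrable M (\<lambda>x. (comb \<alpha> \<beta> s t s' t' x)\<^sup>2)" unfolding sq using L2 fg by simp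
  assume A: "A \<in> sets (F s T)"
  then have AM: "A \<in> sets M" using F by (auto simp: subalgebra_def)
  have ind: "integrable M (\<lambda>x. h x * indicator A x)" if "integrable M h" for h :: "'a \<Rightarrow> real"
    using integrable_mult_indicator[OF AM that] by (simp add: mult.commute)
  note st' = st(1,3,2,4,5,6)
  have "(\<integral>x. (comb \<alpha> \<beta> s t s' t' x)\<^sup>2 * indicator A x \<partial>M)
    = (\<integral>x. \<alpha>\<^sup>2 * ((f x)\<^sup>2 * indicator A x) + \<beta>\<^sup>2 * ((g x)\<^sup>2 * indicator A x) + 2 * \<alpha> * \<beta> * (f x * g x * indicator A x) \<partial>M)"
    unfolding sq by (simp only: distrib_right mult.assoc)
  also have "\<dots> = \<alpha>\<^sup>2 * (\<integral>x. (f x)\<^sup>2 * indicator A x \<partial>M) + \<beta>\<^sup>2 * (\<integral>x. (g x)\<^sup>2 * indicator A x \<partial>M)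
      + 2 * \<alpha> * \<beta> * (\<integral>x. f x * g x * indicator A x \<partial>M)"
    using ind[OF L2(1)] ind[OF L2(2)] ind[OF fg] by simp
  also have "(\<integral>x. f x * g x * indicator A x \<partial>M) = 0 * prob A"
    by (rule cond_exp_const_set_integral[OF F fg _ A]) (use ce_RI[OF st'] in \<open>simp add: f_def g_def\<close>)
  also have "(\<integral>x. (f x)\<^sup>2 * indicator A x \<partial>M) = (s' - s) * (t' - t) * prob A"
    by (rule cond_exp_const_set_integral[OF F L2(1) _ A]) (use ce_R[OF st'] in \<open>simp add: f_def\<close>)
  also have "(\<integral>x. (g x)\<^sup>2 * indicator A x \<partial>M) = (s' - s) * (t' - t) * prob A"
    by (rule cond_exp_const_set_integral[OF F L2(2) _ A]) (use ce_I[OF st'] in \<open>simp add: g_def\<close>)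
  finally show "(\<integral>x. (comb \<alpha> \<beta> s t s' t' x)\<^sup>2 * indicator A x \<partial>M) = (\<alpha>\<^sup>2 + \<beta>\<^sup>2) * ((s' - s) * (t' - t)) * prob A"
    by (simp add: algebra_simps)
qed

lemma comb_mean:
  assumes "0 \<le> s" "s \<le> s'" "0 \<le> t" "t \<le> t'" "s' \<le> S" "t' \<le> T" and A: "A \<in> sets (J s t)"
  shows "(\<integral>x. comb \<alpha> \<beta> s t s' t' x * indicator A x \<partial>M) = 0"
proof -
  have AM: "A \<in> sets M" using subalgebra_J[of s t] A assms by (auto simp: subalgebra_def)
  have ind: "integrable M (\<lambda>x. h x * indicator A x)" if "integrable M h" for h :: "'a \<Rightarrow> real"
    using integrable_mult_indicator[OF AM that] by (simp add: mult.commute)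
  have "(\<integral>x. comb \<alpha> \<beta> s t s' t' x * indicator A x \<partial>M)
      = (\<integral>x. \<alpha> * (rect_incr XR s t s' t' x * indicator A x) + \<beta> * (rect_incr XI s t s' t' x * indicator A x) \<partial>M)"
    unfolding comb_def by (simp only: distrib_right mult.assoc)
  then show ?thesis
    using ind[OF rect_incr_integrable(1)[OF assms(1-6)]] ind[OF rect_incr_integrable(2)[OF assms(1-6)]]
      rect_incr_mean[OF assms] by simp
qed

text \<open>The right edge \<open>r\<close> of the rectangle plays the role of time. Mean zero over
  \<open>J r t\<close> comes from the strong martingale property, the variance over
  \<open>F r T\<close> from (ii). Excluding \<alpha> = \<beta> = 0 makes the bracket rate
  positive.\<close>

lemma comb_bracket:
  assumes "0 < s" "s \<le> s'" "0 < t" "t < t'" "s' \<le> S" "t' \<le> T" and ab: "\<alpha> \<noteq> 0 \<or> \<beta> \<noteq> 0"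
  shows "const_bracket_martingale_ext M (\<lambda>r. F r T) (\<lambda>r. comb \<alpha> \<beta> s t r t') s s' ((\<alpha>\<^sup>2 + \<beta>\<^sup>2) * (t' - t)) (\<lambda>r. J r t)"
proof unfold_locales
  have "0 < (\<alpha>\<^sup>2 + \<beta>\<^sup>2) * (t' - t)" using ab assms by (auto intro!: mult_pos_pos simp: sum_power2_gt_zero_iff)
  then show "0 < (\<alpha>\<^sup>2 + \<beta>\<^sup>2) * (t' - t)" "0 \<le> (\<alpha>\<^sup>2 + \<beta>\<^sup>2) * (t' - t)" by auto
  fix r assume r: "s \<le> r" "r \<le> s'"
  show "subalgebra M (F r T)" using r assms by (intro subalgebra_F) auto
  show "subalgebra M (J r t)" using r assms by (intro subalgebra_J) auto
  show "sets (F r T) \<subseteq> sets (J r t)" using r assms by (intro F_subset_J) auto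
  have "comb \<alpha> \<beta> s t r t' \<in> borel_measurable (F r t')"
    using r assms by (intro comb_measurable_F) auto
  then show "comb \<alpha> \<beta> s t r t' \<in> borel_measurable (F r T)"
    by (rule measurable_from_subalg[rotated]) (use F_mono[of r r t' T] assms in \<open>auto simp: subalgebra_def\<close>)
next
  fix r r' assume r: "s \<le> r" "r \<le> r'" "r' \<le> s'"
  show "sets (F r T) \<subseteq> sets (F r' T)" using r by (intro F_mono) auto
  show "sets (J r t) \<subseteq> sets (J r' t)" using r assms by (intro J_mono) auto
  have *: "0 < r" "r \<le> r'" "0 < t" "t \<le> t'" "r' \<le> S" "t' \<le> T" "0 \<le> r" "0 \<le> t" using r assms by auto
  show "integrable M (\<lambda>x. (comb \<alpha> \<beta> s t r' t' x - comb \<alpha> \<beta> s t r t' x)\<^sup>2)"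
    unfolding comb_diff by (rule comb_L2_var(1)[OF *(1-6)])
  show m: "(\<integral>x. (comb \<alpha> \<beta> s t r' t' x - comb \<alpha> \<beta> s t r t' x) * indicator A x \<partial>M) = 0" if "A \<in> sets (J r t)" for A
    unfolding comb_diff by (rule comb_mean) (use * that in auto)
  fix A assume A: "A \<in> sets (F r T)"
  then have "A \<in> sets (J r t)" using F_subset_J(1)[of r t] r assms by auto
  then show "(\<integral>x. (comb \<alpha> \<beta> s t r' t' x - comb \<alpha> \<beta> s t r t' x) * indicator A x \<partial>M) = 0" by (rule m)
  show "(\<integral>x. (comb \<alpha> \<beta> s t r' t' x - comb \<alpha> \<beta> s t r t' x)\<^sup>2 * indicator A x \<partial>M)
      = (\<alpha>\<^sup>2 + \<beta>\<^sup>2) * (t' - t) * (r' - r) * prob A"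
    unfolding comb_diff using comb_L2_var(2)[OF *(1-6) A, of \<alpha> \<beta>] by (simp only: ac_simps)
next
  fix x assume x: "x \<in> space M"
  show "continuous_on {s..s'} (\<lambda>r. comb \<alpha> \<beta> s t r t' x)"
    unfolding comb_def rect_incr_def
    using assms by (intro continuous_intros continuous_on_subset[OF X_cont_fst[OF x]]) auto
qed (use assms in auto)

lemma char_comb_interior:
  assumes st: "0 < s" "s < s'" "0 < t" "t < t'" "s' \<le> S" "t' \<le> T" and A: "A \<in> sets (J s t)"
  shows "(\<integral>x. indicator A x * iexp (comb \<alpha> \<beta> s t s' t' x) \<partial>M)
    = exp (- ((\<alpha>\<^sup>2 + \<beta>\<^sup>2) * ((s' - s) * (t' - t)) / 2)) * prob A"
proof (cases "\<alpha> \<noteq> 0 \<or> \<beta> \<noteq> 0")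
  case True
  have 0: "comb \<alpha> \<beta> s t s t' x = 0" for x by (simp add: comb_def rect_incr_degenerate)
  show ?thesis
    using const_bracket_martingale_ext.char_incr_G[OF comb_bracket[OF st(1) _ st(3-6) True] A] st(2)
    unfolding 0 by (simp add: ac_simps)
next
  case False
  have "A \<in> sets M" using subalgebra_J[of s t] A assms by (auto simp: subalgebra_def)
  then have "(\<integral>x. complex_of_real (indicator A x) \<partial>M) = prob A" by simp
  moreover have "(\<integral>x. indicator A x * iexp (comb \<alpha> \<beta> s t s' t' x) \<partial>M) = (\<integral>x. complex_of_real (indicator A x) \<partial>M)"
    using False by (intro Bochner_Integration.integral_cong) (auto simp: indicator_def comb_def)
  ultimately show ?thesis using False by simp
qed

text \<open>For corners on the axes (ii) gives nothing, so the lower left corner is approached from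
  the interior. A set of \<open>J s t\<close> also belongs to the algebra at each approximating
  corner, and path continuity with dominated convergence passes to the limit.\<close>

lemma char_comb:
  assumes st: "0 \<le> s" "s < s'" "0 \<le> t" "t < t'" "s' \<le> S" "t' \<le> T" and A: "A \<in> sets (J s t)"
  shows "(\<integral>x. indicator A x * iexp (comb \<alpha> \<beta> s t s' t' x) \<partial>M)
    = exp (- ((\<alpha>\<^sup>2 + \<beta>\<^sup>2) * ((s' - s) * (t' - t)) / 2)) * prob A"
proof -
  \<comment> \<open>The double successor keeps \<kappa> strictly below 1 already at
    \<open>n = 0\<close>, so every approximating rectangle is nondegenerate.\<close>
  define \<kappa> where "\<kappa> n = inverse (real (Suc (Suc n)))" for n
  define f where "f n = s + (s' - s) * \<kappa> n" for n
  define g where "g n = t + (t' - t) * \<kappa> n" for n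
  have \<kappa>: "0 < \<kappa> n" "\<kappa> n < 1" for n
    unfolding \<kappa>_def by (auto simp: inverse_less_1_iff)
  have between: "y < y + (y' - y) * \<kappa> n" "y + (y' - y) * \<kappa> n < y'" if "y < y'" for y y' n
  proof -
    have "0 < (y' - y) * \<kappa> n" "0 < (y' - y) * (1 - \<kappa> n)"
      using \<kappa>[of n] that by (auto intro!: mult_pos_pos)
    then show "y < y + (y' - y) * \<kappa> n" "y + (y' - y) * \<kappa> n < y'"
      unfolding right_diff_distrib mult_1_right by linarith+
  qed
  have f: "s < f n" "f n < s'" and g: "t < g n" "g n < t'" for n
    unfolding f_def g_def using between st by auto
  have \<kappa>l: "\<kappa> \<longlonglongrightarrow> 0"
    unfolding \<kappa>_def by (intro LIMSEQ_Suc[OF LIMSEQ_inverse_real_of_nat])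
  have "(\<lambda>n. y + (y' - y) * \<kappa> n) \<longlonglongrightarrow> y + (y' - y) * 0" for y y'
    by (intro tendsto_intros \<kappa>l)
  then have fl: "f \<longlonglongrightarrow> s" and gl: "g \<longlonglongrightarrow> t"
    unfolding f_def g_def by simp_all
  have AM [measurable]: "A \<in> sets M" using subalgebra_J[of s t] A assms by (auto simp: subalgebra_def)
  have [measurable]: "comb \<alpha> \<beta> s t s' t' \<in> borel_measurable M" "comb \<alpha> \<beta> (f n) (g n) s' t' \<in> borel_measurable M" for n
    using f[of n] g[of n] st by (auto intro!: comb_measurable)
  have "(\<lambda>n. \<integral>x. indicator A x * iexp (comb \<alpha> \<beta> (f n) (g n) s' t' x) \<partial>M)
      \<longlonglongrightarrow> (\<integral>x. indicator A x * iexp (comb \<alpha> \<beta> s t s' t' x) \<partial>M)"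
  proof (rule integral_dominated_convergence[where w="\<lambda>_. 1"])
    show "AE x in M. (\<lambda>n. indicator A x * iexp (comb \<alpha> \<beta> (f n) (g n) s' t' x))
        \<longlonglongrightarrow> indicator A x * iexp (comb \<alpha> \<beta> s t s' t' x)"
    proof (rule AE_I2)
      fix x assume x: "x \<in> space M"
      have fS: "f n \<in> {0..S}" and gT: "g n \<in> {0..T}" for n using f[of n] g[of n] st by auto
      have "(\<lambda>n. X (f n) t' x) \<longlonglongrightarrow> X s t' x" "(\<lambda>n. X s' (g n) x) \<longlonglongrightarrow> X s' t x" "(\<lambda>n. X (f n) (g n) x) \<longlonglongrightarrow> X s t x"
        by (rule X_tendsto[OF x]; use fl gl st fS gT in auto)+
      then show "(\<lambda>n. indicator A x * iexp (comb \<alpha> \<beta> (f n) (g n) s' t' x))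
          \<longlonglongrightarrow> indicator A x * iexp (comb \<alpha> \<beta> s t s' t' x)"
        unfolding comb_def rect_incr_def by (intro tendsto_intros tendsto_of_real tendsto_Re tendsto_Im)
    qed
  qed (auto simp: norm_mult indicator_def)
  moreover have "(\<integral>x. indicator A x * iexp (comb \<alpha> \<beta> (f n) (g n) s' t' x) \<partial>M)
      = exp (- ((\<alpha>\<^sup>2 + \<beta>\<^sup>2) * ((s' - f n) * (t' - g n)) / 2)) * prob A" for n
    using f[of n] g[of n] st A J_mono[of s "f n" t "g n"]
    by (intro char_comb_interior) auto
  moreover have "(\<lambda>n. complex_of_real (exp (- ((\<alpha>\<^sup>2 + \<beta>\<^sup>2) * ((s' - f n) * (t' - g n)) / 2)) * prob A))
      \<longlonglongrightarrow> complex_of_real (exp (- ((\<alpha>\<^sup>2 + \<beta>\<^sup>2) * ((s' - s) * (t' - t)) / 2)) * prob A)"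
    by (intro tendsto_intros tendsto_of_real fl gl) simp_all
  ultimately show ?thesis by (simp add: LIMSEQ_unique)
qed

end

section \<open>Independence from characteristic functions\<close>

text \<open>The pi-system generated by \<open>\<C>\<close>, built one generator at a time so that a
  statement on cylinders can be proved by exchanging one character per induction step.\<close>

inductive_set fin_inter :: "'a set \<Rightarrow> 'a set set \<Rightarrow> 'a set set" for \<Omega> :: "'a set" and \<C> :: "'a set set" where
  top: "\<Omega> \<in> fin_inter \<Omega> \<C>"
| Int: "A \<in> fin_inter \<Omega> \<C> \<Longrightarrow> C \<in> \<C> \<Longrightarrow> C \<inter> A \<in> fin_inter \<Omega> \<C>"

lemma fin_inter_subset: "A \<in> fin_inter \<Omega> \<C> \<Longrightarrow> A \<subseteq> \<Omega>"
  by (induction rule: fin_inter.induct) auto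

lemma Int_stable_fin_inter: "Int_stable (fin_inter \<Omega> \<C>)"
proof (rule Int_stableI)
  fix A B assume A: "A \<in> fin_inter \<Omega> \<C>" and B: "B \<in> fin_inter \<Omega> \<C>"
  from A show "A \<inter> B \<in> fin_inter \<Omega> \<C>"
  proof induction
    case top
    then show ?case using B fin_inter_subset[OF B] by (simp add: Int_absorb1)
  next
    case (Int A C)
    then show ?case using fin_inter.Int[of "A \<inter> B" \<Omega> \<C> C] by (simp add: Int_assoc)
  qed
qed

lemma subset_fin_inter: "\<C> \<subseteq> Pow \<Omega> \<Longrightarrow> \<C> \<subseteq> fin_inter \<Omega> \<C>"
proof
  fix C assume "\<C> \<subseteq> Pow \<Omega>" "C \<in> \<C>"
  then show "C \<in> fin_inter \<Omega> \<C>"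
    using fin_inter.Int[OF fin_inter.top, of C \<C> \<Omega>] by (auto simp: Int_absorb2)
qed

text \<open>Exponents of characters of finite-dimensional marginals. A list may repeat an index, so
  a further term is added by a mere \<open>Cons\<close>, without merging coefficients.\<close>

definition lin_comb :: "('i \<Rightarrow> 'a \<Rightarrow> real) \<Rightarrow> (real \<times> 'i) list \<Rightarrow> 'a \<Rightarrow> real" where
  "lin_comb Y ps x = (\<Sum>(c, i)\<leftarrow>ps. c * Y i x)"

lemma lin_comb_simps [simp]:
  "lin_comb Y [] x = 0" "lin_comb Y ((c, i) # ps) x = c * Y i x + lin_comb Y ps x"
  by (simp_all add: lin_comb_def)

lemma lin_comb_measurable:
  "(\<And>i. i \<in> snd ` set ps \<Longrightarrow> Y i \<in> borel_measurable M) \<Longrightarrow> lin_comb Y ps \<in> borel_measurable M"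
proof (induction ps)
  case Nil
  then show ?case by (simp add: lin_comb_def[abs_def])
next
  case (Cons p ps)
  obtain c i where p: "p = (c, i)" by (cases p)
  have "Y i \<in> borel_measurable M" "lin_comb Y ps \<in> borel_measurable M"
    using Cons by (auto simp: p)
  then have "(\<lambda>x. c * Y i x + lin_comb Y ps x) \<in> borel_measurable M" by simp
  then show ?case unfolding p by (subst measurable_cong[of _ _ "\<lambda>x. c * Y i x + lin_comb Y ps x"]) simp_all
qed

context prob_space begin

text \<open>By induction on the cylinder, with the remaining characters \<open>ps\<close> kept
  arbitrary. A new constraint on \<open>Y i\<close> is handled by putting
  \<open>(\<theta>, i)\<close> in front of \<open>ps\<close>: as this works for every \<theta>,
  \<open>weight_eq_zero_of_char\<close> exchanges the character of \<open>Y i\<close> for an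
  indicator.\<close>

lemma weight_eq_zero_on_cylinders:
  fixes Y :: "'i \<Rightarrow> 'a \<Rightarrow> real" and W :: "'a \<Rightarrow> complex"
  assumes Y: "\<And>i. i \<in> I \<Longrightarrow> Y i \<in> borel_measurable M"
    and W [measurable]: "W \<in> borel_measurable M" and C: "\<And>x. norm (W x) \<le> C"
    and 0: "\<And>ps. snd ` set ps \<subseteq> I \<Longrightarrow> (\<integral>x. iexp (lin_comb Y ps x) * W x \<partial>M) = 0"
    and A: "A \<in> fin_inter (space M) {Y i -` B \<inter> space M |i B. i \<in> I \<and> B \<in> sets borel}"
  shows "A \<in> sets M" "snd ` set ps \<subseteq> I \<Longrightarrow> (\<integral>x. indicator A x * (iexp (lin_comb Y ps x) * W x) \<partial>M) = 0"
proof -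
  from A have "A \<in> sets M \<and>
    (\<forall>ps. snd ` set ps \<subseteq> I \<longrightarrow> (\<integral>x. indicator A x * (iexp (lin_comb Y ps x) * W x) \<partial>M) = 0)"
  proof induction
    case top
    have "(\<integral>x. indicator (space M) x * (iexp (lin_comb Y ps x) * W x) \<partial>M) = (\<integral>x. iexp (lin_comb Y ps x) * W x \<partial>M)" for ps
      by (intro Bochner_Integration.integral_cong) auto
    then show ?case using 0 by simp
  next
    case (Int A D)
    then obtain i B where D: "D = Y i -` B \<inter> space M" "i \<in> I" and B [measurable]: "B \<in> sets borel" by auto
    have AM [measurable]: "A \<in> sets M" using Int by blast
    have Yi [measurable]: "Y i \<in> borel_measurable M" by (rule Y[OF D(2)])
    have "(\<integral>x. indicator (D \<inter> A) x * (iexp (lin_comb Y ps x) * W x) \<partial>M) = 0" if ps: "snd ` set ps \<subseteq> I" for ps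
    proof -
      have [measurable]: "lin_comb Y ps \<in> borel_measurable M"
        by (rule lin_comb_measurable) (use ps Y in auto)
      have "(\<integral>x. indicator B (Y i x) * (indicator A x * (iexp (lin_comb Y ps x) * W x)) \<partial>M) = 0"
      proof (rule weight_eq_zero_of_char[OF Yi _ _ _ B, where C=C])
        show "(\<lambda>x. indicator A x * (iexp (lin_comb Y ps x) * W x)) \<in> borel_measurable M" by measurable
        show "norm (indicator A x * (iexp (lin_comb Y ps x) * W x)) \<le> C" for x
          using C[of x] order_trans[OF norm_ge_zero C[of x]] by (auto simp: norm_mult indicator_def)
        fix \<theta>
        have "(\<integral>x. indicator A x * (iexp (lin_comb Y ((\<theta>, i) # ps) x) * W x) \<partial>M) = 0"
          using Int.IH ps D(2) by (simp del: lin_comb_simps)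
        moreover have "(\<lambda>x. iexp (\<theta> * Y i x) * (indicator A x * (iexp (lin_comb Y ps x) * W x)))
          = (\<lambda>x. indicator A x * (iexp (lin_comb Y ((\<theta>, i) # ps) x) * W x))"
          by (auto simp: distrib_left exp_add)
        ultimately show "(\<integral>x. iexp (\<theta> * Y i x) * (indicator A x * (iexp (lin_comb Y ps x) * W x)) \<partial>M) = 0"
          by simp
      qed
      also have "(\<integral>x. indicator B (Y i x) * (indicator A x * (iexp (lin_comb Y ps x) * W x)) \<partial>M)
        = (\<integral>x. indicator (D \<inter> A) x * (iexp (lin_comb Y ps x) * W x) \<partial>M)"
        by (intro Bochner_Integration.integral_cong) (auto simp: D indicator_def)
      finally show ?thesis .
    qed
    then show ?case using D(1) by auto
  qed
  then show "A \<in> sets M" "snd ` set ps \<subseteq> I \<Longrightarrow> (\<integral>x. indicator A x * (iexp (lin_comb Y ps x) * W x) \<partial>M) = 0"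
    by auto
qed

text \<open>Two passes of \<open>weight_eq_zero_on_cylinders\<close>. With
  \<open>iexp (lin_comb Z qs x)\<close> minus its mean as weight, the characters of \<open>Y\<close>
  are exchanged for the indicator of a \<open>Y\<close>-cylinder \<open>A\<close>. With
  \<open>indicator A x - prob A\<close> as weight, those of \<open>Z\<close> are exchanged for a
  \<open>Z\<close>-cylinder. Stability under intersection then carries independence to the generated
  sigma-algebras.\<close>

lemma indep_set_of_char:
  fixes Y Z :: "'i \<Rightarrow> 'a \<Rightarrow> real"
  assumes Y: "\<And>i. i \<in> I \<Longrightarrow> Y i \<in> borel_measurable M" and Z: "\<And>i. i \<in> I \<Longrightarrow> Z i \<in> borel_measurable M"
    and fac: "\<And>ps qs. snd ` set ps \<subseteq> I \<Longrightarrow> snd ` set qs \<subseteq> I \<Longrightarrow>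
      (\<integral>x. iexp (lin_comb Y ps x + lin_comb Z qs x) \<partial>M)
        = (\<integral>x. iexp (lin_comb Y ps x) \<partial>M) * (\<integral>x. iexp (lin_comb Z qs x) \<partial>M)"
  shows "indep_set (sigma_sets (space M) {Y i -` B \<inter> space M |i B. i \<in> I \<and> B \<in> sets borel})
    (sigma_sets (space M) {Z i -` B \<inter> space M |i B. i \<in> I \<and> B \<in> sets borel})"
proof -
  define CY where "CY = {Y i -` B \<inter> space M |i B. i \<in> I \<and> B \<in> sets borel}"
  define CZ where "CZ = {Z i -` B \<inter> space M |i B. i \<in> I \<and> B \<in> sets borel}"
  have LY: "lin_comb Y ps \<in> borel_measurable M" if "snd ` set ps \<subseteq> I" for ps
    by (rule lin_comb_measurable) (use that Y in auto)
  have LZ: "lin_comb Z ps \<in> borel_measurable M" if "snd ` set ps \<subseteq> I" for ps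
    by (rule lin_comb_measurable) (use that Z in auto)
  have i1: "integrable M (\<lambda>x. iexp (f x))" if "f \<in> borel_measurable M" for f :: "'a \<Rightarrow> real"
    by (rule integrable_const_bound[where B=1]) (use that in auto)
  have n1: "norm (\<integral>x. iexp (f x) \<partial>M) \<le> 1" for f :: "'a \<Rightarrow> real"
    using norm_integral_le[of M "\<lambda>_. 1" "\<lambda>x. iexp (f x)"] by (simp add: prob_space)
  have Y_W: "(\<integral>x. iexp (lin_comb Y ps x) * (iexp (lin_comb Z qs x) - (\<integral>x. iexp (lin_comb Z qs x) \<partial>M)) \<partial>M) = 0"
    if "snd ` set ps \<subseteq> I" "snd ` set qs \<subseteq> I" for ps qs
  proof -
    note m [measurable] = LY[OF that(1)] LZ[OF that(2)]
    have "(\<integral>x. iexp (lin_comb Y ps x) * (iexp (lin_comb Z qs x) - (\<integral>x. iexp (lin_comb Z qs x) \<partial>M)) \<partial>M)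
      = (\<integral>x. iexp (lin_comb Y ps x + lin_comb Z qs x) - iexp (lin_comb Y ps x) * (\<integral>x. iexp (lin_comb Z qs x) \<partial>M) \<partial>M)"
      by (simp add: right_diff_distrib distrib_left exp_add)
    also have "\<dots> = (\<integral>x. iexp (lin_comb Y ps x + lin_comb Z qs x) \<partial>M)
        - (\<integral>x. iexp (lin_comb Y ps x) * (\<integral>x. iexp (lin_comb Z qs x) \<partial>M) \<partial>M)"
      by (rule Bochner_Integration.integral_diff) (rule i1 integrable_mult_left; measurable)+
    also have "\<dots> = 0" unfolding fac[OF that] by simp
    finally show ?thesis .
  qed
  have indep: "A \<in> sets M \<and> B \<in> sets M \<and> prob (A \<inter> B) = prob A * prob B"
    if A: "A \<in> fin_inter (space M) CY" and B: "B \<in> fin_inter (space M) CZ" for A B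
  proof -
    have *: "A \<in> sets M \<and> (\<integral>x. indicator A x * (iexp (lin_comb Z qs x) - (\<integral>x. iexp (lin_comb Z qs x) \<partial>M)) \<partial>M) = 0"
      if qs: "snd ` set qs \<subseteq> I" for qs
    proof -
      have [measurable]: "(\<lambda>x. iexp (lin_comb Z qs x) - (\<integral>x. iexp (lin_comb Z qs x) \<partial>M)) \<in> borel_measurable M"
        using LZ[OF qs] by measurable
      have bd: "norm (iexp (lin_comb Z qs x) - (\<integral>x. iexp (lin_comb Z qs x) \<partial>M)) \<le> 2" for x
        using norm_triangle_ineq4[of "iexp (lin_comb Z qs x)" "\<integral>x. iexp (lin_comb Z qs x) \<partial>M"] n1[of "lin_comb Z qs"]
        by simp
      note w = weight_eq_zero_on_cylinders[OF Y _ bd Y_W[OF _ qs] A[unfolded CY_def]]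
      show ?thesis using w(1) w(2)[of "[]"] by simp
    qed
    have AM [measurable]: "A \<in> sets M" using *[of "[]"] by simp
    have iA: "integrable M (\<lambda>x. indicator A x * iexp (f x))" if "f \<in> borel_measurable M" for f :: "'a \<Rightarrow> real"
      by (rule integrable_const_bound[where B=1]) (use that in \<open>auto simp: norm_mult indicator_def\<close>)
    have iA0: "integrable M (\<lambda>x. indicator A x :: complex)"
      using iA[of "\<lambda>_. 0"] by simp
    have pA: "(\<integral>x. indicator A x \<partial>M) = complex_of_real (prob A)"
    proof -
      have "(\<integral>x. complex_of_real (indicator A x) \<partial>M) = prob A" by simp
      then show ?thesis by (simp add: of_real_indicator)
    qed
    have Z_W: "(\<integral>x. iexp (lin_comb Z qs x) * (indicator A x - complex_of_real (prob A)) \<partial>M) = 0" if qs: "snd ` set qs \<subseteq> I" for qs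
    proof -
      define e where "e = (\<integral>x. iexp (lin_comb Z qs x) \<partial>M)"
      have "(\<integral>x. indicator A x * iexp (lin_comb Z qs x) - indicator A x * e \<partial>M) = 0"
        using *[OF qs] unfolding e_def[symmetric] by (simp add: right_diff_distrib)
      then have "(\<integral>x. indicator A x * iexp (lin_comb Z qs x) \<partial>M) = prob A * e"
        using iA[OF LZ[OF qs]] iA0 pA by simp
      moreover have "(\<integral>x. iexp (lin_comb Z qs x) * (indicator A x - complex_of_real (prob A)) \<partial>M)
        = (\<integral>x. indicator A x * iexp (lin_comb Z qs x) - iexp (lin_comb Z qs x) * complex_of_real (prob A) \<partial>M)"
        by (intro Bochner_Integration.integral_cong) (simp_all add: algebra_simps)
      ultimately show ?thesis
        using iA[OF LZ[OF qs]] i1[OF LZ[OF qs]] unfolding e_def by simp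
    qed
    have bd: "norm (indicator A x - complex_of_real (prob A)) \<le> 2" for x
      using norm_triangle_ineq4[of "indicator A x" "complex_of_real (prob A)"] by (auto simp: indicator_def split: if_splits intro: order_trans)
    have "(\<lambda>x. indicator A x - complex_of_real (prob A)) \<in> borel_measurable M" by measurable
    note w = weight_eq_zero_on_cylinders[OF Z this bd Z_W B[unfolded CZ_def]]
    have BM: "B \<in> sets M" by (rule w(1))
    have "(\<integral>x. indicator B x * (indicator A x - complex_of_real (prob A)) \<partial>M) = 0" using w(2)[of "[]"] by simp
    also have "(\<integral>x. indicator B x * (indicator A x - complex_of_real (prob A)) \<partial>M)
       = (\<integral>x. complex_of_real (indicator (A \<inter> B) x - prob A * indicator B x) \<partial>M)"
      by (intro Bochner_Integration.integral_cong) (auto simp: indicator_def)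
    also have "\<dots> = complex_of_real (prob (A \<inter> B) - prob A * prob B)"
      using BM by (subst integral_complex_of_real) (simp add: less_top[symmetric])
    finally have "prob (A \<inter> B) - prob A * prob B = 0" by (simp only: of_real_eq_0_iff)
    then show ?thesis using AM BM by simp
  qed
  have "indep_set (sigma_sets (space M) (fin_inter (space M) CY)) (sigma_sets (space M) (fin_inter (space M) CZ))"
  proof (rule indep_set_sigma_sets)
    show "indep_set (fin_inter (space M) CY) (fin_inter (space M) CZ)"
      using indep indep[OF _ fin_inter.top] indep[OF fin_inter.top] by (intro indep_setI) auto
  qed (rule Int_stable_fin_inter)+
  moreover have "sigma_sets (space M) CY \<subseteq> sigma_sets (space M) (fin_inter (space M) CY)"
    by (rule sigma_sets_mono', rule subset_fin_inter) (auto simp: CY_def)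
  moreover have "sigma_sets (space M) CZ \<subseteq> sigma_sets (space M) (fin_inter (space M) CZ)"
    by (rule sigma_sets_mono', rule subset_fin_inter) (auto simp: CZ_def)
  ultimately show ?thesis
    unfolding CY_def[symmetric] CZ_def[symmetric] indep_sets2_eq by blast
qed

text \<open>Since \<psi> is real, the hypothesis says that \<open>cos (Y x) - \<psi>\<close> and
  \<open>sin (Y x)\<close> integrate to 0 over every set of \<open>G\<close>. Both are then
  orthogonal to every bounded \<open>G\<close>-measurable \<open>V\<close>.\<close>

lemma char_factor:
  fixes Y :: "'a \<Rightarrow> real" and V :: "'a \<Rightarrow> complex"
  assumes G: "subalgebra M G" and Y [measurable]: "Y \<in> borel_measurable M"
    and ch: "\<And>A. A \<in> sets G \<Longrightarrow> (\<integral>x. indicator A x * iexp (Y x) \<partial>M) = complex_of_real (\<psi> * prob A)"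
    and V: "V \<in> borel_measurable G" and B: "\<And>x. norm (V x) \<le> B"
  shows "(\<integral>x. V x * iexp (Y x) \<partial>M) = complex_of_real \<psi> * (\<integral>x. V x \<partial>M)"
proof -
  have [measurable]: "V \<in> borel_measurable M" by (rule measurable_from_subalg[OF G V])
  have i: "integrable M (\<lambda>x. V x * f x)" if [measurable]: "f \<in> borel_measurable M" and "\<And>x. norm (f x) \<le> 1" for f :: "'a \<Rightarrow> complex"
  proof (rule integrable_const_bound[where B=B])
    show "AE x in M. norm (V x * f x) \<le> B"
      using mult_mono[OF B that(2)] order_trans[OF norm_ge_zero B] by (intro AE_I2) (simp add: norm_mult)
  qed measurable
  have AM: "A \<in> sets M" if "A \<in> sets G" for A using that G by (auto simp: subalgebra_def)
  have iY: "integrable M (\<lambda>x. indicator A x * iexp (Y x))" if "A \<in> sets G" for A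
    using AM[OF that] by (intro integrable_const_bound[where B=1]) (auto simp: norm_mult indicator_def)
  have Rei: "Re (indicator A x * iexp (Y x)) = cos (Y x) * indicator A x"
    and Imi: "Im (indicator A x * iexp (Y x)) = sin (Y x) * indicator A x" for A x
    by (auto simp: indicator_def Re_exp Im_exp)
  have c: "(\<integral>x. V x * of_real (cos (Y x) - \<psi>) \<partial>M) = 0"
  proof (rule complex_integral_mult_eq_zero[OF G _ _ V B])
    have "integrable M (\<lambda>x. cos (Y x))" by (rule integrable_const_bound[where B=1]) auto
    then show "integrable M (\<lambda>x. cos (Y x) - \<psi>)" by simp
    fix A assume A: "A \<in> sets G"
    note [measurable] = AM[OF A]
    have "(\<integral>x. cos (Y x) * indicator A x \<partial>M) = \<psi> * prob A"
      using integral_Re[OF iY[OF A]] unfolding ch[OF A] Rei by simp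
    moreover have "integrable M (\<lambda>x. cos (Y x) * indicator A x)"
      using integrable_Re[OF iY[OF A]] unfolding Rei .
    ultimately show "(\<integral>x. (cos (Y x) - \<psi>) * indicator A x \<partial>M) = 0"
      unfolding left_diff_distrib by (subst Bochner_Integration.integral_diff) (auto simp: less_top[symmetric])
  qed
  have s: "(\<integral>x. V x * of_real (sin (Y x)) \<partial>M) = 0"
  proof (rule complex_integral_mult_eq_zero[OF G _ _ V B])
    show "integrable M (\<lambda>x. sin (Y x))" by (rule integrable_const_bound[where B=1]) auto
    fix A assume A: "A \<in> sets G"
    show "(\<integral>x. sin (Y x) * indicator A x \<partial>M) = 0"
      using integral_Im[OF iY[OF A]] unfolding ch[OF A] Imi by simp
  qed
  have iV: "integrable M V" using i[of "\<lambda>_. 1"] by simp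
  have ic: "integrable M (\<lambda>x. V x * of_real (cos (Y x) - \<psi>))"
    using i[of "\<lambda>x. of_real (cos (Y x))"] iV by (simp add: right_diff_distrib)
  have sin_int: "integrable M (\<lambda>x. V x * of_real (sin (Y x)))"
    using i[of "\<lambda>x. of_real (sin (Y x))"] by simp
  have e: "iexp y = of_real (cos y) + \<i> * of_real (sin y)" for y
    by (simp add: cis_conv_exp[symmetric] complex_eq_iff)
  have "(\<integral>x. V x * iexp (Y x) \<partial>M)
    = (\<integral>x. V x * of_real (cos (Y x) - \<psi>) + \<i> * (V x * of_real (sin (Y x))) + of_real \<psi> * V x \<partial>M)"
    unfolding e by (intro Bochner_Integration.integral_cong) (simp_all add: algebra_simps)
  also have "\<dots> = of_real \<psi> * (\<integral>x. V x \<partial>M)"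
    using ic sin_int iV c s by simp
  finally show ?thesis .
qed

text \<open>Peels off the last summand by \<open>char_factor\<close>. Adaptedness is formulated as
  measurability of all earlier \<open>D j\<close> for \<open>G k\<close>, because the algebras
  \<open>J\<close> met while running through a grid cell by cell do not form an increasing
  sequence.\<close>

lemma char_sum_eq_prod:
  fixes D :: "nat \<Rightarrow> 'a \<Rightarrow> real"
  assumes G: "\<And>k. k < N \<Longrightarrow> subalgebra M (G k)" and D: "\<And>k. k < N \<Longrightarrow> D k \<in> borel_measurable M"
    and DG: "\<And>j k. j < k \<Longrightarrow> k < N \<Longrightarrow> D j \<in> borel_measurable (G k)"
    and ch: "\<And>k A. k < N \<Longrightarrow> A \<in> sets (G k) \<Longrightarrow> (\<integral>x. indicator A x * iexp (D k x) \<partial>M) = complex_of_real (\<psi> k * prob A)"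
  shows "(\<integral>x. iexp (\<Sum>k<N. D k x) \<partial>M) = complex_of_real (\<Prod>k<N. \<psi> k)"
proof -
  have "n \<le> N \<Longrightarrow> (\<integral>x. iexp (\<Sum>k<n. D k x) \<partial>M) = complex_of_real (\<Prod>k<n. \<psi> k)" for n
  proof (induction n)
    case 0
    show ?case by (simp add: prob_space)
  next
    case (Suc n)
    then have n: "n < N" "n \<le> N" by auto
    have "(\<lambda>x. \<Sum>k<n. D k x) \<in> borel_measurable (G n)"
      by (intro borel_measurable_sum DG) (use n in auto)
    then have V: "(\<lambda>x. iexp (\<Sum>k<n. D k x)) \<in> borel_measurable (G n)"
      by measurable
    have "(\<integral>x. iexp (\<Sum>k<Suc n. D k x) \<partial>M) = (\<integral>x. iexp (\<Sum>k<n. D k x) * iexp (D n x) \<partial>M)"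
      by (simp add: distrib_left exp_add)
    also have "\<dots> = complex_of_real (\<psi> n) * (\<integral>x. iexp (\<Sum>k<n. D k x) \<partial>M)"
      by (rule char_factor[OF G[OF n(1)] D[OF n(1)] ch[OF n(1)] V, where B=1]) auto
    finally show ?case using Suc.IH[OF n(2)] by simp
  qed
  then show ?thesis by simp
qed

text \<open>The centred indicator \<open>indicator A x - prob A\<close> has zero integral against
  every character of \<open>Y\<close>, so Fourier uniqueness gives independence of \<open>A\<close>.
  The choice of the whole space for \<open>A\<close> gives the law.\<close>

lemma indep_increment:
  assumes G: "subalgebra M G" and Y [measurable]: "Y \<in> borel_measurable M"
    and ch: "\<And>u A. A \<in> sets G \<Longrightarrow> (\<integral>x. indicator A x * iexp (u * Y x) \<partial>M) = complex_of_real (exp (- (u\<^sup>2 * c / 2)) * prob A)"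
    and c: "0 < c"
  shows "indep_set {Y -` B \<inter> space M |B. B \<in> sets borel} (sets G)"
    and "distributed M lborel Y (normal_density 0 (sqrt c))"
proof -
  have "space M \<in> sets G" using G sets.top[of G] by (simp add: subalgebra_def)
  then have ch1: "(\<integral>x. iexp (u * Y x) \<partial>M) = complex_of_real (exp (- (u\<^sup>2 * c / 2)))" for u
    using ch[of "space M" u] by (subst (asm) Bochner_Integration.integral_cong[of M M _ "\<lambda>x. iexp (u * Y x)"]) (simp_all add: prob_space)
  show "distributed M lborel Y (normal_density 0 (sqrt c))"
    by (rule distributed_normalI[OF Y c]) (use ch1 in simp)
  show "indep_set {Y -` B \<inter> space M |B. B \<in> sets borel} (sets G)"
  proof (rule indep_setI)
    show "{Y -` B \<inter> space M |B. B \<in> sets borel} \<subseteq> events" "sets G \<subseteq> events"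
      using G by (auto simp: subalgebra_def)
    fix D A assume "D \<in> {Y -` B \<inter> space M |B. B \<in> sets borel}" and A: "A \<in> sets G"
    then obtain B where D: "D = Y -` B \<inter> space M" and B [measurable]: "B \<in> sets borel" by auto
    have AM [measurable]: "A \<in> sets M" using A G by (auto simp: subalgebra_def)
    have DM [measurable]: "D \<in> sets M" unfolding D by simp
    have i1: "integrable M (\<lambda>x. iexp (u * Y x))" "integrable M (\<lambda>x. indicator A x * iexp (u * Y x))" for u
      by (rule integrable_const_bound[where B=1]; auto simp: norm_mult indicator_def)+
    have "(\<integral>x. indicator B (Y x) * (indicator A x - complex_of_real (prob A)) \<partial>M) = 0"
    proof (rule weight_eq_zero_of_char[OF Y])
      show "norm (indicator A x - complex_of_real (prob A)) \<le> 2" for x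
        using norm_triangle_ineq4[of "indicator A x" "complex_of_real (prob A)"]
        by (auto simp: indicator_def split: if_splits intro: order_trans)
      fix u
      have "(\<integral>x. iexp (u * Y x) * (indicator A x - complex_of_real (prob A)) \<partial>M)
        = (\<integral>x. indicator A x * iexp (u * Y x) - iexp (u * Y x) * complex_of_real (prob A) \<partial>M)"
        by (intro Bochner_Integration.integral_cong) (simp_all add: algebra_simps)
      also have "\<dots> = (\<integral>x. indicator A x * iexp (u * Y x) \<partial>M) - (\<integral>x. iexp (u * Y x) * complex_of_real (prob A) \<partial>M)"
        by (rule Bochner_Integration.integral_diff[OF i1(2) integrable_mult_left[OF i1(1)]])
      also have "\<dots> = 0" using ch[OF A, of u] ch1[of u] by simp
      finally show "(\<integral>x. iexp (u * Y x) * (indicator A x - complex_of_real (prob A)) \<partial>M) = 0" .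
    qed measurable
    also have "(\<integral>x. indicator B (Y x) * (indicator A x - complex_of_real (prob A)) \<partial>M)
       = (\<integral>x. complex_of_real (indicator (D \<inter> A) x - prob A * indicator D x) \<partial>M)"
      by (intro Bochner_Integration.integral_cong) (auto simp: indicator_def D)
    also have "\<dots> = complex_of_real (prob (D \<inter> A) - prob A * prob D)"
      by (subst integral_complex_of_real) (simp add: less_top[symmetric])
    finally have "prob (D \<inter> A) - prob A * prob D = 0" by (simp only: of_real_eq_0_iff)
    then show "prob (D \<inter> A) = prob D * prob A" by simp
  qed
qed

end

section \<open>Independence of the real and imaginary parts\<close>

lemma sum_div_mod:
  fixes g :: "nat \<Rightarrow> nat \<Rightarrow> real"
  shows "(\<Sum>r<n * n. g (r div n) (r mod n)) = (\<Sum>i<n. \<Sum>j<n. g i j)"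
proof -
  have "(\<Sum>r<n * n. g (r div n) (r mod n)) = (\<Sum>(i, j)\<in>{..<n} \<times> {..<n}. g i j)"
  proof (rule sum.reindex_bij_witness[where i="\<lambda>(i, j). i * n + j" and j="\<lambda>r. (r div n, r mod n)"])
    fix r assume "r \<in> {..<n * n}"
    then have "r < n * n" "0 < n" by (auto intro: ccontr)
    then show "(r div n, r mod n) \<in> {..<n} \<times> {..<n}" by (auto simp: less_mult_imp_div_less)
  next
    fix p assume p: "p \<in> {..<n} \<times> {..<n}"
    then obtain i j where ij: "p = (i, j)" "i < n" "j < n" by auto
    have "i * n + j < Suc i * n" using ij by simp
    also have "\<dots> \<le> n * n" using ij by (intro mult_le_mono1) simp
    finally show "(case p of (i, j) \<Rightarrow> i * n + j) \<in> {..<n * n}" using ij by simp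
  qed auto
  then show ?thesis by (simp add: sum.cartesian_product)
qed

lemma sum_of_bool_less:
  fixes f :: "nat \<Rightarrow> real"
  assumes "l \<le> n"
  shows "(\<Sum>j<n. of_bool (j < l) * f j) = (\<Sum>j<l. f j)"
  using assms by (intro sum.mono_neutral_cong_right) auto

text \<open>Double telescoping over the cells below and to the left of the grid point
  \<open>(k, l)\<close>; the boundary terms vanish on the axes. The sum runs over all cells, with a
  0-1 coefficient, so that different grid points are expanded over the same index set.\<close>

lemma grid_telescope:
  fixes y :: "nat \<Rightarrow> nat \<Rightarrow> real"
  assumes "k \<le> n" "l \<le> n" and y0: "\<And>i. i \<le> n \<Longrightarrow> y i 0 = 0" "\<And>j. j \<le> n \<Longrightarrow> y 0 j = 0"
  shows "(\<Sum>r<n * n. of_bool (r div n < k \<and> r mod n < l) *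
      (y (Suc (r div n)) (Suc (r mod n)) - y (r div n) (Suc (r mod n)) - y (Suc (r div n)) (r mod n) + y (r div n) (r mod n)))
    = y k l"
proof -
  have "(\<Sum>r<n * n. of_bool (r div n < k \<and> r mod n < l) *
      (y (Suc (r div n)) (Suc (r mod n)) - y (r div n) (Suc (r mod n)) - y (Suc (r div n)) (r mod n) + y (r div n) (r mod n)))
    = (\<Sum>i<n. \<Sum>j<n. of_bool (i < k \<and> j < l) * (y (Suc i) (Suc j) - y i (Suc j) - y (Suc i) j + y i j))"
    by (rule sum_div_mod)
  also have "\<dots> = (\<Sum>i<n. of_bool (i < k) * (\<Sum>j<n. of_bool (j < l) * ((y (Suc i) (Suc j) - y i (Suc j)) - (y (Suc i) j - y i j))))"
    unfolding sum_distrib_left by (intro sum.cong) (auto simp: of_bool_def)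
  also have "\<dots> = (\<Sum>i<k. \<Sum>j<l. (y (Suc i) (Suc j) - y i (Suc j)) - (y (Suc i) j - y i j))"
    by (simp only: sum_of_bool_less[OF assms(1)] sum_of_bool_less[OF assms(2)])
  also have "\<dots> = (\<Sum>i<k. (y (Suc i) l - y i l) - (y (Suc i) 0 - y i 0))"
    by (intro sum.cong refl sum_lessThan_telescope)
  also have "\<dots> = (\<Sum>i<k. y (Suc i) l - y i l)"
    using assms(1) y0 by (intro sum.cong) auto
  also have "\<dots> = y k l - y 0 l" by (rule sum_lessThan_telescope)
  finally show ?thesis using y0(2)[OF assms(2)] by simp
qed

lemma floor_grid_tendsto:
  fixes u U :: real
  assumes "0 < U" "0 \<le> u"
  shows "(\<lambda>m. U * nat \<lfloor>Suc m * u / U\<rfloor> / Suc m) \<longlonglongrightarrow> u"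
proof (rule tendsto_sandwich)
  have k: "Suc m * u / U - 1 \<le> nat \<lfloor>Suc m * u / U\<rfloor>" "nat \<lfloor>Suc m * u / U\<rfloor> \<le> Suc m * u / U" for m
  proof -
    have "0 \<le> real (Suc m) * u / U" using assms by simp
    then have "real (nat \<lfloor>Suc m * u / U\<rfloor>) = of_int \<lfloor>Suc m * u / U\<rfloor>" by simp
    then show "Suc m * u / U - 1 \<le> nat \<lfloor>Suc m * u / U\<rfloor>" "nat \<lfloor>Suc m * u / U\<rfloor> \<le> Suc m * u / U" by linarith+
  qed
  have e: "U * (Suc m * u / U) / Suc m = u" "U * (Suc m * u / U - 1) / Suc m = u - U / Suc m" for m
    using assms by (simp_all add: right_diff_distrib diff_divide_distrib del: of_nat_Suc)
  show "\<forall>\<^sub>F m in sequentially. u - U / Suc m \<le> U * nat \<lfloor>Suc m * u / U\<rfloor> / Suc m"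
    unfolding e(2)[symmetric] using k(1) assms by (intro always_eventually allI divide_right_mono mult_left_mono) auto
  have "U * nat \<lfloor>Suc m * u / U\<rfloor> / Suc m \<le> U * (Suc m * u / U) / Suc m" for m
    using k(2)[of m] assms by (intro divide_right_mono mult_left_mono) auto
  then show "\<forall>\<^sub>F m in sequentially. U * nat \<lfloor>Suc m * u / U\<rfloor> / Suc m \<le> u"
    unfolding e(1) by simp
  have "(\<lambda>m. u - U / Suc m) \<longlonglongrightarrow> u - 0"
    by (intro tendsto_intros LIMSEQ_Suc[OF lim_const_over_n])
  then show "(\<lambda>m. u - U / Suc m) \<longlonglongrightarrow> u" by simp
qed auto

lemma floor_grid_le:
  fixes u U :: real
  assumes "0 < U" "u \<le> U"
  shows "nat \<lfloor>n * u / U\<rfloor> \<le> n"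
proof -
  have "n * u / U \<le> n" using assms by (simp add: pos_divide_le_eq mult_left_mono)
  then have "\<lfloor>n * u / U\<rfloor> \<le> int n" by (simp add: floor_le_iff)
  then show ?thesis by simp
qed

section \<open>Factorisation of the joint characteristic function over a grid\<close>

context planar_levy
begin

context
  assumes S_pos: "0 < S" and T_pos: "0 < T"
begin

definition gs :: "nat \<Rightarrow> nat \<Rightarrow> real" where "gs n i = S * i / n"
definition gt :: "nat \<Rightarrow> nat \<Rightarrow> real" where "gt n j = T * j / n"

lemma gs_bounds: "0 \<le> gs n i" "i \<le> n \<Longrightarrow> gs n i \<le> S" and gs_mono: "i \<le> i' \<Longrightarrow> gs n i \<le> gs n i'"
  using S_pos by (auto simp: gs_def divide_simps intro!: mult_left_mono divide_right_mono)

lemma gt_bounds: "0 \<le> gt n i" "i \<le> n \<Longrightarrow> gt n i \<le> T" and gt_mono: "i \<le> i' \<Longrightarrow> gt n i \<le> gt n i'"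
  using T_pos by (auto simp: gt_def divide_simps intro!: mult_left_mono divide_right_mono)

lemma g_diff: "gs n (Suc i) - gs n i = S / n" "gt n (Suc i) - gt n i = T / n"
  by (cases "n = 0"; simp add: gs_def gt_def field_simps)+

text \<open>Cell \<open>r\<close> has index \<open>r div n\<close> in \<open>s\<close> and
  \<open>r mod n\<close> in \<open>t\<close>. In this order every earlier cell is known to the
  algebra \<open>J\<close> at the lower left corner of the current one, so the characteristic
  functions of the cells multiply.\<close>

lemma grid_char:
  fixes a b :: "nat \<Rightarrow> real"
  assumes n: "0 < n"
  shows "(\<integral>x. iexp (\<Sum>r<n * n. comb (a r) (b r) (gs n (r div n)) (gt n (r mod n)) (gs n (Suc (r div n))) (gt n (Suc (r mod n))) x) \<partial>M)
    = complex_of_real (\<Prod>r<n * n. exp (- (((a r)\<^sup>2 + (b r)\<^sup>2) * (S / n * (T / n)) / 2)))"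
proof (rule char_sum_eq_prod[where G="\<lambda>r. J (gs n (r div n)) (gt n (r mod n))"])
  have less: "gs n i < gs n (Suc i)" "gt n i < gt n (Suc i)" for i
    using g_diff[where n=n and i=i] divide_pos_pos[OF S_pos, of "real n"] divide_pos_pos[OF T_pos, of "real n"] n by simp_all
  fix r assume r: "r < n * n"
  then have ij: "r div n < n" "r mod n < n" using n by (auto simp: less_mult_imp_div_less)
  then have le: "Suc (r div n) \<le> n" "Suc (r mod n) \<le> n" "r div n \<le> n" "r mod n \<le> n" by linarith+
  have bounds: "0 \<le> gs n (r div n)" "0 \<le> gt n (r mod n)" "gs n (Suc (r div n)) \<le> S" "gt n (Suc (r mod n)) \<le> T"
    "gs n (r div n) \<le> S" "gt n (r mod n) \<le> T"
    by (rule gs_bounds(1) gt_bounds(1) gs_bounds(2)[OF le(1)] gs_bounds(2)[OF le(3)]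
      gt_bounds(2)[OF le(2)] gt_bounds(2)[OF le(4)])+
  show "subalgebra M (J (gs n (r div n)) (gt n (r mod n)))" using bounds by (intro subalgebra_J) auto
  show "comb (a r) (b r) (gs n (r div n)) (gt n (r mod n)) (gs n (Suc (r div n))) (gt n (Suc (r mod n))) \<in> borel_measurable M"
    by (rule comb_measurable[OF bounds(1) less_imp_le[OF less(1)] bounds(2) less_imp_le[OF less(2)] bounds(3,4)])
  fix A assume A: "A \<in> sets (J (gs n (r div n)) (gt n (r mod n)))"
  show "(\<integral>x. indicator A x * iexp (comb (a r) (b r) (gs n (r div n)) (gt n (r mod n)) (gs n (Suc (r div n))) (gt n (Suc (r mod n))) x) \<partial>M)
    = complex_of_real (exp (- (((a r)\<^sup>2 + (b r)\<^sup>2) * (S / n * (T / n)) / 2)) * prob A)"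
    using char_comb[OF bounds(1) less(1) bounds(2) less(2) bounds(3,4) A, of "a r" "b r"] unfolding g_diff by simp
next
  fix q r assume qr: "q < r" and r: "r < n * n"
  then have "r div n < n" "r mod n < n" and "q div n < n" "q mod n < n"
    using n by (auto simp: less_mult_imp_div_less)
  then have le: "r div n \<le> n" "r mod n \<le> n" "Suc (q div n) \<le> n" "Suc (q mod n) \<le> n" by linarith+
  have bounds: "gs n (r div n) \<le> S" "gt n (r mod n) \<le> T" "gs n (Suc (q div n)) \<le> S" "gt n (Suc (q mod n)) \<le> T"
    by (rule gs_bounds(2)[OF le(1)] gt_bounds(2)[OF le(2)] gs_bounds(2)[OF le(3)] gt_bounds(2)[OF le(4)])+
  define f where "f = comb (a q) (b q) (gs n (q div n)) (gt n (q mod n)) (gs n (Suc (q div n))) (gt n (Suc (q mod n)))"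
  have f: "f \<in> borel_measurable (F (gs n (Suc (q div n))) (gt n (Suc (q mod n))))"
    unfolding f_def by (intro comb_measurable_F gs_bounds gt_bounds gs_mono gt_mono) auto
  \<comment> \<open>An earlier cell lies either in an earlier strip in \<open>s\<close>, hence in
    the part \<open>F s T\<close> of the past, or lower in the same strip, hence in the part
    \<open>F S t\<close>. This is why both parts of \<open>J\<close> are needed.\<close>
  have "q div n < r div n \<or> (q div n = r div n \<and> q mod n < r mod n)"
  proof (cases "q div n < r div n")
    case False
    then have eq: "q div n = r div n" using div_le_mono[of q r n] qr by simp
    have "q = q div n * n + q mod n" "r = r div n * n + r mod n" by simp_all
    then show ?thesis using eq qr by (metis add_less_cancel_left)
  qed simp
  then have "sets (F (gs n (Suc (q div n))) (gt n (Suc (q mod n)))) \<subseteq> sets (J (gs n (r div n)) (gt n (r mod n)))"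
  proof
    assume "q div n < r div n"
    then have "sets (F (gs n (Suc (q div n))) (gt n (Suc (q mod n)))) \<subseteq> sets (F (gs n (r div n)) T)"
      using bounds by (intro F_mono gs_mono) auto
    then show ?thesis using F_subset_J(1)[OF bounds(1,2)] by blast
  next
    assume "q div n = r div n \<and> q mod n < r mod n"
    then have "sets (F (gs n (Suc (q div n))) (gt n (Suc (q mod n)))) \<subseteq> sets (F S (gt n (r mod n)))"
      using bounds by (intro F_mono gt_mono) auto
    then show ?thesis using F_subset_J(2)[OF bounds(1,2)] by blast
  qed
  then show "f \<in> borel_measurable (J (gs n (r div n)) (gt n (r mod n)))"
    by (intro measurable_from_subalg[OF _ f]) (simp add: subalgebra_def)
qed

definition gp :: "nat \<Rightarrow> real \<times> real \<Rightarrow> real \<times> real" where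
  "gp n = (\<lambda>(u, v). (gs n (nat \<lfloor>n * u / S\<rfloor>), gt n (nat \<lfloor>n * v / T\<rfloor>)))"

text \<open>The coefficients of the process at the rounded point \<open>gp n p\<close> in terms of
  the cell increments. With the point as first argument, \<open>lin_comb (weight n) ps\<close> is
  the coefficient vector of a whole linear combination.\<close>

definition weight :: "nat \<Rightarrow> real \<times> real \<Rightarrow> nat \<Rightarrow> real" where
  "weight n = (\<lambda>(u, v) r. of_bool (r div n < nat \<lfloor>n * u / S\<rfloor> \<and> r mod n < nat \<lfloor>n * v / T\<rfloor>))"

lemma gp_bounds: "p \<in> {0..S} \<times> {0..T} \<Longrightarrow> gp n p \<in> {0..S} \<times> {0..T}"
  using gs_bounds gt_bounds floor_grid_le[OF S_pos] floor_grid_le[OF T_pos] by (auto simp: gp_def)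

lemma gp_decomp:
  assumes x: "x \<in> space M" and p: "p \<in> {0..S} \<times> {0..T}" and n: "0 < n"
  shows "XR (fst (gp n p)) (snd (gp n p)) x = (\<Sum>r<n * n. weight n p r *
      rect_incr XR (gs n (r div n)) (gt n (r mod n)) (gs n (Suc (r div n))) (gt n (Suc (r mod n))) x)"
    and "XI (fst (gp n p)) (snd (gp n p)) x = (\<Sum>r<n * n. weight n p r *
      rect_incr XI (gs n (r div n)) (gt n (r mod n)) (gs n (Suc (r div n))) (gt n (Suc (r mod n))) x)"
proof -
  obtain u v where uv: "p = (u, v)" "0 \<le> u" "u \<le> S" "0 \<le> v" "v \<le> T" using p by auto
  have z: "X (gs n i) (gt n 0) x = 0" "X (gs n 0) (gt n i) x = 0" if "i \<le> n" for i
    using X_s0[of "gs n i" x] X_0t[of "gt n i" x] gs_bounds gt_bounds that x by (auto simp: gs_def gt_def)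
  show "XR (fst (gp n p)) (snd (gp n p)) x = (\<Sum>r<n * n. weight n p r *
      rect_incr XR (gs n (r div n)) (gt n (r mod n)) (gs n (Suc (r div n))) (gt n (Suc (r mod n))) x)"
    using grid_telescope[OF floor_grid_le[OF S_pos uv(3), of n] floor_grid_le[OF T_pos uv(5), of n], where y="\<lambda>i j. XR (gs n i) (gt n j) x"] z
    by (simp add: uv(1) gp_def weight_def rect_incr_def)
  show "XI (fst (gp n p)) (snd (gp n p)) x = (\<Sum>r<n * n. weight n p r *
      rect_incr XI (gs n (r div n)) (gt n (r mod n)) (gs n (Suc (r div n))) (gt n (Suc (r mod n))) x)"
    using grid_telescope[OF floor_grid_le[OF S_pos uv(3), of n] floor_grid_le[OF T_pos uv(5), of n], where y="\<lambda>i j. XI (gs n i) (gt n j) x"] z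
    by (simp add: uv(1) gp_def weight_def rect_incr_def)
qed

lemma lin_comb_grid:
  assumes x: "x \<in> space M" and n: "0 < n" and ps: "snd ` set ps \<subseteq> {0..S} \<times> {0..T}"
  shows "lin_comb (\<lambda>p. XR (fst (gp n p)) (snd (gp n p))) ps x = (\<Sum>r<n * n. lin_comb (weight n) ps r *
      rect_incr XR (gs n (r div n)) (gt n (r mod n)) (gs n (Suc (r div n))) (gt n (Suc (r mod n))) x)"
    and "lin_comb (\<lambda>p. XI (fst (gp n p)) (snd (gp n p))) ps x = (\<Sum>r<n * n. lin_comb (weight n) ps r *
      rect_incr XI (gs n (r div n)) (gt n (r mod n)) (gs n (Suc (r div n))) (gt n (Suc (r mod n))) x)"
  using ps
proof (induction ps)
  case (Cons q ps)
  obtain c p where q: "q = (c, p)" by (cases q)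
  {
    case 1
    then have "p \<in> {0..S} \<times> {0..T}" "snd ` set ps \<subseteq> {0..S} \<times> {0..T}" unfolding q by auto
    from gp_decomp(1)[OF x this(1) n] Cons.IH(1)[OF this(2)] show ?case
      by (simp add: q distrib_right sum.distrib sum_distrib_left mult.assoc)
  next
    case 2
    then have "p \<in> {0..S} \<times> {0..T}" "snd ` set ps \<subseteq> {0..S} \<times> {0..T}" unfolding q by auto
    from gp_decomp(2)[OF x this(1) n] Cons.IH(2)[OF this(2)] show ?case
      by (simp add: q distrib_right sum.distrib sum_distrib_left mult.assoc)
  }
qed simp_all

lemma gp_tendsto:
  assumes x: "x \<in> space M" and p: "p \<in> {0..S} \<times> {0..T}"
  shows "(\<lambda>m. X (fst (gp (Suc m) p)) (snd (gp (Suc m) p)) x) \<longlonglongrightarrow> X (fst p) (snd p) x"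
proof (rule X_tendsto[OF x])
  obtain u v where uv: "p = (u, v)" "0 \<le> u" "u \<le> S" "0 \<le> v" "v \<le> T" using p by auto
  show "(\<lambda>m. fst (gp (Suc m) p)) \<longlonglongrightarrow> fst p" "(\<lambda>m. snd (gp (Suc m) p)) \<longlonglongrightarrow> snd p"
    using floor_grid_tendsto[OF S_pos uv(2)] floor_grid_tendsto[OF T_pos uv(4)]
    by (simp_all add: uv(1) gp_def gs_def gt_def)
  show "fst (gp (Suc m) p) \<in> {0..S}" "snd (gp (Suc m) p) \<in> {0..T}" for m
    using gp_bounds[OF p, of "Suc m"] by (auto simp: mem_Times_iff)
qed (use p in auto)

lemma lin_comb_tendsto:
  assumes x: "x \<in> space M" and ps: "snd ` set ps \<subseteq> {0..S} \<times> {0..T}"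
  shows "(\<lambda>m. lin_comb (\<lambda>p. XR (fst (gp (Suc m) p)) (snd (gp (Suc m) p))) ps x) \<longlonglongrightarrow> lin_comb (\<lambda>p. XR (fst p) (snd p)) ps x"
    and "(\<lambda>m. lin_comb (\<lambda>p. XI (fst (gp (Suc m) p)) (snd (gp (Suc m) p))) ps x) \<longlonglongrightarrow> lin_comb (\<lambda>p. XI (fst p) (snd p)) ps x"
  using ps
proof (induction ps)
  case (Cons q ps)
  obtain c p where q: "q = (c, p)" by (cases q)
  {
    case 1
    then have "p \<in> {0..S} \<times> {0..T}" "snd ` set ps \<subseteq> {0..S} \<times> {0..T}" unfolding q by auto
    from gp_tendsto[OF x this(1)] Cons.IH(1)[OF this(2)] show ?case
      unfolding q lin_comb_simps by (intro tendsto_intros tendsto_Re)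
  next
    case 2
    then have "p \<in> {0..S} \<times> {0..T}" "snd ` set ps \<subseteq> {0..S} \<times> {0..T}" unfolding q by auto
    from gp_tendsto[OF x this(1)] Cons.IH(2)[OF this(2)] show ?case
      unfolding q lin_comb_simps by (intro tendsto_intros tendsto_Im)
  }
qed simp_all

lemma lin_comb_X_measurable:
  assumes "\<And>p. p \<in> snd ` set ps \<Longrightarrow> g p \<in> {0..S} \<times> {0..T}"
  shows "lin_comb (\<lambda>p. XR (fst (g p)) (snd (g p))) ps \<in> borel_measurable M"
    "lin_comb (\<lambda>p. XI (fst (g p)) (snd (g p))) ps \<in> borel_measurable M"
proof -
  have "X (fst (g p)) (snd (g p)) \<in> borel_measurable M" if "p \<in> snd ` set ps" for p
    using assms[OF that] by (intro X_measurable) (auto simp: mem_Times_iff)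
  note [measurable] = this
  show "lin_comb (\<lambda>p. XR (fst (g p)) (snd (g p))) ps \<in> borel_measurable M"
    "lin_comb (\<lambda>p. XI (fst (g p)) (snd (g p))) ps \<in> borel_measurable M"
    by (rule lin_comb_measurable; measurable)+
qed

text \<open>In each cell the exponent is proportional to the sum of the squares of the real and
  imaginary coefficients, without a mixed term, so the product over the cells splits into two
  products.\<close>

lemma char_factor_grid:
  assumes n: "0 < n" and ps: "snd ` set ps \<subseteq> {0..S} \<times> {0..T}" and qs: "snd ` set qs \<subseteq> {0..S} \<times> {0..T}"
  defines "LR \<equiv> lin_comb (\<lambda>p. XR (fst (gp n p)) (snd (gp n p))) ps" and "LI \<equiv> lin_comb (\<lambda>p. XI (fst (gp n p)) (snd (gp n p))) qs"
  shows "(\<integral>x. iexp (LR x + LI x) \<partial>M) = (\<integral>x. iexp (LR x) \<partial>M) * (\<integral>x. iexp (LI x) \<partial>M)"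
proof -
  define \<phi> where "\<phi> a = (\<Prod>r<n * n. exp (- ((a r)\<^sup>2 * (S / n * (T / n)) / 2)))" for a :: "nat \<Rightarrow> real"
  \<comment> \<open>Stated for arbitrary lists, since an empty list on one side yields the two
    marginal characteristic functions.\<close>
  have key: "(\<integral>x. iexp (lin_comb (\<lambda>p. XR (fst (gp n p)) (snd (gp n p))) ps x + lin_comb (\<lambda>p. XI (fst (gp n p)) (snd (gp n p))) qs x) \<partial>M)
      = complex_of_real (\<phi> (lin_comb (weight n) ps) * \<phi> (lin_comb (weight n) qs))"
    if "snd ` set ps \<subseteq> {0..S} \<times> {0..T}" "snd ` set qs \<subseteq> {0..S} \<times> {0..T}" for ps qs
  proof -
    have "(\<integral>x. iexp (lin_comb (\<lambda>p. XR (fst (gp n p)) (snd (gp n p))) ps x + lin_comb (\<lambda>p. XI (fst (gp n p)) (snd (gp n p))) qs x) \<partial>M)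
      = (\<integral>x. iexp (\<Sum>r<n * n. comb (lin_comb (weight n) ps r) (lin_comb (weight n) qs r)
          (gs n (r div n)) (gt n (r mod n)) (gs n (Suc (r div n))) (gt n (Suc (r mod n))) x) \<partial>M)"
      using that n
      by (intro Bochner_Integration.integral_cong refl) (simp add: lin_comb_grid comb_def sum.distrib)
    also have "\<dots> = complex_of_real (\<Prod>r<n * n. exp (- (((lin_comb (weight n) ps r)\<^sup>2 + (lin_comb (weight n) qs r)\<^sup>2) * (S / n * (T / n)) / 2)))"
      by (rule grid_char[OF n])
    also have "(\<Prod>r<n * n. exp (- (((lin_comb (weight n) ps r)\<^sup>2 + (lin_comb (weight n) qs r)\<^sup>2) * (S / n * (T / n)) / 2)))
        = \<phi> (lin_comb (weight n) ps) * \<phi> (lin_comb (weight n) qs)"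
      unfolding \<phi>_def prod.distrib[symmetric] exp_add[symmetric] by (intro prod.cong arg_cong[where f=exp] refl) (simp add: distrib_right add_divide_distrib)
    finally show ?thesis .
  qed
  have "\<phi> (lin_comb (weight n) []) = 1" unfolding \<phi>_def by simp
  then show ?thesis
    using key[OF ps qs] key[OF ps, of "[]"] key[OF _ qs, of "[]"] unfolding LR_def LI_def by simp
qed

text \<open>As the grid is refined the rounded points converge, hence so do the linear combinations
  along each path. Both sides pass to the limit by dominated convergence, characters being bounded
  by 1.\<close>

lemma char_factor_X_pos:
  assumes ps: "snd ` set ps \<subseteq> {0..S} \<times> {0..T}" and qs: "snd ` set qs \<subseteq> {0..S} \<times> {0..T}"
  defines "LR \<equiv> lin_comb (\<lambda>p. XR (fst p) (snd p)) ps" and "LI \<equiv> lin_comb (\<lambda>p. XI (fst p) (snd p)) qs"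
  shows "(\<integral>x. iexp (LR x + LI x) \<partial>M) = (\<integral>x. iexp (LR x) \<partial>M) * (\<integral>x. iexp (LI x) \<partial>M)"
proof -
  define R where "R m = lin_comb (\<lambda>p. XR (fst (gp (Suc m) p)) (snd (gp (Suc m) p))) ps" for m
  define I where "I m = lin_comb (\<lambda>p. XI (fst (gp (Suc m) p)) (snd (gp (Suc m) p))) qs" for m
  have [measurable]: "R m \<in> borel_measurable M" "I m \<in> borel_measurable M" for m
    unfolding R_def I_def using ps qs gp_bounds by (auto intro!: lin_comb_X_measurable)
  have [measurable]: "LR \<in> borel_measurable M" "LI \<in> borel_measurable M"
    unfolding LR_def LI_def using lin_comb_X_measurable[of ps "\<lambda>p. p"] lin_comb_X_measurable[of qs "\<lambda>p. p"] ps qs by auto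
  have Rl: "(\<lambda>m. R m x) \<longlonglongrightarrow> LR x" if "x \<in> space M" for x
    unfolding R_def LR_def by (rule lin_comb_tendsto(1)[OF that ps])
  have Il: "(\<lambda>m. I m x) \<longlonglongrightarrow> LI x" if "x \<in> space M" for x
    unfolding I_def LI_def by (rule lin_comb_tendsto(2)[OF that qs])
  have lim: "(\<lambda>m. \<integral>x. iexp (f m x) \<partial>M) \<longlonglongrightarrow> (\<integral>x. iexp (g x) \<partial>M)"
    if "\<And>m. f m \<in> borel_measurable M" "g \<in> borel_measurable M" "\<And>x. x \<in> space M \<Longrightarrow> (\<lambda>m. f m x) \<longlonglongrightarrow> g x"
    for f :: "nat \<Rightarrow> 'a \<Rightarrow> real" and g
    by (rule integral_dominated_convergence[where w="\<lambda>_. 1"])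
      (use that in \<open>auto intro!: tendsto_intros tendsto_of_real\<close>)
  have "(\<lambda>m. \<integral>x. iexp (R m x + I m x) \<partial>M) \<longlonglongrightarrow> (\<integral>x. iexp (LR x + LI x) \<partial>M)"
    by (rule lim) (auto intro!: tendsto_add Rl Il)
  moreover have "(\<lambda>m. (\<integral>x. iexp (R m x) \<partial>M) * (\<integral>x. iexp (I m x) \<partial>M)) \<longlonglongrightarrow> (\<integral>x. iexp (LR x) \<partial>M) * (\<integral>x. iexp (LI x) \<partial>M)"
    by (intro tendsto_mult lim Rl Il) auto
  moreover have "(\<integral>x. iexp (R m x + I m x) \<partial>M) = (\<integral>x. iexp (R m x) \<partial>M) * (\<integral>x. iexp (I m x) \<partial>M)" for m
    unfolding R_def I_def by (rule char_factor_grid[OF _ ps qs]) simp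
  ultimately show ?thesis by (simp add: LIMSEQ_unique)
qed

end

lemma char_factor_X:
  assumes ps: "snd ` set ps \<subseteq> {0..S} \<times> {0..T}" and qs: "snd ` set qs \<subseteq> {0..S} \<times> {0..T}"
  shows "(\<integral>x. iexp (lin_comb (\<lambda>p. XR (fst p) (snd p)) ps x + lin_comb (\<lambda>p. XI (fst p) (snd p)) qs x) \<partial>M)
    = (\<integral>x. iexp (lin_comb (\<lambda>p. XR (fst p) (snd p)) ps x) \<partial>M) * (\<integral>x. iexp (lin_comb (\<lambda>p. XI (fst p) (snd p)) qs x) \<partial>M)"
proof (cases "0 < S \<and> 0 < T")
  case True
  then show ?thesis using char_factor_X_pos[OF _ _ ps qs] by simp
next
  case False
  \<comment> \<open>If \<open>S\<close> or \<open>T\<close> is not positive, the parameter set is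
    empty or contained in an axis, where the process vanishes.\<close>
  have "X (fst p) (snd p) x = 0" if "x \<in> space M" "p \<in> {0..S} \<times> {0..T}" for x p
  proof -
    have "fst p = 0 \<or> snd p = 0" using False that by (auto simp: mem_Times_iff)
    then show ?thesis using that X_s0[of "fst p" x] X_0t[of "snd p" x] by (auto simp: mem_Times_iff)
  qed
  then have z: "lin_comb (\<lambda>p. XR (fst p) (snd p)) ps x = 0" if "x \<in> space M" for x
    using ps that by (induction ps) (auto simp: lin_comb_def)
  have "(\<integral>x. iexp (lin_comb (\<lambda>p. XR (fst p) (snd p)) ps x + lin_comb (\<lambda>p. XI (fst p) (snd p)) qs x) \<partial>M)
      = (\<integral>x. iexp (lin_comb (\<lambda>p. XI (fst p) (snd p)) qs x) \<partial>M)"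
    by (intro Bochner_Integration.integral_cong) (simp_all add: z)
  moreover have "(\<integral>x. iexp (lin_comb (\<lambda>p. XR (fst p) (snd p)) ps x) \<partial>M) = (\<integral>x. 1 \<partial>M)"
    by (intro Bochner_Integration.integral_cong) (simp_all add: z)
  ultimately show ?thesis by (simp add: prob_space)
qed

lemma proc_sigma_eq:
  "proc_sigma M S T Y = sigma_sets (space M) {(\<lambda>p. Y (fst p) (snd p)) i -` B \<inter> space M |i B. i \<in> {0..S} \<times> {0..T} \<and> B \<in> sets borel}"
  unfolding proc_sigma_def by (rule arg_cong[where f="sigma_sets _"]) force

lemma indep_processes: "indep_set (proc_sigma M S T XR) (proc_sigma M S T XI)"
  unfolding proc_sigma_eq
proof (rule indep_set_of_char)
  fix p assume "p \<in> {0..S} \<times> {0..T}"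
  then have [measurable]: "X (fst p) (snd p) \<in> borel_measurable M"
    by (intro X_measurable) (auto simp: mem_Times_iff)
  show "XR (fst p) (snd p) \<in> borel_measurable M" "XI (fst p) (snd p) \<in> borel_measurable M" by measurable
qed (rule char_factor_X)

lemma is_complex_brownian_sheet: "complex_brownian_sheet M F S T X"
proof -
  have incr: "indep_set {rect_incr XR s t s' t' -` B \<inter> space M |B. B \<in> sets borel} (sets (J s t))
      \<and> distributed M lborel (rect_incr XR s t s' t') (normal_density 0 (sqrt ((s' - s) * (t' - t))))"
    "indep_set {rect_incr XI s t s' t' -` B \<inter> space M |B. B \<in> sets borel} (sets (J s t))
      \<and> distributed M lborel (rect_incr XI s t s' t') (normal_density 0 (sqrt ((s' - s) * (t' - t))))"
    if st: "0 \<le> s" "0 \<le> t" "s < s'" "t < t'" "s' \<le> S" "t' \<le> T" for s t s' t'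
  proof -
    have J: "subalgebra M (J s t)" using st by (intro subalgebra_J) auto
    have m: "rect_incr XR s t s' t' \<in> borel_measurable M" "rect_incr XI s t s' t' \<in> borel_measurable M"
      using st by (auto intro!: rect_incr_measurable)
    have c: "0 < (s' - s) * (t' - t)" using st by simp
    have "(\<integral>x. indicator A x * iexp (u * rect_incr XR s t s' t' x) \<partial>M)
        = complex_of_real (exp (- (u\<^sup>2 * ((s' - s) * (t' - t)) / 2)) * prob A)" if "A \<in> sets (J s t)" for u A
      using char_comb[OF st(1,3,2,4,5,6) that, of u 0] by (simp add: comb_def)
    from indep_increment[OF J m(1) this c]
    show "indep_set {rect_incr XR s t s' t' -` B \<inter> space M |B. B \<in> sets borel} (sets (J s t))
      \<and> distributed M lborel (rect_incr XR s t s' t') (normal_density 0 (sqrt ((s' - s) * (t' - t))))" by blast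
    have "(\<integral>x. indicator A x * iexp (u * rect_incr XI s t s' t' x) \<partial>M)
        = complex_of_real (exp (- (u\<^sup>2 * ((s' - s) * (t' - t)) / 2)) * prob A)" if "A \<in> sets (J s t)" for u A
      using char_comb[OF st(1,3,2,4,5,6) that, of 0 u] by (simp add: comb_def)
    from indep_increment[OF J m(2) this c]
    show "indep_set {rect_incr XI s t s' t' -` B \<inter> space M |B. B \<in> sets borel} (sets (J s t))
      \<and> distributed M lborel (rect_incr XI s t s' t') (normal_density 0 (sqrt ((s' - s) * (t' - t))))" by blast
  qed
  show ?thesis
    unfolding complex_brownian_sheet_def brownian_sheet_def
    using incr indep_processes X_s0 X_0t by (auto intro!: XR_XI_measurable)
qed

end

section \<open>From Brownian sheets to strong martingales\<close>

context prob_space begin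

lemma cond_exp_constI:
  fixes f :: "'a \<Rightarrow> real"
  assumes G: "subalgebra M G" and f: "integrable M f"
    and c: "\<And>A. A \<in> sets G \<Longrightarrow> (\<integral>x. f x * indicator A x \<partial>M) = c * prob A"
  shows "AE x in M. real_cond_exp M G f x = c"
proof -
  interpret G: sigma_finite_subalgebra M G by (rule sigma_finite_subalgebraI[OF G])
  show ?thesis
  proof (rule G.real_cond_exp_charact)
    fix A assume A: "A \<in> sets G"
    then have "A \<in> sets M" using G by (auto simp: subalgebra_def)
    then show "(\<integral>x\<in>A. f x \<partial>M) = (\<integral>x\<in>A. c \<partial>M)"
      using c[OF A] by (simp add: set_lebesgue_integral_def mult.commute)
  qed (use f in auto)
qed

lemma indep_var_of_preimages:
  fixes Y Z :: "'a \<Rightarrow> real"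
  assumes "Y \<in> borel_measurable M" "Z \<in> borel_measurable M" and ind: "indep_set \<A> \<B>"
    and "\<And>B. B \<in> sets borel \<Longrightarrow> Y -` B \<inter> space M \<in> \<A>" "\<And>B. B \<in> sets borel \<Longrightarrow> Z -` B \<inter> space M \<in> \<B>"
  shows "indep_var borel Y borel Z"
  unfolding indep_var_eq
proof (intro conjI indep_set_sigma_sets)
  have st: "Int_stable {h -` B \<inter> space M |B. B \<in> sets borel}" for h :: "'a \<Rightarrow> real"
  proof (rule Int_stableI, clarify)
    fix B C :: "real set" assume "B \<in> sets borel" "C \<in> sets borel"
    then show "\<exists>D. h -` B \<inter> space M \<inter> (h -` C \<inter> space M) = h -` D \<inter> space M \<and> D \<in> sets borel"
      by (intro exI[of _ "B \<inter> C"]) auto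
  qed
  show "Int_stable {Y -` B \<inter> space M |B. B \<in> sets borel}" "Int_stable {Z -` B \<inter> space M |B. B \<in> sets borel}"
    by (rule st)+
  show "indep_set {Y -` B \<inter> space M |B. B \<in> sets borel} {Z -` B \<inter> space M |B. B \<in> sets borel}"
    using ind assms(4,5) unfolding indep_sets2_eq by blast
qed (use assms in auto)

lemma integral_indep_indicator:
  fixes Y :: "'a \<Rightarrow> real" and f :: "real \<Rightarrow> real"
  assumes Y: "Y \<in> borel_measurable M" and G: "subalgebra M G"
    and ind: "indep_set {Y -` B \<inter> space M |B. B \<in> sets borel} (sets G)" and A: "A \<in> sets G"
    and f [measurable]: "f \<in> borel_measurable borel" and i: "integrable M (\<lambda>x. f (Y x))"
  shows "(\<integral>x. f (Y x) * indicator A x \<partial>M) = (\<integral>x. f (Y x) \<partial>M) * prob A"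
proof -
  have AM [measurable]: "A \<in> sets M" using A G by (auto simp: subalgebra_def)
  have im: "(indicator A :: 'a \<Rightarrow> real) \<in> borel_measurable G" using A by simp
  have "indicator A -` B \<inter> space M \<in> sets G" if "B \<in> sets borel" for B :: "real set"
    using measurable_sets[OF im that] G by (simp add: subalgebra_def)
  then have "indep_var borel Y borel (indicator A :: 'a \<Rightarrow> real)"
    by (intro indep_var_of_preimages[OF Y _ ind]) auto
  then have "indep_var borel (f \<circ> Y) borel ((\<lambda>x. x) \<circ> (indicator A :: 'a \<Rightarrow> real))"
    by (rule indep_var_compose) auto
  from indep_var_lebesgue_integral[OF this] i show ?thesis
    by (simp add: o_def less_top[symmetric])
qed

lemma normal_moments:
  assumes d: "distributed M lborel Y (normal_density 0 (sqrt c))" and c: "0 < c"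
  shows "integrable M Y" "(\<integral>x. Y x \<partial>M) = 0" "integrable M (\<lambda>x. (Y x)\<^sup>2)" "(\<integral>x. (Y x)\<^sup>2 \<partial>M) = c"
proof -
  have Y: "Y \<in> borel_measurable M" using distributed_measurable[OF d] by simp
  have "integrable lborel (\<lambda>x. normal_density 0 (sqrt c) x * x ^ 2)"
    using integrable_normal_moment[of "sqrt c" 0 2] c by simp
  then show i2: "integrable M (\<lambda>x. (Y x)\<^sup>2)"
    by (subst distributed_integrable[OF d, symmetric]) auto
  then show "integrable M Y" by (rule integrable_of_square[OF Y])
  have "(\<integral>x. (Y x)\<^sup>2 \<partial>M) = (\<integral>x. normal_density 0 (sqrt c) x * x ^ 2 \<partial>lborel)"
    by (rule distributed_integral[OF d, symmetric]) auto
  also have "\<dots> = c"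
    using integral_normal_moment_even[of "sqrt c" 0 1] c by simp
  finally show "(\<integral>x. (Y x)\<^sup>2 \<partial>M) = c" .
  show "(\<integral>x. Y x \<partial>M) = 0"
    using normal_distributed_expectation[OF _ d] c by simp
qed

end

context planar_process
begin

lemma brownian_incr_moments:
  assumes bs: "brownian_sheet M F S T Y" and st: "0 \<le> s" "0 \<le> t" "s < s'" "t < t'" "s' \<le> S" "t' \<le> T"
  shows "rect_incr Y s t s' t' \<in> borel_measurable M"
    "integrable M (rect_incr Y s t s' t')" "integrable M (\<lambda>x. (rect_incr Y s t s' t' x)\<^sup>2)"
    "A \<in> sets (J s t) \<Longrightarrow> (\<integral>x. rect_incr Y s t s' t' x * indicator A x \<partial>M) = 0"
    "A \<in> sets (J s t) \<Longrightarrow> (\<integral>x. (rect_incr Y s t s' t' x)\<^sup>2 * indicator A x \<partial>M) = (s' - s) * (t' - t) * prob A"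
proof -
  have d: "distributed M lborel (rect_incr Y s t s' t') (normal_density 0 (sqrt ((s' - s) * (t' - t))))"
    and ind: "indep_set {rect_incr Y s t s' t' -` B \<inter> space M |B. B \<in> sets borel} (sets (J s t))"
    using bs st unfolding brownian_sheet_def by blast+
  have c: "0 < (s' - s) * (t' - t)" using st by simp
  note m = normal_moments[OF d c]
  have J: "subalgebra M (J s t)" using st by (intro subalgebra_J) auto
  show Y: "rect_incr Y s t s' t' \<in> borel_measurable M" using distributed_measurable[OF d] by simp
  show "integrable M (rect_incr Y s t s' t')" "integrable M (\<lambda>x. (rect_incr Y s t s' t' x)\<^sup>2)" by (rule m)+
  assume A: "A \<in> sets (J s t)"
  show "(\<integral>x. rect_incr Y s t s' t' x * indicator A x \<partial>M) = 0"
    using integral_indep_indicator[OF Y J ind A, of "\<lambda>x. x"] m by simp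
  show "(\<integral>x. (rect_incr Y s t s' t' x)\<^sup>2 * indicator A x \<partial>M) = (s' - s) * (t' - t) * prob A"
    using integral_indep_indicator[OF Y J ind A, of "\<lambda>x. x\<^sup>2"] m by simp
qed

text \<open>\<open>Y s t\<close> is the increment over the rectangle from the origin, hence
  integrable as a normal variable. Vanishing on the axes is assumed pointwise because
  \<open>strong_martingale\<close> demands it everywhere and \<open>brownian_sheet\<close> gives it
  almost surely.\<close>

lemma strong_martingale_of_brownian_sheet:
  assumes bs: "brownian_sheet M F S T Y"
    and Y0: "\<And>s x. 0 \<le> s \<Longrightarrow> s \<le> S \<Longrightarrow> x \<in> space M \<Longrightarrow> Y s 0 x = 0"
      "\<And>t x. 0 \<le> t \<Longrightarrow> t \<le> T \<Longrightarrow> x \<in> space M \<Longrightarrow> Y 0 t x = 0"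
  shows "strong_martingale M F S T Y"
proof -
  have "integrable M (Y s t)" if st: "0 \<le> s" "s \<le> S" "0 \<le> t" "t \<le> T" for s t
  proof (cases "s = 0 \<or> t = 0")
    case True
    then have "Y s t x = 0" if "x \<in> space M" for x using Y0 st that by auto
    then show ?thesis by (subst Bochner_Integration.integrable_cong[OF refl, of M _ "\<lambda>_. 0"]) auto
  next
    case False
    then have "integrable M (rect_incr Y 0 0 s t)" using st by (intro brownian_incr_moments(2)[OF bs]) auto
    moreover have "rect_incr Y 0 0 s t x = Y s t x" if "x \<in> space M" for x
      using Y0[of _ x] st that by (simp add: rect_incr_def)
    ultimately show ?thesis by (subst (asm) Bochner_Integration.integrable_cong[OF refl]) auto
  qed
  moreover have "AE x in M. real_cond_exp M (J s t) (rect_incr Y s t s' t') x = 0"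
    if "0 \<le> s" "0 \<le> t" "s < s'" "t < t'" "s' \<le> S" "t' \<le> T" for s t s' t'
    using that brownian_incr_moments[OF bs that] by (intro cond_exp_constI subalgebra_J) auto
  ultimately show ?thesis
    using bs Y0 unfolding strong_martingale_def brownian_sheet_def by auto
qed

lemma cond_var_of_brownian_sheet:
  assumes bs: "brownian_sheet M F S T Y" and st: "0 \<le> s" "0 \<le> t" "s \<le> s'" "t \<le> t'" "s' \<le> S" "t' \<le> T"
  shows "AE x in M. real_cond_exp M (F s T) (\<lambda>x. (rect_incr Y s t s' t' x)\<^sup>2) x = (s' - s) * (t' - t)"
proof (rule cond_exp_constI)
  show "subalgebra M (F s T)" using st by (intro subalgebra_F) auto
  have FJ: "sets (F s T) \<subseteq> sets (J s t)" using st by (intro F_subset_J) auto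
  have "integrable M (\<lambda>x. (rect_incr Y s t s' t' x)\<^sup>2) \<and>
    (\<forall>A\<in>sets (F s T). (\<integral>x. (rect_incr Y s t s' t' x)\<^sup>2 * indicator A x \<partial>M) = (s' - s) * (t' - t) * prob A)"
  proof (cases "s < s' \<and> t < t'")
    case True
    then show ?thesis using brownian_incr_moments[OF bs, of s t s' t'] st FJ by auto
  qed (use st in \<open>auto simp: rect_incr_degenerate\<close>)
  then show "integrable M (\<lambda>x. (rect_incr Y s t s' t' x)\<^sup>2)"
    "\<And>A. A \<in> sets (F s T) \<Longrightarrow> (\<integral>x. (rect_incr Y s t s' t' x)\<^sup>2 * indicator A x \<partial>M) = (s' - s) * (t' - t) * prob A"
    by auto
qed

text \<open>\<open>proc_sigma\<close> recast as a measure, so that measurability of functions with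
  respect to it can be expressed.\<close>

definition proc_alg where "proc_alg s t Y = sigma (space M)
  {Y u v -` B \<inter> space M |u v B. 0 \<le> u \<and> u \<le> s \<and> 0 \<le> v \<and> v \<le> t \<and> B \<in> sets borel}" for Y :: "real \<Rightarrow> real \<Rightarrow> 'a \<Rightarrow> real"

lemma sets_proc_alg: "sets (proc_alg s t Y) = proc_sigma M s t Y" and space_proc_alg: "space (proc_alg s t Y) = space M"
  unfolding proc_alg_def proc_sigma_def by (subst sets_measure_of space_measure_of; auto)+

lemma proc_alg_measurable: "0 \<le> u \<Longrightarrow> u \<le> s \<Longrightarrow> 0 \<le> v \<Longrightarrow> v \<le> t \<Longrightarrow> Y u v \<in> borel_measurable (proc_alg s t Y)"
  by (rule measurableI) (auto simp: sets_proc_alg space_proc_alg proc_sigma_def intro!: sigma_sets.Basic)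

lemma proc_sigma_mono: "s \<le> s' \<Longrightarrow> t \<le> t' \<Longrightarrow> proc_sigma M s t Y \<subseteq> proc_sigma M s' t' Y"
  unfolding proc_sigma_def by (rule sigma_sets_mono') (blast intro: order_trans)

lemma proc_sigma_subset_F: "proc_sigma M s t XR \<subseteq> sets (F s t)" "proc_sigma M s t XI \<subseteq> sets (F s t)"
proof -
  have "sigma_sets (space (F s t)) {Y u v -` B \<inter> space M |u v B. 0 \<le> u \<and> u \<le> s \<and> 0 \<le> v \<and> v \<le> t \<and> B \<in> sets borel} \<subseteq> sets (F s t)"
    if "\<And>u v. 0 \<le> u \<Longrightarrow> u \<le> s \<Longrightarrow> 0 \<le> v \<Longrightarrow> v \<le> t \<Longrightarrow> Y u v \<in> borel_measurable (F s t)" for Y :: "real \<Rightarrow> real \<Rightarrow> 'a \<Rightarrow> real"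
    using measurable_sets[OF that] by (intro sets.sigma_sets_subset) auto
  from this[of XR] this[of XI] show "proc_sigma M s t XR \<subseteq> sets (F s t)" "proc_sigma M s t XI \<subseteq> sets (F s t)"
    unfolding proc_sigma_def using XR_XI_measurable by auto
qed

lemma rect_incr_proc_alg:
  assumes "0 \<le> s" "s \<le> s'" "0 \<le> t" "t \<le> t'" "s' \<le> S" "t' \<le> T"
  shows "rect_incr Y s t s' t' \<in> borel_measurable (proc_alg S T Y)"
  unfolding rect_incr_def[abs_def] using assms
  by (auto intro!: borel_measurable_diff borel_measurable_add proc_alg_measurable)

text \<open>A preimage of a complex Borel set need not be an intersection of the two kinds. But both
  parts are measurable for the sigma-algebra generated on the right, since either factor of an
  intersection may be the whole space, and therefore so is the complex process. The null sets are
  those adjoined in \<open>nat_filt\<close>.\<close>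

lemma sets_F_generator:
  "sets (F s T) \<subseteq> sigma_sets (space M) ({A \<inter> B |A B. A \<in> proc_sigma M s T XR \<and> B \<in> proc_sigma M s T XI} \<union> null_sets M)"
proof -
  define P where "P = {A \<inter> B |A B. A \<in> proc_sigma M s T XR \<and> B \<in> proc_sigma M s T XI} \<union> null_sets M"
  have sub: "A \<subseteq> space M" if "A \<in> proc_sigma M s T Y" for A Y
    using that unfolding sets_proc_alg[symmetric] using sets.sets_into_space[of A "proc_alg s T Y"] by (simp add: space_proc_alg)
  have top: "space M \<in> proc_sigma M s T Y" for Y unfolding proc_sigma_def by (rule sigma_sets_top)
  have P: "P \<subseteq> Pow (space M)" unfolding P_def using sub sets.sets_into_space by blast
  define N where "N = sigma (space M) P"
  have N: "space N = space M" "sets N = sigma_sets (space M) P" unfolding N_def using P by auto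
  have AB_P: "A \<inter> B \<in> P" if "A \<in> proc_sigma M s T XR" "B \<in> proc_sigma M s T XI" for A B
    unfolding P_def using that by blast
  have PR: "proc_sigma M s T XR \<subseteq> P"
    using AB_P[OF _ top] sub by (metis Int_absorb2 subsetI)
  have PI: "proc_sigma M s T XI \<subseteq> P"
    using AB_P[OF top] sub by (metis Int_absorb1 subsetI)
  have X: "X u v \<in> borel_measurable N" if uv: "0 \<le> u" "u \<le> s" "0 \<le> v" "v \<le> T" for u v
  proof -
    have "subalgebra N (proc_alg s T XR)" "subalgebra N (proc_alg s T XI)"
      using PR PI unfolding subalgebra_def N sets_proc_alg space_proc_alg by auto
    from measurable_from_subalg[OF this(1) proc_alg_measurable[OF uv]] measurable_from_subalg[OF this(2) proc_alg_measurable[OF uv]]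
    have "XR u v \<in> borel_measurable N" "XI u v \<in> borel_measurable N" .
    then have "(\<lambda>x. complex_of_real (XR u v x) + \<i> * complex_of_real (XI u v x)) \<in> borel_measurable N" by measurable
    then show ?thesis by (simp add: complex_eq[symmetric])
  qed
  have "{X u v -` B \<inter> space M |u v B. 0 \<le> u \<and> u \<le> s \<and> 0 \<le> v \<and> v \<le> T \<and> B \<in> sets borel} \<subseteq> sets N"
    using measurable_sets[OF X] unfolding N(1) by blast
  moreover have "null_sets M \<subseteq> sets N" unfolding N P_def by auto
  ultimately have "sets (F s T) \<subseteq> sets N"
    unfolding sets_F N(1)[symmetric] by (intro sets.sigma_sets_subset Un_least)
  then show ?thesis unfolding N(2) P_def .
qed

text \<open>Over an intersection of \<open>A\<close> from the real and \<open>B\<close> from the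
  imaginary part, the integrand is the product of \<open>f x * indicator A x\<close> and
  \<open>g x * indicator B x\<close>. Each factor is measurable for the sigma-algebra of its own
  part, so the integral factorises, and the first factor has mean 0 because \<open>A\<close> lies in
  \<open>J s t\<close>. A pi-lambda argument extends this to all of \<open>F s T\<close>.\<close>

lemma cond_cov_of_complex_brownian_sheet:
  assumes cbs: "complex_brownian_sheet M F S T X"
    and st: "0 \<le> s" "0 \<le> t" "s < s'" "t < t'" "s' \<le> S" "t' \<le> T" and A: "A \<in> sets (F s T)"
  shows "(\<integral>x. rect_incr XR s t s' t' x * rect_incr XI s t s' t' x * indicator A x \<partial>M) = 0"
proof -
  define f where "f = rect_incr XR s t s' t'"
  define g where "g = rect_incr XI s t s' t'"
  define P where "P = {A \<inter> B |A B. A \<in> proc_sigma M s T XR \<and> B \<in> proc_sigma M s T XI} \<union> null_sets M"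
  have bs: "brownian_sheet M F S T XR" "brownian_sheet M F S T XI"
    and ind: "indep_set (proc_sigma M S T XR) (proc_sigma M S T XI)"
    using cbs unfolding complex_brownian_sheet_def by auto
  note mf = brownian_incr_moments[OF bs(1) st, folded f_def]
  note mg = brownian_incr_moments[OF bs(2) st, folded g_def]
  have fg: "integrable M (\<lambda>x. f x * g x)" by (rule integrable_mult_of_squares[OF mf(1) mg(1) mf(3) mg(3)])
  have F: "subalgebra M (F s T)" using st by (intro subalgebra_F) auto
  have FJ: "sets (F s T) \<subseteq> sets (J s t)" using st by (intro F_subset_J) auto
  have PM: "P \<subseteq> sets M"
    using F proc_sigma_subset_F[of s T] unfolding P_def subalgebra_def by blast
  have stable: "Int_stable P"
  proof (rule Int_stableI)
    fix A B assume A: "A \<in> P" and B: "B \<in> P"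
    have AB: "A \<in> sets M" "B \<in> sets M" using A B PM by auto
    show "A \<inter> B \<in> P"
    \<comment> \<open>Adjoining the null sets preserves stability under intersection, as a
      measurable subset of a null set is null.\<close>
    proof (cases "A \<in> null_sets M \<or> B \<in> null_sets M")
      case True
      then have "A \<inter> B \<in> null_sets M"
        using AB null_set_Int1[of A M B] null_set_Int1[of B M A] by (auto simp: Int_commute)
      then show ?thesis unfolding P_def by simp
    next
      case False
      then obtain A1 A2 B1 B2 where AB: "A = A1 \<inter> A2" "B = B1 \<inter> B2"
        "A1 \<in> proc_sigma M s T XR" "B1 \<in> proc_sigma M s T XR" "A2 \<in> proc_sigma M s T XI" "B2 \<in> proc_sigma M s T XI"
        using A B unfolding P_def by blast
      then have "A1 \<inter> B1 \<in> proc_sigma M s T XR" "A2 \<inter> B2 \<in> proc_sigma M s T XI"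
        unfolding sets_proc_alg[symmetric] by auto
      moreover have "A \<inter> B = (A1 \<inter> B1) \<inter> (A2 \<inter> B2)" using AB by auto
      ultimately show ?thesis unfolding P_def by blast
    qed
  qed
  have basic: "(\<integral>x. f x * g x * indicator D x \<partial>M) = 0" if D: "D \<in> P" for D
  proof (cases "D \<in> null_sets M")
    case True
    have "(\<integral>x. f x * g x * indicator D x \<partial>M) = (\<integral>x. 0 \<partial>M)"
      using AE_not_in[OF True] mf(1) mg(1) PM D by (intro integral_cong_AE) auto
    then show ?thesis by simp
  next
    case False
    then obtain A B where AB: "D = A \<inter> B" "A \<in> proc_sigma M s T XR" "B \<in> proc_sigma M s T XI"
      using D unfolding P_def by blast
    have ABF: "A \<in> sets (F s T)" "B \<in> sets (F s T)" using AB(2,3) proc_sigma_subset_F[of s T] by blast+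
    then have ABM [measurable]: "A \<in> sets M" "B \<in> sets M" using F by (auto simp: subalgebra_def)
    have iA: "integrable M (\<lambda>x. f x * indicator A x)" and iB: "integrable M (\<lambda>x. g x * indicator B x)"
      using integrable_mult_indicator[OF ABM(1) mf(2)] integrable_mult_indicator[OF ABM(2) mg(2)]
      by (simp_all add: mult.commute)
    have "A \<in> sets (proc_alg S T XR)" "B \<in> sets (proc_alg S T XI)"
      unfolding sets_proc_alg using AB(2,3) subsetD[OF proc_sigma_mono[of s S T T]] st by auto
    then have m: "(\<lambda>x. f x * indicator A x) \<in> borel_measurable (proc_alg S T XR)"
      "(\<lambda>x. g x * indicator B x) \<in> borel_measurable (proc_alg S T XI)"
      unfolding f_def g_def using rect_incr_proc_alg[of s s' t t'] st
      by (auto intro!: borel_measurable_times)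
    have "indep_var borel (\<lambda>x. f x * indicator A x) borel (\<lambda>x. g x * indicator B x)"
    proof (rule indep_var_of_preimages[OF _ _ ind])
      fix C :: "real set" assume "C \<in> sets borel"
      then show "(\<lambda>x. f x * indicator A x) -` C \<inter> space M \<in> proc_sigma M S T XR"
        "(\<lambda>x. g x * indicator B x) -` C \<inter> space M \<in> proc_sigma M S T XI"
        using measurable_sets[OF m(1)] measurable_sets[OF m(2)] by (auto simp: sets_proc_alg space_proc_alg)
    qed (use iA iB in auto)
    from indep_var_lebesgue_integral[OF this iA iB]
    have "(\<integral>x. f x * indicator A x * (g x * indicator B x) \<partial>M) = 0"
      using mf(4)[of A] FJ ABF by auto
    moreover have "f x * indicator A x * (g x * indicator B x) = f x * g x * indicator D x" for x
      by (simp add: AB(1) indicator_inter_arith)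
    ultimately show ?thesis by simp
  qed
  have full: "(\<integral>x. f x * g x \<partial>M) = 0"
  proof -
    have "space M \<in> P" unfolding P_def proc_sigma_def using sigma_sets_top by blast
    from basic[OF this] show ?thesis
      by (subst (asm) Bochner_Integration.integral_cong[of M M _ "\<lambda>x. f x * g x"]) auto
  qed
  have sig: "sigma_sets (space M) P \<subseteq> sets M" using PM by (rule sets.sigma_sets_subset)
  have ifg: "integrable M (\<lambda>x. f x * g x * indicator D x)" if "D \<in> sets M" for D
    using integrable_mult_indicator[OF that fg] by (simp add: mult.commute)
  have PP: "P \<subseteq> Pow (space M)" using PM sets.sets_into_space by blast
  have A': "A \<in> sigma_sets (space M) P" using A sets_F_generator unfolding P_def by blast
  from stable PP A' have "(\<integral>x. f x * g x * indicator A x \<partial>M) = 0"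
  proof (rule sigma_sets_induct_disjoint)
    fix D assume D: "D \<in> sigma_sets (space M) P" and IH: "(\<integral>x. f x * g x * indicator D x \<partial>M) = 0"
    then have DM: "D \<in> sets M" using sig by blast
    have "(\<integral>x. f x * g x * indicator (space M - D) x \<partial>M) = (\<integral>x. f x * g x - f x * g x * indicator D x \<partial>M)"
      by (intro Bochner_Integration.integral_cong) (auto simp: indicator_def)
    also have "\<dots> = 0" using fg ifg[OF DM] full IH by simp
    finally show "(\<integral>x. f x * g x * indicator (space M - D) x \<partial>M) = 0" .
  next
    fix D :: "nat \<Rightarrow> 'a set" assume D: "disjoint_family D" "range D \<subseteq> sigma_sets (space M) P"
      and IH: "\<And>i. (\<integral>x. f x * g x * indicator (D i) x \<partial>M) = 0"
    then have DM: "D i \<in> sets M" for i using sig by blast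
    then have "set_integrable M (\<Union>i. D i) (\<lambda>x. f x * g x)"
      unfolding set_integrable_def by (intro integrable_mult_indicator fg) auto
    from lebesgue_integral_countable_add[OF DM _ this] D(1) IH
    show "(\<integral>x. f x * g x * indicator (\<Union>i. D i) x \<partial>M) = 0"
      by (simp add: set_lebesgue_integral_def mult.commute disjoint_family_on_def)
  qed (use basic in auto)
  then show ?thesis unfolding f_def g_def .
qed

end

theorem theorem4p1:
  fixes M :: "'a measure" and X :: "real \<Rightarrow> real \<Rightarrow> 'a \<Rightarrow> complex" and S T :: real
  assumes "prob_space M"
    and "\<forall>s\<in>{0..S}. \<forall>t\<in>{0..T}. X s t \<in> borel_measurable M"
    and "\<forall>\<omega>\<in>space M. continuous_on ({0..S} \<times> {0..T}) (\<lambda>(s, t). X s t \<omega>)"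
    and "\<forall>s\<in>{0..S}. \<forall>\<omega>\<in>space M. X s 0 \<omega> = 0"
    and "\<forall>t\<in>{0..T}. \<forall>\<omega>\<in>space M. X 0 t \<omega> = 0"
  shows "complex_brownian_sheet M (nat_filt M X) S T X \<longleftrightarrow>
    (strong_martingale M (nat_filt M X) S T (\<lambda>s t \<omega>. Re (X s t \<omega>)) \<and>
     strong_martingale M (nat_filt M X) S T (\<lambda>s t \<omega>. Im (X s t \<omega>)) \<and>
     (\<forall>s t s' t'. 0 < s \<and> 0 < t \<and> s \<le> s' \<and> t \<le> t' \<and> s' \<le> S \<and> t' \<le> T \<longrightarrow>
        (AE \<omega> in M. real_cond_exp M (nat_filt M X s T)
            (\<lambda>\<omega>. (rect_incr (\<lambda>s t \<omega>. Re (X s t \<omega>)) s t s' t' \<omega>)\<^sup>2) \<omega> = (s' - s) * (t' - t)) \<and>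
        (AE \<omega> in M. real_cond_exp M (nat_filt M X s T)
            (\<lambda>\<omega>. (rect_incr (\<lambda>s t \<omega>. Im (X s t \<omega>)) s t s' t' \<omega>)\<^sup>2) \<omega> = (s' - s) * (t' - t)) \<and>
        (AE \<omega> in M. real_cond_exp M (nat_filt M X s T)
            (\<lambda>\<omega>. rect_incr (\<lambda>s t \<omega>. Re (X s t \<omega>)) s t s' t' \<omega> *
                  rect_incr (\<lambda>s t \<omega>. Im (X s t \<omega>)) s t s' t' \<omega>) \<omega> = 0)))"
  (is "?lhs \<longleftrightarrow> ?rhs")
proof -
  interpret prob_space M by fact
  interpret planar_process M X S T
    by unfold_locales (use assms in auto)
  show ?thesis
  proof
    assume cbs: ?lhs
    then have bs: "brownian_sheet M F S T XR" "brownian_sheet M F S T XI"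
      unfolding complex_brownian_sheet_def by auto
    have cov: "AE \<omega> in M. real_cond_exp M (F s T)
        (\<lambda>\<omega>. rect_incr XR s t s' t' \<omega> * rect_incr XI s t s' t' \<omega>) \<omega> = 0"
      if st: "0 \<le> s" "0 \<le> t" "s \<le> s'" "t \<le> t'" "s' \<le> S" "t' \<le> T" for s t s' t'
    proof (rule cond_exp_constI)
      show "subalgebra M (F s T)" using st by (intro subalgebra_F) auto
      have "integrable M (\<lambda>\<omega>. rect_incr XR s t s' t' \<omega> * rect_incr XI s t s' t' \<omega>) \<and>
        (\<forall>A\<in>sets (F s T). (\<integral>\<omega>. rect_incr XR s t s' t' \<omega> * rect_incr XI s t s' t' \<omega> * indicator A \<omega> \<partial>M) = 0)"
      proof (cases "s < s' \<and> t < t'")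
        case True
        then show ?thesis
          using brownian_incr_moments[OF bs(1), of s t s' t'] brownian_incr_moments[OF bs(2), of s t s' t'] st
            cond_cov_of_complex_brownian_sheet[OF cbs, of s t s' t']
          by (auto intro!: integrable_mult_of_squares)
      qed (use st in \<open>auto simp: rect_incr_degenerate\<close>)
      then show "integrable M (\<lambda>\<omega>. rect_incr XR s t s' t' \<omega> * rect_incr XI s t s' t' \<omega>)"
        "\<And>A. A \<in> sets (F s T) \<Longrightarrow> (\<integral>\<omega>. rect_incr XR s t s' t' \<omega> * rect_incr XI s t s' t' \<omega> * indicator A \<omega> \<partial>M) = 0 * prob A"
        by auto
    qed
    have "strong_martingale M F S T XR" "strong_martingale M F S T XI"
      using X_s0 X_0t by (auto intro!: strong_martingale_of_brownian_sheet bs)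
    moreover have "(AE \<omega> in M. real_cond_exp M (F s T) (\<lambda>\<omega>. (rect_incr XR s t s' t' \<omega>)\<^sup>2) \<omega> = (s' - s) * (t' - t)) \<and>
        (AE \<omega> in M. real_cond_exp M (F s T) (\<lambda>\<omega>. (rect_incr XI s t s' t' \<omega>)\<^sup>2) \<omega> = (s' - s) * (t' - t)) \<and>
        (AE \<omega> in M. real_cond_exp M (F s T) (\<lambda>\<omega>. rect_incr XR s t s' t' \<omega> * rect_incr XI s t s' t' \<omega>) \<omega> = 0)"
      if "0 < s \<and> 0 < t \<and> s \<le> s' \<and> t \<le> t' \<and> s' \<le> S \<and> t' \<le> T" for s t s' t'
      by (intro conjI cond_var_of_brownian_sheet bs cov) (use that in linarith)+
    ultimately show ?rhs by blast
  next
    assume rhs: ?rhs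
    interpret planar_levy M X S T
      by unfold_locales (use rhs in auto)
    show ?lhs by (rule is_complex_brownian_sheet)
  qed
qed

end
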